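(* If $\Gamma=\{r_z^1,\ldots,r_z^M\}$ is a finite set of resonance points corresponding to a non-real number $z$, then for every real $s$ the signature of the finite-rank self-adjoint operator $Q_{\bar z}(\bar\Gamma)\,J\,P_z(\Gamma)$ is equal to the $R$-index of the operator $\operatorname{Im}z\;A_z(s)P_z(\Gamma)$.
   Context: Setting. $\mathcal H,\mathcal K$ are complex separable Hilbert spaces. $F:\mathcal H\to\mathcal K$ is a closed densely defined operator with trivial kernel and co-kernel. $H_0$ is a self-adjoint operator on $\mathcal H$, $V=F^*JF$ is a self-adjoint operator with $J$ bounded self-adjoint on $\mathcal K$, and $H_s=H_0+sV$, $s\in\mathbb R$. Standing assumptions: all $H_s$ are self-adjoint with a common dense domain $\mathcal D$, $\mathcal D\subset\operatorname{dom}(F)\cap\operatorname{dom}(V)$, $V$ is relatively compact with respect to each $H_s$, and for non-real $z$ the operator $T_z(H_s):=F(H_s-z)^{-1}F^*$ (densely defined on $\operatorname{dom}F^*$) extends to a compact operator on $\mathcal K$, also denoted $T_z(H_s)$. It is also assumed that for each $s$ the norm limit $\lim_{y\to0^+}T_{\lambda+iy}(H_s)$ exists for a.e. real $\lambda$. For non-real $z$ and real $s$ put $A_z(s)=T_z(H_s)J$ and $B_z(s)=JT_z(H_s)$. As functions of $s$ they extend meromorphically to $\mathbb C$. A complex number $r_z$ is a resonance point corresponding to $z$ if it is a pole of $s\mapsto A_z(s)$ (equivalently, $(s-r_z)^{-1}$ is an eigenvalue of $A_z(s)$ for a real $s$). If $r_z$ is a resonance point corresponding to $z$, then $\bar r_z$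 is a resonance point corresponding to $\bar z$. The finite-rank idempotents $P_z(r_z)$, $Q_z(r_z)$ are $$P_z(r_z)=\frac1{2\pi i}\oint_{C}(\sigma-A_z(s))^{-1}d\sigma,\qquad Q_z(r_z)=\frac1{2\pi i}\oint_{C}(\sigma-B_z(s))^{-1}d\sigma,$$ where $C$ is a small circle enclosing only the eigenvalue $(s-r_z)^{-1}$ of $A_z(s)$; they do not depend on the real number $s$. For a finite set $\Gamma$ of resonance points corresponding to $z$: $P_z(\Gamma)=\sum_{r_z\in\Gamma}P_z(r_z)$, $Q_z(\Gamma)=\sum_{r_z\in\Gamma}Q_z(r_z)$, and $\bar\Gamma=\{\bar r_z:r_z\in\Gamma\}$. The signature of a finite-rank self-adjoint operator $M$ is $\operatorname{rank}M_+-\operatorname{rank}M_-$, where $M_\pm$ are its positive and negative parts. The $R$-index is defined for finite-rank operators $A$ which have no non-zero real eigenvalues and satisfy $A^2f=0\Rightarrow Af=0$; it equals $N_+-N_-$, where $N_+$ and $N_-$ are the numbers of eigenvalues of $A$, counting algebraic multiplicities, in the open upper and lower complex half-planes respectively. *)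

theory Defs
  imports "HOL-Complex_Analysis.Complex_Analysis"
begin

section \<open>Complex Hilbert spaces\<close>

class complex_normed_vector = real_normed_vector +
  fixes scaleC :: "complex \<Rightarrow> 'a \<Rightarrow> 'a" (infixr \<open>*\<^sub>C\<close> 75)
  assumes scaleC_add_right: "a *\<^sub>C (x + y) = a *\<^sub>C x + a *\<^sub>C y"
    and scaleC_add_left: "(a + b) *\<^sub>C x = a *\<^sub>C x + b *\<^sub>C x"
    and scaleC_scaleC: "a *\<^sub>C (b *\<^sub>C x) = (a * b) *\<^sub>C x"
    and scaleC_of_real: "complex_of_real r *\<^sub>C x = r *\<^sub>R x"
    and norm_scaleC: "norm (a *\<^sub>C x) = cmod a * norm x"

text \<open>The inner product is conjugate-linear in its first and linear in its second argument.
  The last axiom states positive definiteness and that the norm comes from the inner product.\<close>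

class complex_inner = complex_normed_vector +
  fixes cinner :: "'a \<Rightarrow> 'a \<Rightarrow> complex"
  assumes cinner_commute: "cinner x y = cnj (cinner y x)"
    and cinner_add_right: "cinner x (y + z) = cinner x y + cinner x z"
    and cinner_scaleC_right: "cinner x (a *\<^sub>C y) = a * cinner x y"
    and cinner_self: "cinner x x = complex_of_real ((norm x)\<^sup>2)"

text \<open>Separability is added where needed by the sort \<^class>\<open>second_countable_topology\<close>,
  which for metric spaces is the same thing.\<close>

class chilbert_space = complex_inner + banach

instantiation complex :: chilbert_space
begin
definition scaleC_complex :: "complex \<Rightarrow> complex \<Rightarrow> complex"
  where "scaleC_complex a x = a * x"
definition cinner_complex :: "complex \<Rightarrow> complex \<Rightarrow> complex"
  where "cinner_complex x y = cnj x * y"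
instance
  by standard
    (simp_all add: scaleC_complex_def cinner_complex_def algebra_simps norm_mult
      scaleR_conv_of_real complex_norm_square del: of_real_power)
end

global_interpretation complex_vector:
  vector_space "scaleC :: complex \<Rightarrow> 'a \<Rightarrow> 'a::complex_normed_vector"
  using scaleC_of_real[of 1]
  by unfold_locales (simp_all add: scaleC_add_right scaleC_add_left scaleC_scaleC)

section \<open>Bounded operators\<close>

text \<open>\<^typ>\<open>'a \<Rightarrow>\<^sub>L 'b\<close> consists of the bounded real-linear maps with the operator norm;
  complex linearity is a separate predicate.\<close>

instantiation blinfun :: (real_normed_vector, complex_normed_vector) complex_normed_vector
begin
lift_definition scaleC_blinfun :: "complex \<Rightarrow> ('a \<Rightarrow>\<^sub>L 'b) \<Rightarrow> ('a \<Rightarrow>\<^sub>L 'b)"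
  is "\<lambda>c f x. c *\<^sub>C f x"
proof -
  fix c :: complex and f :: "'a \<Rightarrow> 'b"
  assume f: "bounded_linear f"
  have com: "c *\<^sub>C (r *\<^sub>R y) = r *\<^sub>R (c *\<^sub>C y)" for r and y :: 'b
    by (simp flip: scaleC_of_real add: scaleC_scaleC mult.commute)
  have "bounded_linear (\<lambda>y :: 'b. c *\<^sub>C y)"
    by (rule bounded_linear_intro[where K = "cmod c"])
      (simp_all add: scaleC_add_right com norm_scaleC mult.commute)
  from bounded_linear_compose[OF this f] show "bounded_linear (\<lambda>x. c *\<^sub>C f x)" .
qed
instance
proof
  fix a b :: complex and r :: real and x y :: "'a \<Rightarrow>\<^sub>L 'b"
  show "a *\<^sub>C (x + y) = a *\<^sub>C x + a *\<^sub>C y"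
    by (transfer, simp add: scaleC_add_right)
  show "(a + b) *\<^sub>C x = a *\<^sub>C x + b *\<^sub>C x"
    by (transfer, simp add: scaleC_add_left)
  show "a *\<^sub>C (b *\<^sub>C x) = (a * b) *\<^sub>C x"
    by (transfer, simp add: scaleC_scaleC)
  show "complex_of_real r *\<^sub>C x = r *\<^sub>R x"
    by (transfer, simp add: scaleC_of_real)
  show "norm (a *\<^sub>C x) = cmod a * norm x"
  proof (transfer fixing: a)
    fix f :: "'a \<Rightarrow> 'b" assume f: "bounded_linear f"
    have "onorm (\<lambda>x. a *\<^sub>C f x) = onorm (\<lambda>x. cmod a *\<^sub>R f x)"
      by (simp add: onorm_def norm_scaleC)
    also have "\<dots> = cmod a * onorm f"
      using onorm_scaleR[OF f, of "cmod a"] by simp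
    finally show "onorm (\<lambda>x. a *\<^sub>C f x) = cmod a * onorm f" .
  qed
qed
end

definition clinear_op :: "('a::complex_normed_vector \<Rightarrow>\<^sub>L 'b::complex_normed_vector) \<Rightarrow> bool" where
  "clinear_op A \<longleftrightarrow> (\<forall>c x. A (c *\<^sub>C x) = c *\<^sub>C A x)"

definition compact_op :: "('a::complex_normed_vector \<Rightarrow>\<^sub>L 'b::complex_normed_vector) \<Rightarrow> bool" where
  "compact_op A \<longleftrightarrow> compact (closure (blinfun_apply A ` cball 0 1))"

definition self_adjoint_op :: "('a::complex_inner \<Rightarrow>\<^sub>L 'a) \<Rightarrow> bool" where
  "self_adjoint_op A \<longleftrightarrow> clinear_op A \<and> (\<forall>x y. cinner (A x) y = cinner x (A y))"

definition positive_op :: "('a::complex_inner \<Rightarrow>\<^sub>L 'a) \<Rightarrow> bool" where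
  "positive_op A \<longleftrightarrow> clinear_op A \<and> (\<forall>x. cinner x (A x) \<in> \<real>\<^sub>\<ge>\<^sub>0)"

definition is_inverse_op :: "('a::complex_normed_vector \<Rightarrow>\<^sub>L 'a) \<Rightarrow> ('a \<Rightarrow>\<^sub>L 'a) \<Rightarrow> bool" where
  "is_inverse_op A B \<longleftrightarrow> A o\<^sub>L B = id_blinfun \<and> B o\<^sub>L A = id_blinfun"

definition op_spectrum :: "('a::complex_normed_vector \<Rightarrow>\<^sub>L 'a) \<Rightarrow> complex set" where
  "op_spectrum A = {\<sigma>. \<not> (\<exists>B. is_inverse_op (\<sigma> *\<^sub>C id_blinfun - A) B)}"

definition op_resolvent ::
  "('a::complex_normed_vector \<Rightarrow>\<^sub>L 'a) \<Rightarrow> complex \<Rightarrow> ('a \<Rightarrow>\<^sub>L 'a)" where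
  "op_resolvent A \<sigma> = (THE B. is_inverse_op (\<sigma> *\<^sub>C id_blinfun - A) B)"

definition op_eigenvalue :: "('a::complex_normed_vector \<Rightarrow>\<^sub>L 'a) \<Rightarrow> complex \<Rightarrow> bool" where
  "op_eigenvalue A \<mu> \<longleftrightarrow> (\<exists>x. x \<noteq> 0 \<and> A x = \<mu> *\<^sub>C x)"

section \<open>Vector-valued complex analysis\<close>

definition vcontour_integral ::
  "(real \<Rightarrow> complex) \<Rightarrow> (complex \<Rightarrow> 'a::{complex_normed_vector,banach}) \<Rightarrow> 'a" where
  "vcontour_integral g f =
     integral {0..1} (\<lambda>t. vector_derivative g (at t within {0..1}) *\<^sub>C f (g t))"

definition vholomorphic_on ::
  "(complex \<Rightarrow> 'a::complex_normed_vector) \<Rightarrow> complex set \<Rightarrow> bool" where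
  "vholomorphic_on f S \<longleftrightarrow>
     (\<forall>s\<in>S. \<exists>D. ((\<lambda>w. inverse (w - s) *\<^sub>C (f w - f s)) \<longlongrightarrow> D) (at s within S))"

definition vmeromorphic :: "(complex \<Rightarrow> 'a::complex_normed_vector) \<Rightarrow> bool" where
  "vmeromorphic f \<longleftrightarrow>
     (\<exists>E. (\<forall>p. \<not> p islimpt E) \<and> vholomorphic_on f (- E) \<and>
          (\<forall>p\<in>E. \<exists>n L. ((\<lambda>w. (w - p) ^ n *\<^sub>C f w) \<longlongrightarrow> L) (at p)))"

section \<open>Signature and R-index\<close>

definition finite_rank :: "('a::complex_normed_vector \<Rightarrow>\<^sub>L 'b::complex_normed_vector) \<Rightarrow> bool" where
  "finite_rank A \<longleftrightarrow> (\<exists>B. finite B \<and> range (blinfun_apply A) \<subseteq> complex_vector.span B)"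

definition op_rank :: "('a::complex_normed_vector \<Rightarrow>\<^sub>L 'b::complex_normed_vector) \<Rightarrow> nat" where
  "op_rank A = complex_vector.dim (range (blinfun_apply A))"

definition pos_part :: "('a::complex_inner \<Rightarrow>\<^sub>L 'a) \<Rightarrow> ('a \<Rightarrow>\<^sub>L 'a)" where
  "pos_part M =
     (THE B. \<exists>C. positive_op B \<and> positive_op C \<and> M = B - C \<and> B o\<^sub>L C = 0)"

definition neg_part :: "('a::complex_inner \<Rightarrow>\<^sub>L 'a) \<Rightarrow> ('a \<Rightarrow>\<^sub>L 'a)" where
  "neg_part M = pos_part M - M"

definition signature :: "('a::complex_inner \<Rightarrow>\<^sub>L 'a) \<Rightarrow> int" where
  "signature M = int (op_rank (pos_part M)) - int (op_rank (neg_part M))"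

definition alg_mult :: "('a::complex_normed_vector \<Rightarrow>\<^sub>L 'a) \<Rightarrow> complex \<Rightarrow> nat" where
  "alg_mult A \<mu> =
     complex_vector.dim {x. \<exists>k. (blinfun_apply (A - \<mu> *\<^sub>C id_blinfun) ^^ k) x = 0}"

definition has_R_index :: "('a::complex_normed_vector \<Rightarrow>\<^sub>L 'a) \<Rightarrow> bool" where
  "has_R_index A \<longleftrightarrow> clinear_op A \<and> finite_rank A \<and>
     (\<forall>\<mu>. op_eigenvalue A \<mu> \<and> \<mu> \<in> \<real> \<longrightarrow> \<mu> = 0) \<and> (\<forall>f. A (A f) = 0 \<longrightarrow> A f = 0)"

definition R_index :: "('a::complex_normed_vector \<Rightarrow>\<^sub>L 'a) \<Rightarrow> int" where
  "R_index A = int (\<Sum>\<mu> | op_eigenvalue A \<mu> \<and> Im \<mu> > 0. alg_mult A \<mu>)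
             - int (\<Sum>\<mu> | op_eigenvalue A \<mu> \<and> Im \<mu> < 0. alg_mult A \<mu>)"

section \<open>Unbounded operators, represented by their graphs\<close>

text \<open>The product \<open>S T\<close> of operators (first \<open>T\<close>, then \<open>S\<close>) has the graph \<open>T O S\<close>.\<close>

definition linear_operator ::
  "('a::complex_normed_vector \<times> 'b::complex_normed_vector) set \<Rightarrow> bool" where
  "linear_operator S \<longleftrightarrow> single_valued S \<and> (0, 0) \<in> S \<and>
     (\<forall>x y x' y'. (x, y) \<in> S \<and> (x', y') \<in> S \<longrightarrow> (x + x', y + y') \<in> S) \<and>
     (\<forall>c x y. (x, y) \<in> S \<longrightarrow> (c *\<^sub>C x, c *\<^sub>C y) \<in> S)"

definition densely_defined ::
  "('a::complex_normed_vector \<times> 'b::complex_normed_vector) set \<Rightarrow> bool" where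
  "densely_defined S \<longleftrightarrow> closure (Domain S) = UNIV"

definition adj :: "('a::complex_inner \<times> 'b::complex_inner) set \<Rightarrow> ('b \<times> 'a) set" where
  "adj S = {(g, h). \<forall>(f, f') \<in> S. cinner f' g = cinner f h}"

definition self_adjoint :: "('a::complex_inner \<times> 'a) set \<Rightarrow> bool" where
  "self_adjoint S \<longleftrightarrow> linear_operator S \<and> densely_defined S \<and> adj S = S"

definition op_graph ::
  "('a::complex_normed_vector \<Rightarrow>\<^sub>L 'b::complex_normed_vector) \<Rightarrow> ('a \<times> 'b) set" where
  "op_graph A = range (\<lambda>x. (x, A x))"

text \<open>Graph of \<open>(S - z)\<^sup>-\<^sup>1\<close>.\<close>
definition resolvent_graph ::
  "('a::complex_normed_vector \<times> 'a) set \<Rightarrow> complex \<Rightarrow> ('a \<times> 'a) set" where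
  "resolvent_graph S z = {(y - z *\<^sub>C x, x) | x y. (x, y) \<in> S}"

section \<open>The perturbation problem\<close>

definition V_op ::
  "('h::chilbert_space \<times> 'k::chilbert_space) set \<Rightarrow> ('k \<Rightarrow>\<^sub>L 'k) \<Rightarrow> ('h \<times> 'h) set" where
  "V_op F J = F O op_graph J O adj F"

definition H_op ::
  "('h::chilbert_space \<times> 'h) set \<Rightarrow> ('h \<times> 'k::chilbert_space) set \<Rightarrow> ('k \<Rightarrow>\<^sub>L 'k) \<Rightarrow>
    real \<Rightarrow> ('h \<times> 'h) set" where
  "H_op H0 F J s = {(x, y + s *\<^sub>R v) | x y v. (x, y) \<in> H0 \<and> (x, v) \<in> V_op F J}"

text \<open>Graph of \<open>F (H\<^sub>s - z)\<^sup>-\<^sup>1 F\<^sup>*\<close> on its natural domain.\<close>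
definition T_graph ::
  "('h::chilbert_space \<times> 'h) set \<Rightarrow> ('h \<times> 'k::chilbert_space) set \<Rightarrow> ('k \<Rightarrow>\<^sub>L 'k) \<Rightarrow>
    complex \<Rightarrow> real \<Rightarrow> ('k \<times> 'k) set" where
  "T_graph H0 F J z s = adj F O resolvent_graph (H_op H0 F J s) z O F"

definition T_op ::
  "('h::chilbert_space \<times> 'h) set \<Rightarrow> ('h \<times> 'k::chilbert_space) set \<Rightarrow> ('k \<Rightarrow>\<^sub>L 'k) \<Rightarrow>
    complex \<Rightarrow> real \<Rightarrow> ('k \<Rightarrow>\<^sub>L 'k)" where
  "T_op H0 F J z s = (THE T. T_graph H0 F J z s \<subseteq> op_graph T)"

text \<open>In \<open>V_rel_compact\<close>, compactness of \<open>V (H\<^sub>s - w)\<^sup>-\<^sup>1\<close> for one non-real \<open>w\<close> is the same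
  as for all of them, by the resolvent identity.\<close>

locale resonance_setting =
  fixes H0 :: "('h::{chilbert_space,second_countable_topology} \<times> 'h) set"
    and F :: "('h \<times> 'k::{chilbert_space,second_countable_topology}) set"
    and J :: "'k \<Rightarrow>\<^sub>L 'k"
    and D :: "'h set"
  assumes F_operator: "linear_operator F" "closed F" "densely_defined F"
    and F_kernel: "{x. (x, 0) \<in> F} = {0}"
    and F_cokernel: "{y. (y, 0) \<in> adj F} = {0}"
    and J_self_adjoint: "self_adjoint_op J"
    and H0_self_adjoint: "self_adjoint H0"
    and V_self_adjoint: "self_adjoint (V_op F J)"
    and H_self_adjoint: "\<And>s. self_adjoint (H_op H0 F J s)"
    and H_domain: "\<And>s. Domain (H_op H0 F J s) = D"
    and D_dense: "closure D = UNIV"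
    and D_subset: "D \<subseteq> Domain F \<inter> Domain (V_op F J)"
    and V_rel_compact: "\<And>s. \<exists>w K. Im w \<noteq> 0 \<and> clinear_op K \<and> compact_op K \<and>
          resolvent_graph (H_op H0 F J s) w O V_op F J = op_graph K"
    and T_compact: "\<And>z s. Im z \<noteq> 0 \<Longrightarrow>
          Domain (T_graph H0 F J z s) = Domain (adj F) \<and>
          (\<exists>T. clinear_op T \<and> compact_op T \<and> T_graph H0 F J z s \<subseteq> op_graph T)"
    and T_limit: "\<And>s. AE x in lborel. \<exists>L.
          ((\<lambda>y. T_op H0 F J (Complex x y) s) \<longlongrightarrow> L) (at_right 0)"

definition A_op ::
  "('h::chilbert_space \<times> 'h) set \<Rightarrow> ('h \<times> 'k::chilbert_space) set \<Rightarrow> ('k \<Rightarrow>\<^sub>L 'k) \<Rightarrow>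
    complex \<Rightarrow> real \<Rightarrow> ('k \<Rightarrow>\<^sub>L 'k)" where
  "A_op H0 F J z s = T_op H0 F J z s o\<^sub>L J"

definition B_op ::
  "('h::chilbert_space \<times> 'h) set \<Rightarrow> ('h \<times> 'k::chilbert_space) set \<Rightarrow> ('k \<Rightarrow>\<^sub>L 'k) \<Rightarrow>
    complex \<Rightarrow> real \<Rightarrow> ('k \<Rightarrow>\<^sub>L 'k)" where
  "B_op H0 F J z s = J o\<^sub>L T_op H0 F J z s"

text \<open>\<open>G\<close> is the meromorphic extension of \<open>s \<mapsto> A\<^sub>z(s)\<close> from the real line to the plane; it is
  unique up to its values at the poles.\<close>
definition resonance_point ::
  "('h::chilbert_space \<times> 'h) set \<Rightarrow> ('h \<times> 'k::chilbert_space) set \<Rightarrow> ('k \<Rightarrow>\<^sub>L 'k) \<Rightarrow>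
    complex \<Rightarrow> complex \<Rightarrow> bool" where
  "resonance_point H0 F J z r \<longleftrightarrow>
     (\<exists>G. vmeromorphic G \<and> (\<forall>s. G (complex_of_real s) = A_op H0 F J z s) \<and> is_pole G r)"

text \<open>A circle around \<open>(s - r)\<^sup>-\<^sup>1\<close> whose closed disc meets the spectrum of \<open>A\<^sub>z(s)\<close> at most in
  its centre; the integrals below do not depend on which such circle is chosen.\<close>
definition resonance_circle ::
  "('h::chilbert_space \<times> 'h) set \<Rightarrow> ('h \<times> 'k::chilbert_space) set \<Rightarrow> ('k \<Rightarrow>\<^sub>L 'k) \<Rightarrow>
    real \<Rightarrow> complex \<Rightarrow> complex \<Rightarrow> real \<Rightarrow> complex" where
  "resonance_circle H0 F J s z r =
     (let \<mu> = inverse (of_real s - r)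
      in circlepath \<mu> (SOME \<rho>. \<rho> > 0 \<and> cball \<mu> \<rho> \<inter> op_spectrum (A_op H0 F J z s) \<subseteq> {\<mu>}))"

text \<open>The idempotents are independent of the real number \<open>s\<close> used to compute them; it is kept
  as an explicit argument here.\<close>

definition P_idem ::
  "('h::chilbert_space \<times> 'h) set \<Rightarrow> ('h \<times> 'k::chilbert_space) set \<Rightarrow> ('k \<Rightarrow>\<^sub>L 'k) \<Rightarrow>
    real \<Rightarrow> complex \<Rightarrow> complex \<Rightarrow> ('k \<Rightarrow>\<^sub>L 'k)" where
  "P_idem H0 F J s z r = (1 / (2 * of_real pi * \<i>)) *\<^sub>C
     vcontour_integral (resonance_circle H0 F J s z r) (op_resolvent (A_op H0 F J z s))"

definition Q_idem ::
  "('h::chilbert_space \<times> 'h) set \<Rightarrow> ('h \<times> 'k::chilbert_space) set \<Rightarrow> ('k \<Rightarrow>\<^sub>L 'k) \<Rightarrow>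
    real \<Rightarrow> complex \<Rightarrow> complex \<Rightarrow> ('k \<Rightarrow>\<^sub>L 'k)" where
  "Q_idem H0 F J s z r = (1 / (2 * of_real pi * \<i>)) *\<^sub>C
     vcontour_integral (resonance_circle H0 F J s z r) (op_resolvent (B_op H0 F J z s))"

definition P_set ::
  "('h::chilbert_space \<times> 'h) set \<Rightarrow> ('h \<times> 'k::chilbert_space) set \<Rightarrow> ('k \<Rightarrow>\<^sub>L 'k) \<Rightarrow>
    real \<Rightarrow> complex \<Rightarrow> complex set \<Rightarrow> ('k \<Rightarrow>\<^sub>L 'k)" where
  "P_set H0 F J s z \<Gamma> = (\<Sum>r\<in>\<Gamma>. P_idem H0 F J s z r)"

definition Q_set ::
  "('h::chilbert_space \<times> 'h) set \<Rightarrow> ('h \<times> 'k::chilbert_space) set \<Rightarrow> ('k \<Rightarrow>\<^sub>L 'k) \<Rightarrow>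
    real \<Rightarrow> complex \<Rightarrow> complex set \<Rightarrow> ('k \<Rightarrow>\<^sub>L 'k)" where
  "Q_set H0 F J s z \<Gamma> = (\<Sum>r\<in>\<Gamma>. Q_idem H0 F J s z r)"

end

theory Submission
  imports Defs "HOL-Computational_Algebra.Fundamental_Theorem_Algebra"
begin

text \<open>The resolvent identity makes \<open>A\<^sub>z(t)\<close> a Moebius function of \<open>A\<^sub>z(s)\<close>, so the projections
  \<open>P\<^sub>z(r)\<close> do not depend on the coupling constant, and \<open>Q\<^sub>z(r)\<close> at conjugate arguments is the adjoint
  of \<open>P\<^sub>z(r)\<close>. On the finite-dimensional range of \<open>P\<^sub>z(\<Gamma>)\<close> the operator \<open>N = Im z A\<^sub>z(s)\<close> is
  strictly dissipative for the indefinite form \<open>\<langle>u, J v\<rangle>\<close>: indeed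
  \<open>Im \<langle>u, J N u\<rangle> = Im z * Im \<langle>Ju, T\<^sub>z(s) Ju\<rangle>\<close> is the square of the norm of
  \<open>Im z (H\<^sub>s - z)\<^sup>-\<^sup>1 F\<^sup>* J u\<close> in the limit, and it vanishes only for \<open>A\<^sub>z(s) u = 0\<close>. As in
  Lyapunov's inertia theorem, the form is then positive definite on the spectral subspace of \<open>N\<close>
  for the upper half-plane and negative definite on the one for the lower half-plane, and a
  Sylvester argument identifies the dimensions of these subspaces with the ranks of the positive
  and negative parts of \<open>Q J P\<close>. Of the resonance points only \<open>Im r \<noteq> 0\<close> matters: at a
  non-resonance point the projection is zero.\<close>

section \<open>Inner products\<close>

text \<open>The idempotents are defined by contour integrals, which are awkward for the algebraic
  questions asked of them. They are therefore identified once with an algebraic object,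
  \<open>riesz\<close>: an idempotent commuting with the operator, on whose range A - \<mu> is
  nilpotent and on whose kernel it is invertible. The three real coupling constants (one for P, one
  for Q, one for A), the adjoint relation and the multiplicities are then handled without comparing
  circles. Existence of this object is Riesz-Schauder theory, built on approximation by finite-rank
  operators because such estimates pass directly to sums, products and powers.

  Two points are delicate. The circle for Q is chosen from the spectrum of A, not of B, with an
  arbitrary admissible radius, so its disc may contain 0 and the spectra of T J and J T have to be
  compared there too. Moreover J u need not lie in the domain of \<open>adj F\<close>; strict
  dissipativity is reached by approximating J u and using that F is closed, and it is strict because
  0 is not among the non-real eigenvalues of A on the range of P.\<close>

lemma cinner_add_left: "cinner (x + y) z = cinner x z + cinner y (z::'a::complex_inner)"
  by (metis cinner_commute cinner_add_right complex_cnj_add)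

lemma cinner_scaleC_left: "cinner (a *\<^sub>C x) y = cnj a * cinner x (y::'a::complex_inner)"
  by (metis cinner_commute cinner_scaleC_right complex_cnj_mult)

lemma scaleR_eq_scaleC: "r *\<^sub>R x = complex_of_real r *\<^sub>C x"
  by (simp add: scaleC_of_real)

lemma cinner_eq_zero_iff: "cinner x x = 0 \<longleftrightarrow> x = (0::'a::complex_inner)"
  by (simp add: cinner_self del: of_real_power)

lemma cinner_minus_right: "cinner x (- y) = - cinner x (y::'a::complex_inner)"
  using cinner_scaleC_right[of x "-1" y] by simp

lemma cinner_minus_left: "cinner (- x) y = - cinner x (y::'a::complex_inner)"
  using cinner_scaleC_left[of "-1" x y] by simp

lemma cinner_diff_right: "cinner x (y - z) = cinner x y - cinner x (z::'a::complex_inner)"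
  using cinner_add_right[of x "y - z" z] by simp

lemma cinner_diff_left: "cinner (x - y) z = cinner x z - cinner y (z::'a::complex_inner)"
  using cinner_add_left[of "x - y" y z] by simp

lemma norm_diff_sq:
  "(norm (x - y :: 'a::complex_inner))\<^sup>2 = (norm x)\<^sup>2 + (norm y)\<^sup>2 - 2 * Re (cinner x y)"
proof -
  have "cinner (x - y) (x - y) = cinner x x + cinner y y - (cinner x y + cnj (cinner x y))"
    using cinner_commute[of y x]
    by (simp add: cinner_diff_left cinner_diff_right)
  then have "Re (cinner (x - y) (x - y))
      = Re (cinner x x + cinner y y - (cinner x y + cnj (cinner x y)))"
    by (rule arg_cong)
  then show ?thesis
    by (simp add: cinner_self del: of_real_power)
qed

lemma norm_add_sq:
  "(norm (x + y :: 'a::complex_inner))\<^sup>2 = (norm x)\<^sup>2 + (norm y)\<^sup>2 + 2 * Re (cinner x y)"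
  using norm_diff_sq[of x "- y"] by (simp add: cinner_minus_right)

lemma cinner_Cauchy_Schwarz: "cmod (cinner x y) \<le> norm x * norm (y::'a::complex_inner)"
proof (cases "y = 0")
  case True
  then show ?thesis
    using cinner_scaleC_right[of x 0 0] by simp
next
  case False
  \<comment> \<open>\<open>c *\<^sub>C y\<close> is the orthogonal projection of \<open>x\<close> to
    the line through \<open>y\<close>; that its distance to \<open>x\<close> has a non-negative
    square is the claim.\<close>
  define c where "c = cinner y x / of_real ((norm y)\<^sup>2)"
  have n: "(norm y)\<^sup>2 > 0" using False by simp
  have "cinner x (c *\<^sub>C y) = of_real ((cmod (cinner x y))\<^sup>2 / (norm y)\<^sup>2)"
    using cinner_commute[of y x]
    by (simp add: c_def cinner_scaleC_right complex_norm_square mult.commute del: of_real_power)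
  then have "Re (cinner x (c *\<^sub>C y)) = (cmod (cinner x y))\<^sup>2 / (norm y)\<^sup>2"
    by (metis Re_complex_of_real)
  moreover have "(norm (c *\<^sub>C y))\<^sup>2 = (cmod (cinner x y))\<^sup>2 / (norm y)\<^sup>2"
    using n cinner_commute[of y x]
    by (simp add: norm_scaleC c_def norm_divide power_divide power_mult_distrib field_simps
        power2_eq_square norm_power norm_mult)
  ultimately have "(norm (x - c *\<^sub>C y))\<^sup>2 = (norm x)\<^sup>2 - (cmod (cinner x y))\<^sup>2 / (norm y)\<^sup>2"
    by (simp add: norm_diff_sq)
  then have "(cmod (cinner x y))\<^sup>2 / (norm y)\<^sup>2 \<le> (norm x)\<^sup>2"
    by (smt (verit) zero_le_power2)
  then have "(cmod (cinner x y))\<^sup>2 \<le> (norm x * norm y)\<^sup>2"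
    using n by (simp add: divide_simps power_mult_distrib mult.commute)
  then show ?thesis
    by (rule power2_le_imp_le) simp
qed

text \<open>Real bilinearity, with constant 1 from Cauchy-Schwarz, gives the rules for limits,
  continuity and finite sums all at once.\<close>

interpretation cinner: bounded_bilinear "cinner :: 'a::complex_inner \<Rightarrow> 'a \<Rightarrow> complex"
proof
  show "\<exists>K. \<forall>a b::'a. norm (cinner a b) \<le> norm a * norm b * K"
    by (rule exI[of _ 1]) (simp add: cinner_Cauchy_Schwarz)
qed (simp_all add: cinner_add_left cinner_add_right scaleR_eq_scaleC cinner_scaleC_left
      cinner_scaleC_right scaleR_conv_of_real scaleC_complex_def)

interpretation scaleC: bounded_bilinear "scaleC :: complex \<Rightarrow> 'a::complex_normed_vector \<Rightarrow> 'a"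
proof
  show "\<exists>K. \<forall>a (b::'a). norm (a *\<^sub>C b) \<le> norm a * norm b * K"
    by (rule exI[of _ 1]) (simp add: norm_scaleC)
qed (simp_all add: scaleC_add_left scaleC_add_right scaleR_eq_scaleC scaleC_scaleC mult.commute
      scaleR_conv_of_real scaleC_complex_def)

lemmas cinner_simps = cinner_add_left cinner_add_right cinner_scaleC_left cinner_scaleC_right
  cinner_minus_left cinner_minus_right cinner_diff_left cinner_diff_right

lemma cinner_ext: "(\<And>y. cinner y x = cinner y x') \<Longrightarrow> x = (x'::'a::complex_inner)"
  by (metis cinner_diff_right cinner_eq_zero_iff eq_iff_diff_eq_0)

section \<open>Products of Hilbert spaces, in which the graphs of operators live\<close>

instantiation prod :: (complex_normed_vector, complex_normed_vector) complex_normed_vector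
begin
definition scaleC_prod :: "complex \<Rightarrow> 'a \<times> 'b \<Rightarrow> 'a \<times> 'b"
  where "scaleC_prod c p = (c *\<^sub>C fst p, c *\<^sub>C snd p)"
instance
proof
  fix a :: complex and x :: "'a \<times> 'b"
  have "(cmod a * norm (fst x))\<^sup>2 + (cmod a * norm (snd x))\<^sup>2
      = (cmod a)\<^sup>2 * ((norm (fst x))\<^sup>2 + (norm (snd x))\<^sup>2)"
    by (simp add: algebra_simps power_mult_distrib)
  then show "norm (a *\<^sub>C x) = cmod a * norm x"
    by (simp add: scaleC_prod_def norm_prod_def norm_scaleC real_sqrt_mult)
qed (simp_all add: scaleC_prod_def scaleC_add_left scaleC_add_right scaleC_scaleC scaleC_of_real
      prod_eq_iff)
end

instantiation prod :: (complex_inner, complex_inner) complex_inner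
begin
definition cinner_prod :: "'a \<times> 'b \<Rightarrow> 'a \<times> 'b \<Rightarrow> complex"
  where "cinner_prod p q = cinner (fst p) (fst q) + cinner (snd p) (snd q)"
instance
proof
  fix x y :: "'a \<times> 'b"
  show "cinner x y = cnj (cinner y x)"
    using cinner_commute[of "fst x" "fst y"] cinner_commute[of "snd x" "snd y"]
    by (simp add: cinner_prod_def)
qed (simp_all add: cinner_prod_def scaleC_prod_def cinner_simps algebra_simps cinner_self
      norm_prod_def flip: of_real_add of_real_power)
end

instance prod :: (chilbert_space, chilbert_space) chilbert_space ..

abbreviation cspan :: "'a::complex_normed_vector set \<Rightarrow> 'a set" where
  "cspan \<equiv> complex_vector.span"

abbreviation csubspace :: "'a::complex_normed_vector set \<Rightarrow> bool" where
  "csubspace \<equiv> complex_vector.subspace"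

abbreviation cindependent :: "'a::complex_normed_vector set \<Rightarrow> bool" where
  "cindependent \<equiv> complex_vector.independent"

abbreviation cdim :: "'a::complex_normed_vector set \<Rightarrow> nat" where
  "cdim \<equiv> complex_vector.dim"

text \<open>A minimizing sequence in \<open>S\<close> is Cauchy by the parallelogram law, and its
  limit \<open>p\<close> works because no move along \<open>S\<close> may shorten
  \<open>x - p\<close>.\<close>

theorem orthogonal_decomposition:
  fixes S :: "'a::chilbert_space set"
  assumes sub: "csubspace S" and cl: "closed S"
  obtains p where "p \<in> S" "\<And>y. y \<in> S \<Longrightarrow> cinner y (x - p) = 0"
proof -
  define d where "d = (INF y\<in>S. (norm (x - y))\<^sup>2)"
  have ne: "S \<noteq> {}" using complex_vector.subspace_0[OF sub] by auto
  have bb: "bdd_below ((\<lambda>y. (norm (x - y))\<^sup>2) ` S)"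
    by (rule bdd_belowI[of _ 0]) auto
  have dle: "d \<le> (norm (x - y))\<^sup>2" if "y \<in> S" for y
    unfolding d_def by (rule cINF_lower[OF bb that])
  have "\<exists>y\<in>S. (norm (x - y))\<^sup>2 < d + 1 / real (Suc n)" for n
  proof -
    have "d < d + 1 / real (Suc n)" by simp
    then show ?thesis
      unfolding d_def using cINF_less_iff[OF ne bb] by blast
  qed
  then obtain y where yS: "\<And>n. y n \<in> S"
    and yd: "\<And>n. (norm (x - y n))\<^sup>2 < d + 1 / real (Suc n)"
    by metis
  \<comment> \<open>The midpoint of \<open>y m\<close> and \<open>y n\<close> lies in
    \<open>S\<close>, so its squared distance to \<open>x\<close> is at least \<open>d\<close>; the
    parallelogram law then leaves little room for \<open>y m - y n\<close>.\<close>
  have par: "(norm (y m - y n))\<^sup>2 \<le> 2 / real (Suc m) + 2 / real (Suc n)" for m n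
  proof -
    have mid: "(1/2) *\<^sub>C (y m + y n) \<in> S"
      by (simp add: complex_vector.subspace_add complex_vector.subspace_scale sub yS)
    have "x - y n + (x - y m) = 2 *\<^sub>C (x - (1/2) *\<^sub>C (y m + y n))"
      using scaleC_of_real[of 2 x]
      by (simp add: scaleC.diff_right scaleC_scaleC scaleC_add_right scaleR_2)
    then have "(norm (x - y n + (x - y m)))\<^sup>2 \<ge> 4 * d"
      using dle[OF mid] by (simp add: norm_scaleC power_mult_distrib)
    moreover have "(norm (x - y n - (x - y m)))\<^sup>2 + (norm (x - y n + (x - y m)))\<^sup>2
        = 2 * (norm (x - y n))\<^sup>2 + 2 * (norm (x - y m))\<^sup>2"
      using norm_add_sq[of "x - y n" "x - y m"] norm_diff_sq[of "x - y n" "x - y m"] by linarith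
    ultimately show ?thesis
      using yd[of m] yd[of n] by simp
  qed
  have "Cauchy y"
  proof (rule metric_CauchyI)
    fix e :: real assume e: "e > 0"
    obtain k where k: "4 / e\<^sup>2 < real k" using reals_Archimedean2 by blast
    have "dist (y m) (y n) < e" if "m \<ge> k" "n \<ge> k" for m n
    proof -
      have kpos: "real k > 0" using k e by (smt (verit) divide_pos_pos zero_less_power)
      have "2 / real (Suc i) < 2 / real k" if "i \<ge> k" for i
        using that kpos by (intro divide_strict_left_mono) auto
      then have "(norm (y m - y n))\<^sup>2 < 4 / real k"
        using par[of m n] that by (smt (verit) add_divide_distrib)
      also have "\<dots> < e\<^sup>2" using k e kpos by (simp add: field_simps)
      finally show ?thesis
        using e by (simp add: dist_norm power_less_imp_less_base)
    qed
    then show "\<exists>M. \<forall>m\<ge>M. \<forall>n\<ge>M. dist (y m) (y n) < e" by blast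
  qed
  then obtain p where p: "y \<longlonglongrightarrow> p" using Cauchy_convergent convergent_def by blast
  have pS: "p \<in> S" using cl closed_sequentially p yS by blast
  have "(\<lambda>n. (norm (x - y n))\<^sup>2) \<longlonglongrightarrow> (norm (x - p))\<^sup>2"
    by (intro tendsto_intros p)
  moreover have "(\<lambda>n. d + 1 / real (Suc n)) \<longlonglongrightarrow> d + 0"
    by (intro tendsto_intros LIMSEQ_Suc lim_1_over_n)
  ultimately have pd: "(norm (x - p))\<^sup>2 \<le> d"
    using LIMSEQ_le yd by (metis (no_types, lifting) add.right_neutral less_imp_le)
  have "cinner v (x - p) = 0" if v: "v \<in> S" for v
  proof -
    define c where "c = cinner v (x - p)"
    \<comment> \<open>The factor \<open>c\<close> in the perturbation of \<open>p\<close> turns its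
      phase so that the cross term is real; only the real size \<open>t\<close> stays free.\<close>
    have "0 \<le> - 2 * t * (cmod c)\<^sup>2 + t\<^sup>2 * (cmod c)\<^sup>2 * (norm v)\<^sup>2" for t :: real
    proof -
      have "p + (of_real t * c) *\<^sub>C v \<in> S"
        by (simp add: complex_vector.subspace_add complex_vector.subspace_scale sub pS v)
      then have "(norm (x - p))\<^sup>2 \<le> (norm (x - p - (of_real t * c) *\<^sub>C v))\<^sup>2"
        using pd dle[of "p + (of_real t * c) *\<^sub>C v"] unfolding diff_diff_eq by linarith
      also have "\<dots> = (norm (x - p))\<^sup>2 + t\<^sup>2 * (cmod c)\<^sup>2 * (norm v)\<^sup>2
          - 2 * Re (of_real t * c * cnj c)"
        using cinner_commute[of "x - p" v]
        by (simp only: norm_diff_sq norm_scaleC cinner_scaleC_right c_def[symmetric])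
          (simp add: power_mult_distrib norm_mult)
      finally show ?thesis
        by (simp add: complex_norm_square[symmetric] mult.assoc flip: of_real_mult of_real_power)
    qed
    note ineq = this
    show ?thesis
    proof (cases "v = 0")
      case False
      then have nv: "(norm v)\<^sup>2 > 0" by simp
      \<comment> \<open>The quadratic in \<open>t\<close> takes its minimum at
        \<open>1 / (norm v)\<^sup>2\<close>, and this is its value there.\<close>
      have "0 \<le> - ((cmod c)\<^sup>2 / (norm v)\<^sup>2)"
      proof -
        have "(1 / b)\<^sup>2 * a * b = a / b" if "b > 0" for a b :: real
          using that by (simp add: power2_eq_square)
        from this[OF nv] show ?thesis
          using ineq[of "1 / (norm v)\<^sup>2"] by simp
      qed
      then have "c = 0" using nv by (simp add: divide_le_0_iff zero_le_divide_iff)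
      then show ?thesis by (simp add: c_def)
    qed (simp add: cinner.zero_left)
  qed
  then show ?thesis using that pS by blast
qed

section \<open>Orthonormal sets and finite-dimensional subspaces\<close>

definition orthonormal :: "'a::complex_inner set \<Rightarrow> bool" where
  "orthonormal E \<longleftrightarrow> (\<forall>x\<in>E. \<forall>y\<in>E. cinner x y = (if x = y then 1 else 0))"

lemma orthonormal_expansion:
  assumes "finite E" "orthonormal E" "x \<in> cspan E"
  shows "(\<Sum>e\<in>E. cinner e x *\<^sub>C e) = x"
  using assms(3)
proof (induction rule: complex_vector.span_induct_alt)
  case base
  then show ?case by (simp add: cinner.zero_right)
next
  case (step c b y)
  have "(\<Sum>e\<in>E. cinner e b *\<^sub>C e) = (\<Sum>e\<in>E. if b = e then e else 0)"
    using assms(2) step(1) by (intro sum.cong) (auto simp: orthonormal_def)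
  also have "\<dots> = b" using assms(1) step(1) by simp
  finally have "(\<Sum>e\<in>E. cinner e b *\<^sub>C e) = b" .
  then show ?case
    using step(2)
    by (simp add: cinner_simps scaleC_add_left sum.distrib flip: scaleC_scaleC
        complex_vector.scale_sum_right)
qed

text \<open>Gram-Schmidt, one vector at a time. A vector equal to its own projection is dropped, so
  \<open>X\<close> may be linearly dependent.\<close>

lemma orthonormal_basis_exists:
  assumes "finite (X :: 'a::complex_inner set)"
  obtains E where "finite E" "orthonormal E" "cspan E = cspan X"
  using assms
proof (induction X arbitrary: thesis rule: finite_induct)
  case empty
  then show ?case by (metis finite.emptyI orthonormal_def empty_iff)
next
  case (insert x X)
  obtain E where E: "finite E" "orthonormal E" "cspan E = cspan X"
    using insert.IH .
  define p where "p = (\<Sum>e\<in>E. cinner e x *\<^sub>C e)"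
  have pE: "p \<in> cspan E"
    unfolding p_def
    by (intro complex_vector.span_sum complex_vector.span_scale complex_vector.span_base)
  have orth: "cinner e (x - p) = 0" if "e \<in> E" for e
  proof -
    have "cinner e p = (\<Sum>e'\<in>E. if e = e' then cinner e x else 0)"
      unfolding p_def using E(2) that
      by (simp add: cinner.sum_right cinner_scaleC_right orthonormal_def if_distrib cong: if_cong)
        (intro sum.cong, auto)
    then show ?thesis using E(1) that by (simp add: cinner_diff_right)
  qed
  have span': "cspan (insert x X) = cspan (insert x E)"
    using E(3) by (simp add: complex_vector.span_insert)
  show ?case
  proof (cases "x = p")
    case True
    then have "cspan (insert x E) = cspan E"
      using pE complex_vector.span_redundant by blast
    then show ?thesis using insert.prems E span' by metis
  next
    case False
    define u where "u = (1 / of_real (norm (x - p))) *\<^sub>C (x - p)"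
    have nz: "norm (x - p) \<noteq> 0" using False by simp
    have uu: "cinner u u = 1"
      using nz by (simp add: u_def cinner_self norm_scaleC norm_divide)
    have ou: "cinner e u = 0" "cinner u e = 0" if "e \<in> E" for e
      using orth[OF that] cinner_commute[of u e] by (simp_all add: u_def cinner_scaleC_right)
    have "orthonormal (insert u E)"
      using E(2) uu ou unfolding orthonormal_def by (metis insert_iff zero_neq_one)
    moreover have "cspan (insert u E) = cspan (insert x E)"
    proof (rule complex_vector.span_eq[THEN iffD2], safe)
      have p: "p \<in> cspan (insert x E)"
        using pE complex_vector.span_mono[of E "insert x E"] by blast
      show "\<And>v. u \<in> cspan (insert x E)"
        unfolding u_def
        by (intro complex_vector.span_scale complex_vector.span_diff p complex_vector.span_base) auto
      have p: "p \<in> cspan (insert u E)"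
        using pE complex_vector.span_mono[of E "insert u E"] by blast
      have "of_real (norm (x - p)) *\<^sub>C u + p \<in> cspan (insert u E)"
        by (intro complex_vector.span_add complex_vector.span_scale p complex_vector.span_base) auto
      moreover have "of_real (norm (x - p)) *\<^sub>C u + p = x"
        using nz by (simp add: u_def scaleC_scaleC)
      ultimately show "x \<in> cspan (insert u E)" by simp
    qed (auto intro: complex_vector.span_base)
    ultimately show ?thesis using insert.prems[of "insert u E"] E(1) span' by simp
  qed
qed

section \<open>Complex linear operators\<close>

global_interpretation complex_vector_pair:
  vector_space_pair "scaleC :: complex \<Rightarrow> 'a \<Rightarrow> 'a::complex_normed_vector"
    "scaleC :: complex \<Rightarrow> 'b \<Rightarrow> 'b::complex_normed_vector" ..

abbreviation op_range :: "('a::real_normed_vector \<Rightarrow>\<^sub>L 'b::real_normed_vector) \<Rightarrow> 'b set" where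
  "op_range A \<equiv> range (blinfun_apply A)"

abbreviation op_pow :: "('a::real_normed_vector \<Rightarrow>\<^sub>L 'a) \<Rightarrow> nat \<Rightarrow> 'a \<Rightarrow> 'a" where
  "op_pow A n \<equiv> blinfun_apply A ^^ n"

lemma clinear_op_scaleC: "clinear_op A \<Longrightarrow> A (c *\<^sub>C x) = c *\<^sub>C A x"
  by (simp add: clinear_op_def)

lemma clinear_op_linear: "clinear_op A \<Longrightarrow> Vector_Spaces.linear scaleC scaleC (blinfun_apply A)"
  by (simp add: Vector_Spaces.linear_iff blinfun.add_right clinear_op_scaleC
      complex_vector.vector_space_axioms)

lemma scaleC_blinfun_apply [simp]: "blinfun_apply (c *\<^sub>C A) x = c *\<^sub>C blinfun_apply A x"
  by (simp add: scaleC_blinfun.rep_eq)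

lemma clinear_op_0 [simp]: "clinear_op 0"
  by (simp add: clinear_op_def)

lemma clinear_op_id [simp]: "clinear_op id_blinfun"
  by (simp add: clinear_op_def)

lemma clinear_op_add: "clinear_op A \<Longrightarrow> clinear_op B \<Longrightarrow> clinear_op (A + B)"
  by (simp add: clinear_op_def blinfun.add_left scaleC_add_right)

lemma clinear_op_diff: "clinear_op A \<Longrightarrow> clinear_op B \<Longrightarrow> clinear_op (A - B)"
  by (simp add: clinear_op_def blinfun.diff_left scaleC.diff_right)

lemma clinear_op_minus: "clinear_op A \<Longrightarrow> clinear_op (- A)"
  by (simp add: clinear_op_def blinfun.minus_left scaleC.minus_right)

lemma clinear_op_cmult: "clinear_op A \<Longrightarrow> clinear_op (c *\<^sub>C A)"
  by (simp add: clinear_op_def scaleC_scaleC mult.commute)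

lemma clinear_op_compose: "clinear_op A \<Longrightarrow> clinear_op B \<Longrightarrow> clinear_op (A o\<^sub>L B)"
  by (simp add: clinear_op_def)

lemma clinear_op_sum: "(\<And>i. i \<in> I \<Longrightarrow> clinear_op (A i)) \<Longrightarrow> clinear_op (\<Sum>i\<in>I. A i)"
  by (induction I rule: infinite_finite_induct) (auto intro: clinear_op_add)

lemmas clinear_op_intros = clinear_op_0 clinear_op_id clinear_op_add clinear_op_diff
  clinear_op_minus clinear_op_cmult clinear_op_compose clinear_op_sum

lemma clinear_op_Blinfun:
  assumes "bounded_linear f" "\<And>c x. f (c *\<^sub>C x) = c *\<^sub>C f x"
  shows "clinear_op (Blinfun f)"
  using assms by (simp add: clinear_op_def bounded_linear_Blinfun_apply)

lemma subspace_range: "clinear_op A \<Longrightarrow> csubspace (op_range A)"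
  by (intro complex_vector_pair.linear_subspace_image clinear_op_linear
      complex_vector.subspace_UNIV)

section \<open>Finite-rank operators\<close>

lemma finite_rank_compose_left:
  assumes "clinear_op B" "finite_rank A"
  shows "finite_rank (B o\<^sub>L A)"
proof -
  obtain X where X: "finite X" "op_range A \<subseteq> cspan X"
    using assms(2) by (auto simp: finite_rank_def)
  have "op_range (B o\<^sub>L A) \<subseteq> cspan (blinfun_apply B ` X)"
    using X(2) complex_vector_pair.linear_span_image[OF clinear_op_linear[OF assms(1)]] by auto
  then show ?thesis using X(1) by (auto simp: finite_rank_def)
qed

lemma finite_rank_compose_right: "finite_rank A \<Longrightarrow> finite_rank (A o\<^sub>L B)"
  by (auto simp: finite_rank_def)

lemma finite_rank_add:
  assumes "finite_rank A" "finite_rank B"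
  shows "finite_rank (A + B)"
proof -
  obtain X Y where XY: "finite X" "op_range A \<subseteq> cspan X"
    "finite Y" "op_range B \<subseteq> cspan Y"
    using assms by (auto simp: finite_rank_def)
  have "A x + B x \<in> cspan (X \<union> Y)" for x
    using XY(2,4) complex_vector.span_mono[of X "X \<union> Y"] complex_vector.span_mono[of Y "X \<union> Y"]
    by (intro complex_vector.span_add) auto
  then show ?thesis
    unfolding finite_rank_def using XY(1,3)
    by (intro exI[of _ "X \<union> Y"]) (auto simp: blinfun.add_left)
qed

lemma finite_rank_cmult:
  assumes "finite_rank A" shows "finite_rank (c *\<^sub>C A)"
  using assms by (auto simp: finite_rank_def intro!: complex_vector.span_scale)

lemma finite_rank_0 [simp]: "finite_rank 0"
  unfolding finite_rank_def by (intro exI[of _ "{}"]) auto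

lemma finite_rank_sum: "(\<And>i. i \<in> I \<Longrightarrow> finite_rank (A i)) \<Longrightarrow> finite_rank (\<Sum>i\<in>I. A i)"
  by (induction I rule: infinite_finite_induct) (auto intro: finite_rank_add)

text \<open>In bra-ket notation this is |w><u|; it depends conjugate-linearly on
  \<open>u\<close>.\<close>

definition rank_one :: "'a::complex_inner \<Rightarrow> 'b::complex_normed_vector \<Rightarrow> ('a \<Rightarrow>\<^sub>L 'b)" where
  "rank_one u w = Blinfun (\<lambda>x. cinner u x *\<^sub>C w)"

lemma rank_one_bounded_linear: "bounded_linear (\<lambda>x. cinner u x *\<^sub>C w)"
  by (intro bounded_linear_compose[OF scaleC.bounded_linear_left] cinner.bounded_linear_right)

lemma rank_one_apply [simp]: "rank_one u w x = cinner u x *\<^sub>C w"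
  unfolding rank_one_def by (simp add: bounded_linear_Blinfun_apply rank_one_bounded_linear)

lemma clinear_op_rank_one: "clinear_op (rank_one u w)"
  by (simp add: clinear_op_def cinner_scaleC_right scaleC_scaleC)

lemma finite_rank_rank_one: "finite_rank (rank_one u w)"
  unfolding finite_rank_def
  by (intro exI[of _ "{w}"]) (auto intro: complex_vector.span_scale complex_vector.span_base)

text \<open>This is the orthogonal projection to the span of \<open>E\<close> only if
  \<open>E\<close> is finite and orthonormal; for other sets it is merely some finite-rank
  operator.\<close>

definition orth_proj :: "'a::complex_inner set \<Rightarrow> ('a \<Rightarrow>\<^sub>L 'a)" where
  "orth_proj E = (\<Sum>e\<in>E. rank_one e e)"

lemma orth_proj_apply: "orth_proj E x = (\<Sum>e\<in>E. cinner e x *\<^sub>C e)"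
  by (simp add: orth_proj_def blinfun.sum_left)

lemma clinear_op_orth_proj: "clinear_op (orth_proj E)"
  unfolding orth_proj_def by (intro clinear_op_sum clinear_op_rank_one)

lemma finite_rank_orth_proj: "finite_rank (orth_proj E)"
  unfolding orth_proj_def by (intro finite_rank_sum finite_rank_rank_one)

lemma orth_proj_in_span: "orth_proj E x \<in> cspan E"
  unfolding orth_proj_apply
  by (intro complex_vector.span_sum complex_vector.span_scale complex_vector.span_base)

lemma norm_diff_orth_proj_le:
  assumes E: "finite E" "orthonormal E"
  shows "norm (x - orth_proj E x) \<le> norm x"
proof -
  define p where "p = orth_proj E x"
  have o: "cinner e (x - p) = 0" if "e \<in> E" for e
  proof -
    have "cinner e p = (\<Sum>e'\<in>E. if e = e' then cinner e x else 0)"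
      unfolding p_def orth_proj_apply using E(2) that
      by (auto simp: cinner.sum_right cinner_scaleC_right orthonormal_def intro!: sum.cong)
    then show ?thesis using E(1) that by (simp add: cinner_diff_right)
  qed
  have "cinner v (x - p) = 0" if "v \<in> cspan E" for v
    using that
    by (induction rule: complex_vector.span_induct_alt)
      (auto simp: o cinner_add_left cinner_scaleC_left cinner.zero_left)
  then have "cinner p (x - p) = 0" using orth_proj_in_span[of E x] p_def by blast
  then have "(norm (p + (x - p)))\<^sup>2 = (norm p)\<^sup>2 + (norm (x - p))\<^sup>2"
    unfolding norm_add_sq by simp
  then have "(norm (x - p))\<^sup>2 \<le> (norm x)\<^sup>2"
    by simp
  then show ?thesis unfolding p_def by (rule power2_le_imp_le) simp
qed

text \<open>Finiteness is carried back along \<open>K\<close>: the image of a basis of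
  \<open>S\<close> stays independent inside the span of \<open>X\<close>. In this way a subspace not
  known to be finite-dimensional acquires a finite basis.\<close>

lemma finite_basis_of_injective:
  assumes K: "clinear_op K" and S: "csubspace S" and X: "finite X"
    and inj: "\<And>x. x \<in> S \<Longrightarrow> K x = 0 \<Longrightarrow> x = 0"
    and sub: "\<And>x. x \<in> S \<Longrightarrow> K x \<in> cspan X"
  obtains B where "finite B" "cindependent B" "cspan B = S"
    "card B \<le> card X"
proof -
  obtain B where B: "B \<subseteq> S" "cindependent B" "S \<subseteq> cspan B"
    using complex_vector.maximal_independent_subset by blast
  have span: "cspan B = S"
    by (simp add: B S complex_vector.span_minimal subset_antisym)
  have injK: "inj_on (blinfun_apply K) (cspan B)"
    unfolding complex_vector_pair.linear_inj_on_iff_eq_0[OF clinear_op_linear[OF K]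
        complex_vector.subspace_span]
    using inj span by blast
  have ind: "cindependent (blinfun_apply K ` B)"
    by (rule complex_vector_pair.linear_independent_injective_image[OF clinear_op_linear[OF K]
          B(2) injK])
  have fin: "finite (blinfun_apply K ` B) \<and> card (blinfun_apply K ` B) \<le> card X"
    by (rule complex_vector.independent_span_bound[OF X ind]) (use sub B(1) in auto)
  have injB: "inj_on (blinfun_apply K) B"
    by (rule inj_on_subset[OF injK complex_vector.span_superset])
  have "finite B" using fin injB finite_image_iff by blast
  moreover have "card B \<le> card X" using fin card_image[OF injB] by simp
  ultimately show ?thesis by (rule that[OF _ B(2) span])
qed

lemma finite_basis_exists:
  assumes S: "csubspace S" and X: "finite X" "S \<subseteq> cspan X"
  obtains B where "finite B" "B \<subseteq> S" "cindependent B" "cspan B = S" "card B = cdim S"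
proof -
  obtain B where B: "B \<subseteq> S" "cindependent B" "S \<subseteq> cspan B" "card B = cdim S"
    using complex_vector.basis_exists[of S] by metis
  have "finite B"
    using complex_vector.independent_span_bound[OF X(1) B(2)] B(1) X(2) by auto
  moreover have "cspan B = S"
    by (rule antisym[OF complex_vector.span_minimal[OF B(1) S] B(3)])
  ultimately show ?thesis using that B by metis
qed

text \<open>The finite set spanning \<open>T\<close> matters: \<open>dim\<close> assigns 0 to an
  infinite-dimensional space, and the inequality would fail.\<close>

lemma dim_le_of_injective:
  assumes "clinear_op K" "csubspace S" "csubspace T"
    and T: "finite X" "T \<subseteq> cspan X"
    and "\<And>x. x \<in> S \<Longrightarrow> K x = 0 \<Longrightarrow> x = 0"
    and "\<And>x. x \<in> S \<Longrightarrow> K x \<in> T"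
  shows "cdim S \<le> cdim T"
proof -
  obtain Y where Y: "finite Y" "cspan Y = T" "card Y = cdim T"
    using finite_basis_exists[OF assms(3) T] by metis
  have TY: "K x \<in> cspan Y" if "x \<in> S" for x
    using assms(7)[OF that] Y(2) by simp
  obtain B where B: "cindependent B" "cspan B = S"
    "card B \<le> card Y"
    using finite_basis_of_injective[OF assms(1,2) Y(1) assms(6) TY] by metis
  then show ?thesis
    using Y(3) complex_vector.dim_span_eq_card_independent by metis
qed

section \<open>Approximable operators and the Fredholm alternative\<close>

text \<open>The solution of x = y + R x is taken from the contraction principle instead of summing
  the Neumann series; uniqueness of the fixed point then makes the solution linear in
  \<open>y\<close>.\<close>

lemma Neumann_inverse:
  fixes R :: "'a::{complex_normed_vector,banach} \<Rightarrow>\<^sub>L 'a"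
  assumes R: "clinear_op R" "norm R < 1"
  obtains G where "clinear_op G" "\<And>x. G (x - R x) = x" "\<And>x. G x - R (G x) = x"
proof -
  have ex: "\<exists>!x. y + R x = x" for y
  proof (rule banach_fix_type[OF norm_ge_zero R(2)], intro allI)
    fix x x'
    show "dist (y + R x) (y + R x') \<le> norm R * dist x x'"
      using norm_blinfun[of R "x - x'"] by (simp add: dist_norm blinfun.diff_right)
  qed
  define g where "g y = (THE x. y + R x = x)" for y
  have g: "y + R (g y) = g y" for y
    unfolding g_def by (rule theI'[OF ex])
  have gu: "g y = x" if "y + R x = x" for x y
    unfolding g_def using ex[of y] that by (rule the1_equality)
  have g_add: "g (x + y) = g x + g y" for x y
    by (rule gu) (metis (no_types, lifting) add.assoc add.left_commute blinfun.add_right g)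
  have g_scale: "g (c *\<^sub>C x) = c *\<^sub>C g x" for c x
    by (rule gu) (metis clinear_op_scaleC[OF R(1)] g scaleC_add_right)
  have g_bound: "norm (g y) \<le> norm y * (1 / (1 - norm R))" for y
  proof -
    have "norm (g y) \<le> norm y + norm R * norm (g y)"
      using norm_triangle_ineq[of y "R (g y)"] g[of y] norm_blinfun[of R "g y"] by simp
    then show ?thesis using R(2) by (simp add: field_simps)
  qed
  have bl: "bounded_linear g"
    by (rule bounded_linear_intro[OF g_add _ g_bound]) (simp add: scaleR_eq_scaleC g_scale)
  show ?thesis
  proof (rule that[of "Blinfun g"])
    show "clinear_op (Blinfun g)" by (rule clinear_op_Blinfun[OF bl g_scale])
    show "Blinfun g (x - R x) = x" for x
      by (simp add: bounded_linear_Blinfun_apply[OF bl] gu)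
    show "Blinfun g x - R (Blinfun g x) = x" for x
      using g[of x] by (simp add: bounded_linear_Blinfun_apply[OF bl] diff_eq_eq)
  qed
qed

text \<open>1 - M maps the finite-dimensional span of the range of \<open>M\<close> into itself
  injectively, hence onto. Preimages \<open>w e\<close> of an orthonormal basis give the inverse
  explicitly as 1 plus the sum of |w e><e| M.\<close>

lemma finite_rank_inverse:
  fixes M :: "'a::complex_inner \<Rightarrow>\<^sub>L 'a"
  assumes M: "clinear_op M" "finite_rank M" and inj: "\<And>x. M x = x \<Longrightarrow> x = 0"
  obtains G where "clinear_op G" "\<And>x. G (x - M x) = x" "\<And>x. G x - M (G x) = x"
proof -
  obtain X where X: "finite X" "op_range M \<subseteq> cspan X"
    using M(2) by (auto simp: finite_rank_def)
  obtain E where E: "finite E" "orthonormal E" "cspan E = cspan X"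
    using orthonormal_basis_exists[OF X(1)] .
  have ME: "M x \<in> cspan E" for x using X(2) E(3) by auto
  define f where "f = id_blinfun - M"
  have f: "f x = x - M x" for x by (simp add: f_def blinfun.diff_left)
  have cf: "clinear_op f" unfolding f_def by (intro clinear_op_intros M(1))
  have finj: "x = 0" if "f x = 0" for x using inj[of x] that by (simp add: f)
  have fS: "f x \<in> cspan E" if "x \<in> cspan E" for x
    using that ME by (simp add: f complex_vector.span_diff)
  \<comment> \<open>A vector \<open>e\<close> missed by \<open>f\<close>, added to the image of a
    basis, would be one independent vector too many.\<close>
  have onto: "\<exists>w \<in> cspan E. f w = e" if e: "e \<in> cspan E" for e
  proof (rule ccontr)
    assume contra: "\<not> ?thesis"
    obtain B where B: "cindependent B" "finite B"
      "cspan B = cspan E"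
      by (rule finite_basis_of_injective[OF clinear_op_id complex_vector.subspace_span[of E] E(1)])
        auto
    have injf: "inj_on (blinfun_apply f) (cspan B)"
      unfolding complex_vector_pair.linear_inj_on_iff_eq_0[OF clinear_op_linear[OF cf]
          complex_vector.subspace_span]
      using finj by blast
    have ind: "cindependent (blinfun_apply f ` B)"
      by (rule complex_vector_pair.linear_independent_injective_image[OF clinear_op_linear[OF cf]
            B(1) injf])
    have "e \<notin> cspan (blinfun_apply f ` B)"
      unfolding complex_vector_pair.linear_span_image[OF clinear_op_linear[OF cf]]
      using contra B(3) by auto
    then have "cindependent (insert e (blinfun_apply f ` B))"
      using ind by (rule complex_vector.independent_insertI)
    moreover have "insert e (blinfun_apply f ` B) \<subseteq> cspan B"
      using e fS B(3) complex_vector.span_superset[of B] by auto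
    ultimately have "card (insert e (blinfun_apply f ` B)) \<le> card B"
      using complex_vector.independent_span_bound[OF B(2)] by blast
    moreover have "card (blinfun_apply f ` B) = card B"
      by (rule card_image[OF inj_on_subset[OF injf complex_vector.span_superset]])
    moreover have "e \<notin> blinfun_apply f ` B"
      using contra B(3) complex_vector.span_superset[of B] by auto
    ultimately show False using B(2) by simp
  qed
  have "\<forall>e\<in>E. \<exists>w. f w = e" using onto[OF complex_vector.span_base] by auto
  then obtain w where w: "\<And>e. e \<in> E \<Longrightarrow> f (w e) = e" by metis
  define G where "G = id_blinfun + ((\<Sum>e\<in>E. rank_one e (w e)) o\<^sub>L M)"
  have cG: "clinear_op G"
    unfolding G_def by (intro clinear_op_intros M(1) clinear_op_rank_one)
  have "f (G x) = x" for x
  proof -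
    have "f (G x) = f x + (\<Sum>e\<in>E. cinner e (M x) *\<^sub>C f (w e))"
      by (simp add: G_def blinfun.add_left blinfun.sum_left blinfun.add_right blinfun.sum_right
          clinear_op_scaleC[OF cf])
    also have "(\<Sum>e\<in>E. cinner e (M x) *\<^sub>C f (w e)) = M x"
      using orthonormal_expansion[OF E(1,2) ME[of x]] w by simp
    finally show ?thesis by (simp add: f)
  qed
  note fG = this
  have "G (f x) = x" for x
    using finj[of "G (f x) - x"] fG[of "f x"] by (simp add: blinfun.diff_right)
  then show ?thesis using that[OF cG] fG by (simp add: f)
qed

text \<open>Norm limits of finite-rank operators. The finite-rank approximant in the definition is
  exactly what the Fredholm alternative consumes, and stability under algebraic operations is a
  matter of norm estimates.\<close>

definition approximable :: "('a::complex_normed_vector \<Rightarrow>\<^sub>L 'b::complex_normed_vector) \<Rightarrow> bool" where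
  "approximable A \<longleftrightarrow> clinear_op A \<and>
     (\<forall>\<epsilon>>0. \<exists>K. clinear_op K \<and> finite_rank K \<and> norm (A - K) < \<epsilon>)"

lemma approximable_clinear_op: "approximable A \<Longrightarrow> clinear_op A"
  by (simp add: approximable_def)

lemma approximableD:
  assumes "approximable A" "\<epsilon> > 0"
  obtains K where "clinear_op K" "finite_rank K" "norm (A - K) < \<epsilon>"
  using assms by (auto simp: approximable_def)

lemma approximable_finite_rank: "clinear_op A \<Longrightarrow> finite_rank A \<Longrightarrow> approximable A"
  unfolding approximable_def by (auto intro!: exI[of _ A])

lemma approximable_add:
  assumes "approximable A" "approximable B" shows "approximable (A + B)"
  unfolding approximable_def
proof (intro conjI allI impI)
  show "clinear_op (A + B)" using assms by (simp add: approximable_def clinear_op_add)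
  fix \<epsilon> :: real assume "\<epsilon> > 0"
  then obtain K L where "clinear_op K" "finite_rank K" "norm (A - K) < \<epsilon> / 2"
    "clinear_op L" "finite_rank L" "norm (B - L) < \<epsilon> / 2"
    using assms approximableD by (metis half_gt_zero)
  then show "\<exists>K. clinear_op K \<and> finite_rank K \<and> norm (A + B - K) < \<epsilon>"
    using norm_triangle_ineq[of "A - K" "B - L"]
    by (intro exI[of _ "K + L"])
      (auto intro: clinear_op_add finite_rank_add simp: algebra_simps)
qed

lemma approximable_compose_left:
  assumes A: "approximable A" and B: "clinear_op B" shows "approximable (B o\<^sub>L A)"
  unfolding approximable_def
proof (intro conjI allI impI)
  show "clinear_op (B o\<^sub>L A)" using A B by (simp add: approximable_def clinear_op_compose)
  fix \<epsilon> :: real assume "\<epsilon> > 0"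
  then have "\<epsilon> / (norm B + 1) > 0" by (simp add: add_nonneg_pos)
  then obtain K where K: "clinear_op K" "finite_rank K" "norm (A - K) < \<epsilon> / (norm B + 1)"
    using approximableD[OF A] by blast
  have "norm ((B o\<^sub>L A) - (B o\<^sub>L K)) \<le> norm B * norm (A - K)"
    using norm_blinfun_compose[of B "A - K"]
    by (simp add: bounded_bilinear.diff_right[OF bounded_bilinear_blinfun_compose])
  also have "\<dots> \<le> (norm B + 1) * norm (A - K)"
    by (simp add: mult_right_mono)
  also have "\<dots> < \<epsilon>"
    using K(3) by (simp add: pos_less_divide_eq add_nonneg_pos mult.commute)
  finally show "\<exists>K. clinear_op K \<and> finite_rank K \<and> norm ((B o\<^sub>L A) - K) < \<epsilon>"
    using K B by (intro exI[of _ "B o\<^sub>L K"])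
      (auto intro: clinear_op_compose finite_rank_compose_left)
qed

lemma approximable_compose_right:
  assumes A: "approximable A" and B: "clinear_op B" shows "approximable (A o\<^sub>L B)"
  unfolding approximable_def
proof (intro conjI allI impI)
  show "clinear_op (A o\<^sub>L B)" using A B by (simp add: approximable_def clinear_op_compose)
  fix \<epsilon> :: real assume "\<epsilon> > 0"
  then have "\<epsilon> / (norm B + 1) > 0" by (simp add: add_nonneg_pos)
  then obtain K where K: "clinear_op K" "finite_rank K" "norm (A - K) < \<epsilon> / (norm B + 1)"
    using approximableD[OF A] by blast
  have "norm ((A o\<^sub>L B) - (K o\<^sub>L B)) \<le> norm (A - K) * norm B"
    using norm_blinfun_compose[of "A - K" B]
    by (simp add: bounded_bilinear.diff_left[OF bounded_bilinear_blinfun_compose])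
  also have "\<dots> \<le> norm (A - K) * (norm B + 1)"
    by (simp add: mult_left_mono)
  also have "\<dots> < \<epsilon>"
    using K(3) by (simp add: pos_less_divide_eq add_nonneg_pos mult.commute)
  finally show "\<exists>K. clinear_op K \<and> finite_rank K \<and> norm ((A o\<^sub>L B) - K) < \<epsilon>"
    using K B by (intro exI[of _ "K o\<^sub>L B"])
      (auto intro: clinear_op_compose finite_rank_compose_right)
qed

lemma approximable_cmult:
  assumes "approximable A" shows "approximable (c *\<^sub>C A)"
proof -
  have "c *\<^sub>C A = (c *\<^sub>C id_blinfun) o\<^sub>L A" by (rule blinfun_eqI) simp
  then show ?thesis
    using approximable_compose_left[OF assms] clinear_op_cmult[OF clinear_op_id] by metis
qed

text \<open>Projecting to the span of a finite net of the image of the unit ball moves every image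
  vector by no more than its distance to the net. It is here that the inner product of the target
  space is needed.\<close>

lemma compact_imp_approximable:
  fixes A :: "'a::complex_normed_vector \<Rightarrow>\<^sub>L 'b::complex_inner"
  assumes A: "clinear_op A" "compact_op A"
  shows "approximable A"
  unfolding approximable_def
proof (intro conjI allI impI A(1))
  fix \<epsilon> :: real assume \<epsilon>: "\<epsilon> > 0"
  obtain k where k: "finite k" "closure (blinfun_apply A ` cball 0 1) \<subseteq> (\<Union>x\<in>k. ball x (\<epsilon> / 2))"
    using A(2) \<epsilon> unfolding compact_op_def compact_eq_totally_bounded by (meson half_gt_zero)
  obtain E where E: "finite E" "orthonormal E" "cspan E = cspan k"
    using orthonormal_basis_exists[OF k(1)] .
  have unit: "norm (A x - orth_proj E (A x)) \<le> \<epsilon> / 2" if "norm x \<le> 1" for x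
  proof -
    have "A x \<in> closure (blinfun_apply A ` cball 0 1)"
      using that closure_subset by fastforce
    then obtain c where c: "c \<in> k" "norm (A x - c) < \<epsilon> / 2"
      using k(2) by (auto simp: dist_norm norm_minus_commute)
    have "orth_proj E c = c"
      using c(1) E orthonormal_expansion[OF E(1,2), of c]
      by (simp add: orth_proj_apply complex_vector.span_base)
    \<comment> \<open>The net point \<open>c\<close> is fixed by the projection, so the error at
      \<open>A x\<close> equals the error at the short vector \<open>A x - c\<close>.\<close>
    then have eq: "A x - orth_proj E (A x) = (A x - c) - orth_proj E (A x - c)"
      by (simp add: blinfun.diff_right)
    have "norm (A x - orth_proj E (A x)) \<le> norm (A x - c)"
      unfolding eq by (rule norm_diff_orth_proj_le[OF E(1,2)])
    then show ?thesis using c(2) by simp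
  qed
  have "norm (A - (orth_proj E o\<^sub>L A)) \<le> \<epsilon> / 2"
  proof (rule norm_blinfun_bound)
    fix x
    show "norm ((A - (orth_proj E o\<^sub>L A)) x) \<le> \<epsilon> / 2 * norm x"
    proof (cases "x = 0")
      case False
      define u where "u = (1 / norm x) *\<^sub>R x"
      have x: "x = norm x *\<^sub>R u" using False by (simp add: u_def)
      have "norm u \<le> 1" using False by (simp add: u_def)
      have "(A - (orth_proj E o\<^sub>L A)) x = norm x *\<^sub>R (A u - orth_proj E (A u))"
        by (subst x) (simp add: blinfun.diff_left blinfun.scaleR_right scaleR_diff_right)
      then show ?thesis
        using mult_left_mono[OF unit[OF \<open>norm u \<le> 1\<close>] norm_ge_zero[of x]]
        by (simp add: mult.commute)
    qed (simp add: blinfun.zero_right)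
  qed (use \<epsilon> in simp)
  then show "\<exists>K. clinear_op K \<and> finite_rank K \<and> norm (A - K) < \<epsilon>"
    using \<epsilon> A(1) clinear_op_orth_proj finite_rank_orth_proj
    by (intro exI[of _ "orth_proj E o\<^sub>L A"])
      (auto intro: clinear_op_compose finite_rank_compose_right)
qed

text \<open>A finite-rank \<open>K\<close> closer to \<open>A\<close> than \<open>cmod \<mu>\<close>
  cannot annihilate an eigenvector, so it embeds \<open>S\<close> into a finite-dimensional
  space.\<close>

lemma approximable_eigenspace_finite:
  fixes A :: "'a::complex_normed_vector \<Rightarrow>\<^sub>L 'a"
  assumes A: "approximable A" and \<mu>: "\<mu> \<noteq> 0" and S: "csubspace S"
    and eig: "\<And>x. x \<in> S \<Longrightarrow> A x = \<mu> *\<^sub>C x"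
  obtains B where "finite B" "cspan B = S"
proof -
  obtain K where K: "clinear_op K" "finite_rank K" "norm (A - K) < cmod \<mu>"
    using approximableD[OF A] \<mu> by (metis zero_less_norm_iff)
  obtain X where X: "finite X" "op_range K \<subseteq> cspan X"
    using K(2) by (auto simp: finite_rank_def)
  have inj: "x = 0" if "x \<in> S" "K x = 0" for x
  proof (rule ccontr)
    assume "x \<noteq> 0"
    have "cmod \<mu> * norm x = norm ((A - K) x)"
      using that eig by (simp add: blinfun.diff_left norm_scaleC)
    also have "\<dots> \<le> norm (A - K) * norm x" by (rule norm_blinfun)
    also have "\<dots> < cmod \<mu> * norm x" using K(3) \<open>x \<noteq> 0\<close> by simp
    finally show False by simp
  qed
  have "K x \<in> cspan X" if "x \<in> S" for x using X(2) by auto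
  then show ?thesis
    using finite_basis_of_injective[OF K(1) S X(1) inj] that by metis
qed

text \<open>Factorization \<mu> - A = \<mu> (1 - R) (1 - M): R = (A - K) / \<mu> has norm below 1,
  and M = (1 - R)^-1 K / \<mu> has finite rank. The first factor is inverted by contraction, the
  second by finite-dimensional algebra.\<close>

theorem Fredholm_alternative:
  fixes A :: "'a::chilbert_space \<Rightarrow>\<^sub>L 'a"
  assumes A: "approximable A" and \<mu>: "\<mu> \<noteq> 0" and inj: "\<And>x. A x = \<mu> *\<^sub>C x \<Longrightarrow> x = 0"
  obtains G where "clinear_op G" "\<And>x. G (\<mu> *\<^sub>C x - A x) = x" "\<And>x. \<mu> *\<^sub>C G x - A (G x) = x"
proof -
  obtain K where K: "clinear_op K" "finite_rank K" "norm (A - K) < cmod \<mu>"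
    using approximableD[OF A] \<mu> by (metis zero_less_norm_iff)
  define R where "R = (1 / \<mu>) *\<^sub>C (A - K)"
  have cR: "clinear_op R"
    unfolding R_def by (intro clinear_op_intros approximable_clinear_op[OF A] K(1))
  have "norm R < 1"
    using K(3) \<mu> by (simp add: R_def norm_scaleC norm_divide divide_simps)
  then obtain W where W: "clinear_op W" "\<And>x. W (x - R x) = x" "\<And>x. W x - R (W x) = x"
    using Neumann_inverse[OF cR] by blast
  define M where "M = W o\<^sub>L ((1 / \<mu>) *\<^sub>C K)"
  have cM: "clinear_op M" unfolding M_def by (intro clinear_op_intros W(1) K(1))
  have fM: "finite_rank M"
    unfolding M_def by (intro finite_rank_compose_left W(1) finite_rank_cmult K(2))
  have M: "M x - R (M x) = (1 / \<mu>) *\<^sub>C K x" for x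
    by (simp add: M_def W(3))
  have factor: "\<mu> *\<^sub>C ((x - M x) - R (x - M x)) = \<mu> *\<^sub>C x - A x" for x
  proof -
    have "(x - M x) - R (x - M x) = x - R x - (M x - R (M x))"
      by (simp add: blinfun.diff_right algebra_simps)
    also have "\<dots> = x - (1 / \<mu>) *\<^sub>C A x"
      unfolding M by (simp add: R_def blinfun.diff_left scaleC.diff_right)
    finally have "(x - M x) - R (x - M x) = x - (1 / \<mu>) *\<^sub>C A x" .
    from arg_cong[OF this, of "scaleC \<mu>"] show ?thesis
      using \<mu> by (simp only: scaleC.diff_right scaleC_scaleC) simp
  qed
  have "x = 0" if "M x = x" for x
    using factor[of x] inj[of x] that by (simp add: scaleC.zero_right blinfun.zero_right)
  then obtain N where N: "clinear_op N" "\<And>x. N (x - M x) = x" "\<And>x. N x - M (N x) = x"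
    using finite_rank_inverse[OF cM fM] by blast
  define G where "G = N o\<^sub>L W o\<^sub>L ((1 / \<mu>) *\<^sub>C id_blinfun)"
  show ?thesis
  proof (rule that[of G])
    show "clinear_op G" unfolding G_def by (intro clinear_op_intros N(1) W(1))
    show "G (\<mu> *\<^sub>C x - A x) = x" for x
      unfolding factor[symmetric] using \<mu> by (simp add: G_def scaleC_scaleC W(2) N(2))
    show "\<mu> *\<^sub>C G x - A (G x) = x" for x
      unfolding factor[symmetric] using \<mu> by (simp add: G_def N(3) W(3) scaleC_scaleC)
  qed
qed

section \<open>Riesz projections\<close>

abbreviation shifted :: "('a::complex_normed_vector \<Rightarrow>\<^sub>L 'a) \<Rightarrow> complex \<Rightarrow> ('a \<Rightarrow>\<^sub>L 'a)" where
  "shifted A \<mu> \<equiv> A - \<mu> *\<^sub>C id_blinfun"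

lemma shifted_apply: "shifted A \<mu> x = A x - \<mu> *\<^sub>C x"
  by (simp add: blinfun.diff_left)

lemma clinear_op_shifted: "clinear_op A \<Longrightarrow> clinear_op (shifted A \<mu>)"
  by (intro clinear_op_intros)

section \<open>Powers of a bounded operator\<close>

lemma blinfun_funpow_add:
  fixes L :: "'a::real_normed_vector \<Rightarrow>\<^sub>L 'a"
  shows
  "op_pow L k (x + y) = op_pow L k x + op_pow L k y"
  by (induction k) (simp_all add: blinfun.add_right)

lemma blinfun_funpow_diff:
  fixes L :: "'a::real_normed_vector \<Rightarrow>\<^sub>L 'a"
  shows
  "op_pow L k (x - y) = op_pow L k x - op_pow L k y"
  by (induction k) (simp_all add: blinfun.diff_right)

lemma blinfun_funpow_zero [simp]:
  fixes L :: "'a::real_normed_vector \<Rightarrow>\<^sub>L 'a"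
  shows "op_pow L k 0 = 0"
  by (induction k) (simp_all add: blinfun.zero_right)

lemma blinfun_funpow_scaleC:
  fixes L :: "'a::complex_normed_vector \<Rightarrow>\<^sub>L 'a"
  shows
  "clinear_op L \<Longrightarrow> op_pow L k (c *\<^sub>C x) = c *\<^sub>C op_pow L k x"
  by (induction k) (simp_all add: clinear_op_scaleC)

lemma blinfun_funpow_commute:
  fixes L :: "'a::real_normed_vector \<Rightarrow>\<^sub>L 'a"
  assumes "\<And>x. blinfun_apply L (blinfun_apply P x) = P (L x)"
  shows "op_pow L k (P x) = P (op_pow L k x)"
  by (induction k) (simp_all add: assms)

lemma blinfun_funpow_mono:
  fixes L :: "'a::real_normed_vector \<Rightarrow>\<^sub>L 'a"
  assumes "op_pow L k x = 0" "k \<le> n"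
  shows "op_pow L n x = 0"
proof -
  have "op_pow L (n - k + k) x = 0" unfolding funpow_add using assms(1) by simp
  then show ?thesis using assms(2) by simp
qed

text \<open>\<open>P\<close> projects onto the generalized eigenspace of \<open>A\<close> at \<open>\<mu>\<close>, and \<open>S\<close> inverts
  \<open>A - \<mu>\<close> on the kernel of \<open>P\<close>.\<close>

definition riesz ::
  "('a::complex_normed_vector \<Rightarrow>\<^sub>L 'a) \<Rightarrow> complex \<Rightarrow> ('a \<Rightarrow>\<^sub>L 'a) \<Rightarrow> bool" where
  "riesz A \<mu> P \<longleftrightarrow> clinear_op P \<and> finite_rank P \<and> (\<forall>x. P (P x) = P x) \<and>
     (\<forall>x. A (P x) = P (A x)) \<and>
     (\<exists>n. \<forall>x. op_pow (shifted A \<mu>) n (P x) = 0) \<and>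
     (\<exists>S. clinear_op S \<and> (\<forall>x. S (shifted A \<mu> x) = x - P x) \<and>
        (\<forall>x. shifted A \<mu> (S x) = x - P x))"

lemma Bessel_partial:
  fixes y :: "nat \<Rightarrow> 'a::complex_inner"
  assumes y: "\<And>n. norm (y n) = 1" and orth: "\<And>i j. i < j \<Longrightarrow> cinner (y i) (y j) = 0"
  shows "(\<Sum>n<N. (cmod (cinner (y n) e))\<^sup>2) \<le> (norm e)\<^sup>2"
proof -
  define r where "r N = e - (\<Sum>n<N. cinner (y n) e *\<^sub>C y n)" for N
  have "(norm (r N))\<^sup>2 = (norm e)\<^sup>2 - (\<Sum>n<N. (cmod (cinner (y n) e))\<^sup>2)" for N
  proof (induction N)
    case (Suc N)
    define c where "c = cinner (y N) e"
    have "cinner (y N) (y n) = 0" if "n < N" for n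
      using orth[OF that] cinner_commute[of "y N" "y n"] by simp
    then have "cinner (y N) (r N) = c"
      by (simp add: r_def c_def cinner_diff_right cinner.sum_right cinner_scaleC_right)
    then have "cinner (r N) (c *\<^sub>C y N) = of_real ((cmod c)\<^sup>2)"
      using cinner_commute[of "r N" "y N"]
      by (simp add: cinner_scaleC_right complex_norm_square del: of_real_power)
    then have "Re (cinner (r N) (c *\<^sub>C y N)) = (cmod c)\<^sup>2"
      by (metis Re_complex_of_real)
    moreover have "r (Suc N) = r N - c *\<^sub>C y N"
      by (simp add: r_def c_def algebra_simps)
    ultimately show ?case
      using Suc.IH y by (simp add: norm_diff_sq norm_scaleC c_def)
  qed (simp add: r_def)
  from this[of N] show ?thesis by (smt (verit) zero_le_power2)
qed

lemma Bessel_tendsto_0: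
  fixes y :: "nat \<Rightarrow> 'a::complex_inner"
  assumes y: "\<And>n. norm (y n) = 1" and orth: "\<And>i j. i < j \<Longrightarrow> cinner (y i) (y j) = 0"
  shows "(\<lambda>n. cmod (cinner (y n) e)) \<longlonglongrightarrow> 0"
proof -
  have "summable (\<lambda>n. (cmod (cinner (y n) e))\<^sup>2)"
    by (rule summableI_nonneg_bounded[of _ "(norm e)\<^sup>2"]) (use Bessel_partial[OF y orth] in auto)
  then have "(\<lambda>n. (cmod (cinner (y n) e))\<^sup>2) \<longlonglongrightarrow> 0" by (rule summable_LIMSEQ_zero)
  then have "(\<lambda>n. sqrt ((cmod (cinner (y n) e))\<^sup>2)) \<longlonglongrightarrow> sqrt 0" by (rule tendsto_real_sqrt)
  then show ?thesis by simp
qed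

text \<open>By Bessel's inequality an orthonormal sequence tends weakly to 0, and a finite-rank
  approximant sees it only through finitely many vectors \<open>e\<close>; so the diagonal entries,
  being constant, must vanish.\<close>

lemma approximable_orthonormal_seq:
  fixes y :: "nat \<Rightarrow> 'a::complex_inner"
  assumes A: "approximable A" and y: "\<And>n. norm (y n) = 1"
    and orth: "\<And>i j. i < j \<Longrightarrow> cinner (y i) (y j) = 0"
    and c: "\<And>n. cinner (y n) (A (y n)) = c"
  shows "c = 0"
proof (rule ccontr)
  assume "c \<noteq> 0"
  then obtain K where K: "clinear_op K" "finite_rank K" "norm (A - K) < cmod c / 2"
    using approximableD[OF A, of "cmod c / 2"] by auto
  obtain X where X: "finite X" "op_range K \<subseteq> cspan X"
    using K(2) by (auto simp: finite_rank_def)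
  obtain E where E: "finite E" "orthonormal E" "cspan E = cspan X"
    using orthonormal_basis_exists[OF X(1)] .
  have le: "cmod c / 2 \<le> (\<Sum>e\<in>E. norm e * norm K * cmod (cinner (y n) e))" for n
  proof -
    have "cmod c \<le> cmod (cinner (y n) ((A - K) (y n))) + cmod (cinner (y n) (K (y n)))"
      using norm_triangle_ineq[of "cinner (y n) ((A - K) (y n))" "cinner (y n) (K (y n))"] c[of n]
      by (simp add: blinfun.diff_left cinner_diff_right)
    also have "cmod (cinner (y n) ((A - K) (y n))) \<le> norm (A - K)"
      using cinner_Cauchy_Schwarz[of "y n" "(A - K) (y n)"] norm_blinfun[of "A - K" "y n"] y[of n]
      by simp
    finally have "cmod c / 2 \<le> cmod (cinner (y n) (K (y n)))" using K(3) by simp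
    also have "K (y n) = (\<Sum>e\<in>E. cinner e (K (y n)) *\<^sub>C e)"
      using X(2) unfolding E(3)[symmetric]
      by (intro orthonormal_expansion[OF E(1,2), symmetric]) auto
    also have "cinner (y n) \<dots> = (\<Sum>e\<in>E. cinner e (K (y n)) * cinner (y n) e)"
      by (simp add: cinner.sum_right cinner_scaleC_right)
    also have "cmod \<dots> \<le> (\<Sum>e\<in>E. norm e * norm K * cmod (cinner (y n) e))"
    proof (rule sum_norm_le)
      fix e
      have "norm (K (y n)) \<le> norm K" using norm_blinfun[of K "y n"] y[of n] by simp
      then have "cmod (cinner e (K (y n))) \<le> norm e * norm K"
        by (rule order_trans[OF cinner_Cauchy_Schwarz mult_left_mono[OF _ norm_ge_zero]])
      then show "norm (cinner e (K (y n)) * cinner (y n) e) \<le> norm e * norm K * cmod (cinner (y n) e)"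
        by (simp add: norm_mult mult_right_mono)
    qed
    finally show ?thesis .
  qed
  have "(\<lambda>n. \<Sum>e\<in>E. norm e * norm K * cmod (cinner (y n) e)) \<longlonglongrightarrow> (\<Sum>e\<in>E. norm e * norm K * 0)"
    by (intro tendsto_intros Bessel_tendsto_0 y orth)
  then have "cmod c / 2 \<le> 0"
    using le by (intro LIMSEQ_le_const) auto
  then show False using \<open>c \<noteq> 0\<close> by simp
qed

text \<open>Only one term of the expanded power lacks a factor \<open>A\<close>. The kernel of the
  power is thereby an eigenspace of an approximable operator at the non-zero value - (- \<mu>)^k,
  and the results on eigenspaces apply to it.\<close>

lemma shifted_power_decomposition:
  fixes A :: "'a::complex_normed_vector \<Rightarrow>\<^sub>L 'a"
  assumes A: "approximable A"
  shows "\<exists>B. approximable B \<and>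
    (\<forall>x. op_pow (shifted A \<mu>) k x = B x + (- \<mu>) ^ k *\<^sub>C x)"
proof (induction k)
  case 0
  have "approximable (0 :: 'a \<Rightarrow>\<^sub>L 'a)" by (rule approximable_finite_rank) auto
  then show ?case by (intro exI[of _ 0]) simp
next
  case (Suc k)
  then obtain B where B: "approximable B"
    "\<And>x. op_pow (shifted A \<mu>) k x = B x + (- \<mu>) ^ k *\<^sub>C x" by blast
  have "approximable ((A o\<^sub>L B) + (- \<mu>) ^ k *\<^sub>C A + (- \<mu>) *\<^sub>C B)"
    by (intro approximable_add approximable_cmult B(1) A
        approximable_compose_right[OF A approximable_clinear_op[OF B(1)]])
  moreover have "op_pow (shifted A \<mu>) (Suc k) x
      = ((A o\<^sub>L B) + (- \<mu>) ^ k *\<^sub>C A + (- \<mu>) *\<^sub>C B) x + (- \<mu>) ^ Suc k *\<^sub>C x" for x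
    by (simp add: B(2) shifted_apply blinfun.add_left blinfun.diff_left blinfun.add_right
        clinear_op_scaleC[OF approximable_clinear_op[OF A]] scaleC_add_right scaleC_scaleC
        scaleC.minus_left algebra_simps)
  ultimately show ?case by blast
qed

text \<open>If the kernels of the powers grew for ever, unit vectors of each kernel orthogonal to
  the preceding one would form an orthonormal sequence on which \<open>A\<close> has the constant
  diagonal entry \<mu>, against \<open>approximable_orthonormal_seq\<close>.\<close>

lemma finite_ascent:
  fixes A :: "'a::chilbert_space \<Rightarrow>\<^sub>L 'a"
  assumes A: "approximable A" and \<mu>: "\<mu> \<noteq> 0"
  shows "\<exists>p. \<forall>x m. op_pow (shifted A \<mu>) m x = 0 \<longrightarrow>
    op_pow (shifted A \<mu>) p x = 0"
proof -
  define L where "L = shifted A \<mu>"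
  have cL: "clinear_op L"
    unfolding L_def by (intro clinear_op_shifted approximable_clinear_op A)
  define K where "K k = {x. op_pow L k x = 0}" for k
  have subK: "csubspace (K k)" for k
    by (rule complex_vector.subspaceI)
      (auto simp: K_def blinfun_funpow_add blinfun_funpow_scaleC[OF cL] scaleC.zero_right)
  have clK: "closed (K k)" for k
  proof -
    have "continuous_on UNIV (op_pow L k)"
      by (induction k) (auto intro!: continuous_intros continuous_on_compose2[of UNIV])
    then show ?thesis
      unfolding K_def by (intro closed_Collect_eq) auto
  qed
  have "\<exists>p. K (Suc p) \<subseteq> K p"
  proof (rule ccontr)
    assume "\<not> ?thesis"
    then have "\<forall>p. \<exists>x. x \<in> K (Suc p) \<and> x \<notin> K p" by blast
    then obtain x where x: "\<And>p. x p \<in> K (Suc p)" "\<And>p. x p \<notin> K p" by metis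
    have "\<exists>q. q \<in> K p \<and> (\<forall>v\<in>K p. cinner v (x p - q) = 0)" for p
      using orthogonal_decomposition[OF subK clK] by metis
    then obtain q where q: "\<And>p. q p \<in> K p" "\<And>p v. v \<in> K p \<Longrightarrow> cinner v (x p - q p) = 0"
      by metis
    define y where "y p = (1 / of_real (norm (x p - q p))) *\<^sub>C (x p - q p)" for p
    have nz: "norm (x p - q p) \<noteq> 0" for p using x(2)[of p] q(1)[of p] by auto
    have mono: "K m \<subseteq> K n" if "m \<le> n" for m n
      unfolding K_def using blinfun_funpow_mono that by blast
    have ny: "norm (y p) = 1" for p
      using nz by (simp add: y_def norm_scaleC norm_divide)
    have yK: "y p \<in> K (Suc p)" for p
      unfolding y_def
      using x(1)[of p] q(1)[of p] mono[of p "Suc p"] subK[of "Suc p"]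
      by (intro complex_vector.subspace_scale complex_vector.subspace_diff) auto
    have orthK: "cinner v (y p) = 0" if "v \<in> K p" for v p
      using q(2)[OF that] by (simp add: y_def cinner_scaleC_right)
    have orth: "cinner (y i) (y j) = 0" if "i < j" for i j
      using orthK yK[of i] mono[of "Suc i" j] that by auto
    \<comment> \<open>\<open>L\<close> lowers the kernel index by one, so \<open>L (y n)\<close> is
      orthogonal to \<open>y n\<close> and only the term with \<mu> survives.\<close>
    have diag: "cinner (y n) (A (y n)) = \<mu>" for n
    proof -
      have "L (y n) \<in> K n"
        using yK[of n] by (simp add: K_def funpow_swap1)
      then have "cinner (y n) (L (y n)) = 0"
        using orthK cinner_commute[of "y n" "L (y n)"] by simp
      moreover have "A (y n) = L (y n) + \<mu> *\<^sub>C y n"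
        by (simp add: L_def shifted_apply)
      ultimately show ?thesis
        using ny[of n] by (simp add: cinner_add_right cinner_scaleC_right cinner_self)
    qed
    have "\<mu> = 0" by (rule approximable_orthonormal_seq[OF A ny orth diag])
    then show False using \<mu> by simp
  qed
  then obtain p where p: "K (Suc p) \<subseteq> K p" ..
  have step: "K (p + m) \<subseteq> K p" for m
  proof (induction m)
    case (Suc m)
    have "x \<in> K (p + m)" if "x \<in> K (p + Suc m)" for x
    proof -
      have "op_pow L m x \<in> K (Suc p)"
      proof -
        have "op_pow L (Suc p + m) x = 0" using that by (simp add: K_def)
        then show ?thesis unfolding funpow_add comp_apply K_def by simp
      qed
      then have "op_pow L m x \<in> K p" using p by blast
      then show ?thesis by (simp add: K_def funpow_add)
    qed
    then show ?case using Suc.IH by blast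
  qed simp
  show ?thesis
  proof (intro exI[of _ p] allI impI)
    fix x m assume "op_pow (shifted A \<mu>) m x = 0"
    then have "x \<in> K (p + m)"
      using blinfun_funpow_mono[of m _ x "p + m"] by (simp add: K_def L_def)
    then show "op_pow (shifted A \<mu>) p x = 0"
      using step by (auto simp: K_def L_def)
  qed
qed

text \<open>Let N = (A - \<mu>)^p with \<open>p\<close> the ascent and let \<open>Q\<close> be the
  orthogonal projection to the kernel of \<open>N\<close>. Then N + Q is invertible; if
  \<open>G\<close> is its inverse, x = N (G x) + Q (G x) splits x along range and kernel of N, so
  that P = Q G. This yields the complement without a separate study of the descent.\<close>

theorem riesz_exists:
  fixes A :: "'a::chilbert_space \<Rightarrow>\<^sub>L 'a"
  assumes A: "approximable A" and \<mu>: "\<mu> \<noteq> 0"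
  obtains P where "riesz A \<mu> P"
proof -
  define L where "L = shifted A \<mu>"
  have cA: "clinear_op A" by (rule approximable_clinear_op[OF A])
  have cL: "clinear_op L"
    unfolding L_def by (intro clinear_op_shifted cA)
  have Lx: "L x = A x - \<mu> *\<^sub>C x" for x by (simp add: L_def shifted_apply)
  obtain p where stab: "\<And>x m. op_pow L m x = 0 \<Longrightarrow> op_pow L p x = 0"
    using finite_ascent[OF A \<mu>] unfolding L_def by metis
  define N where "N x = op_pow L p x" for x
  have N_add: "N (x + y) = N x + N y" for x y by (simp add: N_def blinfun_funpow_add)
  have N_diff: "N (x - y) = N x - N y" for x y by (simp add: N_def blinfun_funpow_diff)
  have N0: "N 0 = 0" by (simp add: N_def)
  have NN: "N x = 0" if "N (N x) = 0" for x
    using stab[of "p + p" x] that by (simp add: N_def funpow_add)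
  have NL: "N (L x) = L (N x)" for x by (simp add: N_def funpow_swap1)
  have NLz: "N x = 0" if "L (N x) = 0" for x
    using stab[of "Suc p" x] that by (simp add: N_def)
  obtain Ap where Ap: "approximable Ap" "\<And>x. N x = Ap x + (- \<mu>) ^ p *\<^sub>C x"
    using shifted_power_decomposition[OF A] unfolding N_def L_def by metis
  have sub: "csubspace {x. N x = 0}"
    by (rule complex_vector.subspaceI)
      (auto simp: N_def blinfun_funpow_add blinfun_funpow_scaleC[OF cL] scaleC.zero_right)
  have eig: "Ap x = (- ((- \<mu>) ^ p)) *\<^sub>C x" if "x \<in> {x. N x = 0}" for x
    using Ap(2)[of x] that by (simp add: scaleC.minus_left eq_neg_iff_add_eq_0)
  have \<mu>p: "- ((- \<mu>) ^ p) \<noteq> 0" using \<mu> by simp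
  obtain B where B: "finite B" "cspan B = {x. N x = 0}"
    using approximable_eigenspace_finite[OF Ap(1) \<mu>p sub eig] .
  obtain E where E: "finite E" "orthonormal E" "cspan E = {x. N x = 0}"
    using orthonormal_basis_exists[OF B(1)] B(2) by metis
  define Q where "Q = orth_proj E"
  have NQ: "N (Q x) = 0" for x
    using orth_proj_in_span[of E x] E(3) by (simp add: Q_def)
  have Qfix: "Q x = x" if "N x = 0" for x
    unfolding Q_def orth_proj_apply by (rule orthonormal_expansion[OF E(1,2)]) (use that E(3) in simp)
  have aQ: "approximable (Ap + Q)"
    unfolding Q_def
    by (intro approximable_add Ap(1) approximable_finite_rank clinear_op_orth_proj
        finite_rank_orth_proj)
  \<comment> \<open>The premise says N x + Q x = 0. Applying \<open>N\<close> removes the second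
    term, \<open>NN\<close> gives N x = 0, and then x = Q x vanishes too.\<close>
  have inj: "x = 0" if "(Ap + Q) x = (- ((- \<mu>) ^ p)) *\<^sub>C x" for x
  proof -
    have e: "N x + Q x = 0"
      using that by (simp add: Ap(2) blinfun.add_left scaleC.minus_left eq_neg_iff_add_eq_0
          add.commute add.left_commute)
    then have "N (N x) = 0" using N_add[of "N x" "Q x"] NQ[of x] N0 by simp
    then have "N x = 0" by (rule NN)
    then show ?thesis using e Qfix by simp
  qed
  obtain G0 where G0: "clinear_op G0"
    "\<And>x. G0 ((- ((- \<mu>) ^ p)) *\<^sub>C x - (Ap + Q) x) = x"
    "\<And>x. (- ((- \<mu>) ^ p)) *\<^sub>C G0 x - (Ap + Q) (G0 x) = x"
    using Fredholm_alternative[OF aQ \<mu>p inj] by metis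
  \<comment> \<open>The Fredholm alternative inverts the value minus the operator, which here is -
    (N + Q).\<close>
  define G where "G = - G0"
  have cG: "clinear_op G" unfolding G_def by (intro clinear_op_intros G0(1))
  have GN: "G (N x + Q x) = x" for x
  proof -
    have e: "N x + Q x = - ((- ((- \<mu>) ^ p)) *\<^sub>C x - (Ap + Q) x)"
      by (simp add: Ap(2) blinfun.add_left scaleC.minus_left)
    show ?thesis
      unfolding e by (simp only: G_def blinfun.minus_left blinfun.minus_right G0(2) minus_minus)
  qed
  have NG: "N (G x) + Q (G x) = x" for x
  proof -
    have "N (G x) + Q (G x) = - ((- ((- \<mu>) ^ p)) *\<^sub>C G x - (Ap + Q) (G x))"
      by (simp add: Ap(2) blinfun.add_left scaleC.minus_left)
    also have "\<dots> = (- ((- \<mu>) ^ p)) *\<^sub>C G0 x - (Ap + Q) (G0 x)"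
      by (simp add: G_def blinfun.minus_left blinfun.minus_right scaleC.minus_right)
    finally show ?thesis using G0(3) by simp
  qed
  define P where "P = Q o\<^sub>L G"
  have cP: "clinear_op P" unfolding P_def Q_def by (intro clinear_op_intros clinear_op_orth_proj cG)
  have fP: "finite_rank P"
    unfolding P_def Q_def by (intro finite_rank_compose_right finite_rank_orth_proj)
  have NP: "N (P x) = 0" for x by (simp add: P_def NQ)
  have Pfix: "P x = x" if "N x = 0" for x
    using GN[of x] that Qfix[OF that] by (simp add: P_def)
  have Pcompl: "x - P x = N (G x)" for x
    using NG[of x] by (simp add: P_def diff_eq_eq)
  have PN: "P (N x) = 0" for x
  proof -
    have "N (N (x - G (N x))) = 0"
      using Pcompl[of "N x"] NP[of "N x"] by (simp add: N_diff flip: Pcompl)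
    then have "N (x - G (N x)) = 0" by (rule NN)
    then show ?thesis using Pcompl[of "N x"] by (simp add: N_diff)
  qed
  have PL: "P (L x) = L (P x)" for x
  proof -
    have "L x = L (P x) + N (L (G x))"
      using Pcompl[of x] NL[of "G x"] by (metis add.commute blinfun.add_right diff_add_cancel)
    then have "P (L x) = P (L (P x)) + P (N (L (G x)))" by (metis blinfun.add_right)
    also have "P (L (P x)) = L (P x)"
      by (rule Pfix) (simp add: NL NP blinfun.zero_right)
    finally show ?thesis by (simp add: PN)
  qed
  have PA: "A (P x) = P (A x)" for x
    using PL[of x] by (simp add: Lx blinfun.diff_right clinear_op_scaleC[OF cP])
  have aAP: "approximable (A + P)"
    by (intro approximable_add A approximable_finite_rank cP fP)
  have injAP: "x = 0" if "(A + P) x = \<mu> *\<^sub>C x" for x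
  proof -
    have e: "L x = - P x" using that by (simp add: Lx blinfun.add_left algebra_simps)
    then have "L (N x) = - N (P x)"
      using NL[of x] N_diff[of 0 "P x"] N0 by simp
    then have "N x = 0" using NLz NP by simp
    then have "P x = x" by (rule Pfix)
    \<comment> \<open>On such an \<open>x\<close> the operator \<open>L\<close> acts as -1, while
      its power \<open>p\<close> is zero there.\<close>
    have "op_pow L k x = (- 1) ^ k *\<^sub>C x" for k
      using e \<open>P x = x\<close>
      by (induction k) (simp_all add: clinear_op_scaleC[OF cL] scaleC.minus_left scaleC.minus_right)
    from this[of p] have "(- 1) ^ p *\<^sub>C x = 0" using \<open>N x = 0\<close> by (simp add: N_def)
    then show ?thesis by simp
  qed
  obtain W where W: "clinear_op W" "\<And>x. W (\<mu> *\<^sub>C x - (A + P) x) = x"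
    "\<And>x. \<mu> *\<^sub>C W x - (A + P) (W x) = x"
    using Fredholm_alternative[OF aAP \<mu> injAP] by metis
  have eqW: "\<mu> *\<^sub>C x - (A + P) x = - (L x + P x)" for x
    by (simp add: Lx blinfun.add_left)
  have PP: "P (P x) = P x" for x by (rule Pfix) (rule NP)
  have WP: "W (P x) = P (W x)" for x
  proof -
    have "P x = P (- (L (W x) + P (W x)))" using W(3)[of x] unfolding eqW by simp
    also have "\<dots> = - (L (P (W x)) + P (P (W x)))"
      by (simp add: blinfun.minus_right blinfun.add_right blinfun.diff_right PL)
    finally show ?thesis using W(2)[of "P (W x)"] unfolding eqW by simp
  qed
  \<comment> \<open>\<open>W\<close> is the inverse of - (L + P), and L + P agrees with
    \<open>L\<close> on the kernel of \<open>P\<close>; so this is the inverse of \<open>L\<close>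
    there, extended by 0 on the range of \<open>P\<close>.\<close>
  define S where "S = - (W o\<^sub>L (id_blinfun - P))"
  have cS: "clinear_op S" unfolding S_def by (intro clinear_op_intros W(1) cP)
  have Sx: "S x = - W (x - P x)" for x
    by (simp add: S_def blinfun.minus_left blinfun.diff_left)
  have SL: "S (L x) = x - P x" for x
  proof -
    have "- (L x - P (L x)) = - (L (x - P x) + P (x - P x))"
      by (simp add: PL PP blinfun.diff_right)
    then show ?thesis
      using W(2)[of "x - P x"] unfolding eqW Sx by (metis blinfun.minus_right)
  qed
  have LS: "L (S x) = x - P x" for x
  proof -
    have "P (W (x - P x)) = 0" by (simp add: PP blinfun.diff_right blinfun.zero_right flip: WP)
    then show ?thesis
      using W(3)[of "x - P x"] unfolding eqW Sx by (simp add: blinfun.minus_right)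
  qed
  have "riesz A \<mu> P"
    unfolding riesz_def L_def[symmetric]
  proof (intro conjI allI cP fP PP PA)
    show "\<exists>n. \<forall>x. op_pow L n (P x) = 0" using NP unfolding N_def by blast
    show "\<exists>S. clinear_op S \<and> (\<forall>x. S (L x) = x - P x) \<and> (\<forall>x. L (S x) = x - P x)"
      using cS SL LS by blast
  qed
  then show ?thesis using that by blast
qed

section \<open>Spectrum and resolvent\<close>

lemma is_inverse_op_iff:
  "is_inverse_op A B \<longleftrightarrow> (\<forall>x. A (B x) = x) \<and> (\<forall>x. B (A x) = x)"
  unfolding is_inverse_op_def
  by (auto intro!: blinfun_eqI dest: arg_cong[where f = blinfun_apply] fun_cong simp: fun_eq_iff)

lemma pencil_apply:
  "blinfun_apply (\<sigma> *\<^sub>C id_blinfun - A) x = \<sigma> *\<^sub>C x - A x"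
  by (simp add: blinfun.diff_left)

lemma not_in_spectrumI:
  assumes "\<And>x. blinfun_apply G (\<sigma> *\<^sub>C x - blinfun_apply A x) = x" "\<And>x. \<sigma> *\<^sub>C blinfun_apply G x - A (G x) = x"
  shows "\<sigma> \<notin> op_spectrum A"
  unfolding op_spectrum_def mem_Collect_eq not_not
  by (rule exI[of _ G]) (simp add: is_inverse_op_iff pencil_apply assms)

lemma op_resolvent_inverse:
  assumes "\<sigma> \<notin> op_spectrum A"
  shows "op_resolvent A \<sigma> (\<sigma> *\<^sub>C x - A x) = x"
    and "\<sigma> *\<^sub>C op_resolvent A \<sigma> x - A (op_resolvent A \<sigma> x) = x"
proof -
  obtain B where B: "is_inverse_op (\<sigma> *\<^sub>C id_blinfun - A) B"
    using assms by (auto simp: op_spectrum_def)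
  have "C = B" if "is_inverse_op (\<sigma> *\<^sub>C id_blinfun - A) C" for C
    using that B unfolding is_inverse_op_iff by (intro blinfun_eqI) metis
  with B have "is_inverse_op (\<sigma> *\<^sub>C id_blinfun - A) (op_resolvent A \<sigma>)"
    unfolding op_resolvent_def by (rule theI)
  then show "op_resolvent A \<sigma> (\<sigma> *\<^sub>C x - A x) = x"
    "\<sigma> *\<^sub>C op_resolvent A \<sigma> x - A (op_resolvent A \<sigma> x) = x"
    by (simp_all add: is_inverse_op_iff pencil_apply)
qed

lemma op_resolvent_eqI:
  assumes "\<sigma> \<notin> op_spectrum A" "\<sigma> *\<^sub>C w - A w = x"
  shows "op_resolvent A \<sigma> x = w"
  using op_resolvent_inverse(1)[OF assms(1), of w] assms(2) by simp

lemma clinear_op_resolvent: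
  assumes "clinear_op A" "\<sigma> \<notin> op_spectrum A"
  shows "clinear_op (op_resolvent A \<sigma>)"
  unfolding clinear_op_def
proof (intro allI)
  fix c x
  show "op_resolvent A \<sigma> (c *\<^sub>C x) = c *\<^sub>C op_resolvent A \<sigma> x"
    using op_resolvent_inverse(2)[OF assms(2), of x]
    by (intro op_resolvent_eqI assms(2))
      (metis clinear_op_scaleC[OF assms(1)] scaleC.diff_right scaleC_scaleC mult.commute)
qed

section \<open>Resolvent identity, continuity and differentiability of the resolvent\<close>

lemma op_resolvent_identity:
  assumes A: "clinear_op A" and s: "\<sigma> \<notin> op_spectrum A" and t: "\<tau> \<notin> op_spectrum A"
  shows "op_resolvent A \<sigma> x - op_resolvent A \<tau> x
    = (\<tau> - \<sigma>) *\<^sub>C op_resolvent A \<sigma> (op_resolvent A \<tau> x)"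
proof -
  define w where "w = op_resolvent A \<tau> x"
  have w: "\<tau> *\<^sub>C w - A w = x"
    unfolding w_def by (rule op_resolvent_inverse(2)[OF t])
  have "op_resolvent A \<sigma> x = op_resolvent A \<sigma> (\<sigma> *\<^sub>C w - A w + (\<tau> - \<sigma>) *\<^sub>C w)"
    unfolding w[symmetric] by (simp add: scaleC.diff_left)
  also have "\<dots> = w + (\<tau> - \<sigma>) *\<^sub>C op_resolvent A \<sigma> w"
    unfolding blinfun.add_right op_resolvent_inverse(1)[OF s]
    by (simp add: clinear_op_scaleC[OF clinear_op_resolvent[OF A s]])
  finally show ?thesis unfolding w_def by simp
qed

lemma op_resolvent_identity':
  assumes "clinear_op A" "\<sigma> \<notin> op_spectrum A" "\<tau> \<notin> op_spectrum A"
  shows "op_resolvent A \<sigma> - op_resolvent A \<tau>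
    = (\<tau> - \<sigma>) *\<^sub>C (op_resolvent A \<sigma> o\<^sub>L op_resolvent A \<tau>)"
  by (rule blinfun_eqI) (simp add: blinfun.diff_left op_resolvent_identity[OF assms])

text \<open>The premise with \<open>C\<close> stands for closeness of \<sigma> to \<tau>: resolvent
  estimates are self-improving only where the distance times a norm stays below 1/2.\<close>

lemma tendsto_of_linear_bound:
  fixes f :: "complex \<Rightarrow> 'a::real_normed_vector"
  assumes bound: "\<And>\<sigma>. \<sigma> \<in> S \<Longrightarrow> \<sigma> \<noteq> \<tau> \<Longrightarrow> cmod (\<sigma> - \<tau>) * C < 1 / 2 \<Longrightarrow>
    norm (f \<sigma> - l) \<le> cmod (\<sigma> - \<tau>) * K"
  shows "(f \<longlongrightarrow> l) (at \<tau> within S)"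
proof -
  have lim: "((\<lambda>\<sigma>. cmod (\<sigma> - \<tau>) * c) \<longlongrightarrow> 0) (at \<tau> within S)" for c
  proof -
    have "((\<lambda>\<sigma>. cmod (\<sigma> - \<tau>) * c) \<longlongrightarrow> cmod (\<tau> - \<tau>) * c) (at \<tau> within S)"
      by (intro tendsto_intros)
    then show ?thesis by simp
  qed
  have "eventually (\<lambda>\<sigma>. cmod (\<sigma> - \<tau>) * C < 1 / 2) (at \<tau> within S)"
    by (rule order_tendstoD(2)[OF lim]) simp
  moreover have "eventually (\<lambda>\<sigma>. \<sigma> \<in> S \<and> \<sigma> \<noteq> \<tau>) (at \<tau> within S)"
    by (auto simp: eventually_at_filter)
  ultimately have "eventually (\<lambda>\<sigma>. norm (f \<sigma> - l) \<le> cmod (\<sigma> - \<tau>) * K) (at \<tau> within S)"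
    by eventually_elim (use bound in simp)
  then have "((\<lambda>\<sigma>. f \<sigma> - l) \<longlongrightarrow> 0) (at \<tau> within S)"
    by (rule Lim_null_comparison[OF _ lim])
  then show ?thesis by (rule Lim_null[THEN iffD2])
qed

text \<open>The limit is taken within the complement of the spectrum, so openness of the resolvent
  set is not presupposed.\<close>

lemma op_resolvent_tendsto:
  assumes A: "clinear_op A" and t: "\<tau> \<notin> op_spectrum A"
  shows "(op_resolvent A \<longlongrightarrow> op_resolvent A \<tau>) (at \<tau> within - op_spectrum A)"
proof -
  define C where "C = norm (op_resolvent A \<tau>)"
  have C0: "C \<ge> 0" by (simp add: C_def)
  have bound: "norm (op_resolvent A \<sigma> - op_resolvent A \<tau>) \<le> cmod (\<sigma> - \<tau>) * (2 * C * C)"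
    if s: "\<sigma> \<notin> op_spectrum A" and small: "cmod (\<sigma> - \<tau>) * C \<le> 1 / 2" for \<sigma>
  proof -
    define r where "r = norm (op_resolvent A \<sigma>)"
    have le: "norm (op_resolvent A \<sigma> - op_resolvent A \<tau>) \<le> cmod (\<sigma> - \<tau>) * (r * C)"
      unfolding op_resolvent_identity'[OF A s t] norm_scaleC r_def C_def
      by (simp add: norm_minus_commute norm_blinfun_compose mult_left_mono)
    \<comment> \<open>The unknown \<open>r\<close> stands on both sides; the smallness assumption
      absorbs half of it on the left and leaves \<open>r \<le> 2 * C\<close>.\<close>
    have "r \<le> C + cmod (\<sigma> - \<tau>) * (r * C)"
      using norm_triangle_sub[of "op_resolvent A \<sigma>" "op_resolvent A \<tau>"] le
      by (simp add: r_def C_def)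
    moreover have "cmod (\<sigma> - \<tau>) * (r * C) \<le> r * (1 / 2)"
      using mult_left_mono[OF small, of r] by (simp add: r_def mult_ac)
    ultimately have "r \<le> 2 * C" by simp
    then have "cmod (\<sigma> - \<tau>) * (r * C) \<le> cmod (\<sigma> - \<tau>) * (2 * C * C)"
      by (intro mult_left_mono mult_right_mono) (simp_all add: C0)
    with le show ?thesis by simp
  qed
  show ?thesis 
    by (rule tendsto_of_linear_bound[where C = C and K = "2 * C * C"]) (use bound in simp)
qed

lemma continuous_on_op_resolvent:
  assumes "clinear_op A" "S \<inter> op_spectrum A = {}"
  shows "continuous_on S (op_resolvent A)"
  unfolding continuous_on_def
proof
  fix x assume "x \<in> S"
  then show "(op_resolvent A \<longlongrightarrow> op_resolvent A x) (at x within S)"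
    using assms(2) by (intro tendsto_within_subset[OF op_resolvent_tendsto[OF assms(1)]]) auto
qed

text \<open>Matrix elements are used so that Cauchy's theorem for complex-valued functions applies;
  the derivative is minus the matrix element of the squared resolvent.\<close>

lemma op_resolvent_field_differentiable:
  assumes A: "clinear_op A" and S: "open S" "S \<inter> op_spectrum A = {}" and t: "\<tau> \<in> S"
  shows "(\<lambda>\<sigma>. cinner y (op_resolvent A \<sigma> x)) field_differentiable at \<tau>"
proof -
  have t': "\<tau> \<notin> op_spectrum A" using S(2) t by auto
  have lim: "((\<lambda>\<sigma>. - cinner y (op_resolvent A \<sigma> (op_resolvent A \<tau> x)))
      \<longlongrightarrow> - cinner y (op_resolvent A \<tau> (op_resolvent A \<tau> x))) (at \<tau> within S)"
    using S(2)
    by (intro tendsto_intros cinner.tendsto blinfun.tendsto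
        tendsto_within_subset[OF op_resolvent_tendsto[OF A t']]) auto
  have "((\<lambda>\<sigma>. (cinner y (op_resolvent A \<sigma> x) - cinner y (op_resolvent A \<tau> x)) / (\<sigma> - \<tau>))
      \<longlongrightarrow> - cinner y (op_resolvent A \<tau> (op_resolvent A \<tau> x))) (at \<tau> within S)"
  proof (rule Lim_transform_eventually[OF lim])
    have "eventually (\<lambda>\<sigma>. \<sigma> \<in> S \<and> \<sigma> \<noteq> \<tau>) (at \<tau> within S)"
      by (auto simp: eventually_at_filter)
    then show "eventually (\<lambda>\<sigma>. - cinner y (op_resolvent A \<sigma> (op_resolvent A \<tau> x))
        = (cinner y (op_resolvent A \<sigma> x) - cinner y (op_resolvent A \<tau> x)) / (\<sigma> - \<tau>))
        (at \<tau> within S)"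
    proof eventually_elim
      case (elim \<sigma>)
      then have s: "\<sigma> \<notin> op_spectrum A" using S(2) by auto
      have "cinner y (op_resolvent A \<sigma> x) - cinner y (op_resolvent A \<tau> x)
          = (\<tau> - \<sigma>) * cinner y (op_resolvent A \<sigma> (op_resolvent A \<tau> x))"
        unfolding cinner_diff_right[symmetric] op_resolvent_identity[OF A s t']
        by (rule cinner_scaleC_right)
      then show ?case using elim by (simp add: divide_simps) (simp add: algebra_simps)
    qed
  qed
  then show ?thesis
    unfolding field_differentiable_def has_field_derivative_iff
    using at_within_open[OF t S(1)] by auto
qed

text \<open>Cauchy's formula for the derivatives of the constant function 1.\<close>

lemma Cauchy_circle_pole:
  assumes "\<rho> > 0"
  shows "((\<lambda>w. 1 / (w - \<mu>) ^ Suc k) has_contour_integral (if k = 0 then 2 * of_real pi * \<i> else 0))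
    (circlepath \<mu> \<rho>)"
proof -
  have "((\<lambda>w. 1 / (w - \<mu>) ^ Suc k) has_contour_integral
      ((2 * of_real pi * \<i>) / (fact k) * (deriv ^^ k) (\<lambda>_. 1) \<mu>)) (circlepath \<mu> \<rho>)"
    using assms Cauchy_has_contour_integral_higher_derivative_circlepath[of \<mu> \<rho> "\<lambda>_. 1" \<mu> k]
    by simp
  then show ?thesis by (simp add: higher_deriv_const split: if_splits)
qed

text \<open>A truncated Neumann series. On a vector killed by the \<open>n\<close>-th power of
  \<open>L\<close> it is the exact resolvent, written as a finite principal part in \<tau>.\<close>

lemma telescoping_pole_sum:
  assumes L: "clinear_op L" and t: "\<tau> \<noteq> 0"
  shows "\<tau> *\<^sub>C (\<Sum>k<n. (1 / \<tau> ^ Suc k) *\<^sub>C op_pow L k v)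
      - L (\<Sum>k<n. (1 / \<tau> ^ Suc k) *\<^sub>C op_pow L k v)
    = v - (1 / \<tau> ^ n) *\<^sub>C op_pow L n v"
proof (induction n)
  case (Suc n)
  have e1: "\<tau> *\<^sub>C ((1 / \<tau> ^ Suc n) *\<^sub>C op_pow L n v)
      = (1 / \<tau> ^ n) *\<^sub>C op_pow L n v"
    using t by (simp add: scaleC_scaleC)
  have e2: "L ((1 / \<tau> ^ Suc n) *\<^sub>C op_pow L n v)
      = (1 / \<tau> ^ Suc n) *\<^sub>C op_pow L (Suc n) v"
    by (simp add: clinear_op_scaleC[OF L])
  show ?case
    unfolding sum.lessThan_Suc scaleC_add_right blinfun.add_right add_diff_add Suc.IH e1 e2
    by (simp only: add_diff_eq diff_add_cancel)
qed (simp add: scaleC.zero_right blinfun.zero_right)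

text \<open>For an eigenvector at \<mu> + \<tau> with \<tau> non-zero, the \<open>P\<close> part
  vanishes by nilpotence and the rest satisfies x = \<tau> S x, impossible for small \<tau>. Without
  eigenvectors, the Fredholm alternative puts \<mu> + \<tau> in the resolvent set.\<close>

lemma isolated_in_spectrum:
  fixes A :: "'a::chilbert_space \<Rightarrow>\<^sub>L 'a"
  assumes A: "approximable A" and \<mu>: "\<mu> \<noteq> 0"
  shows "\<exists>\<rho>>0. cball \<mu> \<rho> \<inter> op_spectrum A \<subseteq> {\<mu>}"
proof -
  have cA: "clinear_op A" by (rule approximable_clinear_op[OF A])
  obtain P where "riesz A \<mu> P" using riesz_exists[OF A \<mu>] .
  then obtain n S where P: "clinear_op P" "\<And>x. A (P x) = P (A x)"
    "\<And>x. op_pow (shifted A \<mu>) n (P x) = 0"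
    "clinear_op S" "\<And>x. S (shifted A \<mu> x) = x - P x"
    unfolding riesz_def by auto
  \<comment> \<open>The first bound keeps 0 out of the disc, as the Fredholm alternative requires;
    the second makes \<open>\<rho> * norm S\<close> less than 1/2, with 1 added against
    \<open>S = 0\<close>.\<close>
  define \<rho> where "\<rho> = min (cmod \<mu> / 2) (1 / (2 * (norm S + 1)))"
  have pos: "norm S + 1 > 0" by (simp add: add_nonneg_pos)
  have "\<rho> > 0" using \<mu> pos by (simp add: \<rho>_def)
  moreover have "\<sigma> \<notin> op_spectrum A" if \<sigma>: "cmod (\<sigma> - \<mu>) \<le> \<rho>" "\<sigma> \<noteq> \<mu>" for \<sigma>
  proof -
    have "\<sigma> \<noteq> 0" using \<sigma> \<mu> by (auto simp: \<rho>_def)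
    have "x = 0" if eig: "A x = \<sigma> *\<^sub>C x" for x
    proof -
      define \<tau> where "\<tau> = \<sigma> - \<mu>"
      have Lx: "shifted A \<mu> x = \<tau> *\<^sub>C x"
        by (simp add: shifted_apply eig \<tau>_def scaleC.diff_left)
      have "shifted A \<mu> (P x) = \<tau> *\<^sub>C P x"
        by (simp add: shifted_apply P(2) eig \<tau>_def scaleC.diff_left clinear_op_scaleC[OF P(1)])
      then have "op_pow (shifted A \<mu>) k (P x) = \<tau> ^ k *\<^sub>C P x" for k
        by (induction k)
          (simp_all add: clinear_op_scaleC[OF clinear_op_shifted[OF cA]] scaleC_scaleC mult.commute)
      then have "P x = 0" using P(3)[of x] \<sigma>(2) by (simp add: \<tau>_def)
      then have "x = \<tau> *\<^sub>C S x"
        using P(5)[of x] unfolding Lx by (simp add: clinear_op_scaleC[OF P(4)])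
      then have "norm x = cmod \<tau> * norm (S x)" by (metis norm_scaleC)
      also have "\<dots> \<le> \<rho> * (norm S * norm x)"
        using \<sigma>(1) \<open>\<rho> > 0\<close> norm_blinfun[of S x] by (intro mult_mono) (auto simp: \<tau>_def)
      also have "\<dots> \<le> 1 / (2 * (norm S + 1)) * ((norm S + 1) * norm x)"
        using pos by (intro mult_mono) (auto simp: \<rho>_def intro!: mult_right_mono)
      also have "\<dots> = norm x / 2" using pos by (simp add: field_simps)
      finally show "x = 0" by simp
    qed
    from Fredholm_alternative[OF A \<open>\<sigma> \<noteq> 0\<close> this] show ?thesis
      using not_in_spectrumI by metis
  qed
  then have "cball \<mu> \<rho> \<inter> op_spectrum A \<subseteq> {\<mu>}"
    by (metis IntE dist_commute dist_norm insertCI mem_cball subsetI)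
  ultimately show ?thesis by blast
qed

text \<open>On the range of \<open>P\<close> the resolvent is a finite principal part of which only
  the simple pole contributes to the integral. On the kernel of \<open>P\<close> it extends
  continuously to \<mu>, so that part integrates to 0. Both facts are proved for matrix elements and
  then lifted to operators.\<close>

theorem riesz_contour_integral:
  fixes A :: "'a::chilbert_space \<Rightarrow>\<^sub>L 'a"
  assumes A: "clinear_op A" and P: "riesz A \<mu> P"
    and \<rho>: "\<rho> > 0" "cball \<mu> \<rho> \<inter> op_spectrum A \<subseteq> {\<mu>}"
  shows "(1 / (2 * of_real pi * \<i>)) *\<^sub>C vcontour_integral (circlepath \<mu> \<rho>) (op_resolvent A) = P"
proof -
  define L where "L = shifted A \<mu>"
  define R where "R = op_resolvent A"
  define g where "g = circlepath \<mu> \<rho>"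
  obtain n S where PP: "clinear_op P" "\<And>x. P (P x) = P x" "\<And>x. A (P x) = P (A x)"
    "\<And>x. op_pow L n (P x) = 0"
    "clinear_op S" "\<And>x. S (L x) = x - P x"
    using P unfolding riesz_def L_def by auto
  have cL: "clinear_op L" unfolding L_def by (rule clinear_op_shifted[OF A])
  \<comment> \<open>The exponent \<open>Suc n\<close> ensures that the sum over poles has its term
    \<open>k = 0\<close> even if \<open>n = 0\<close>.\<close>
  have Ln: "op_pow L (Suc n) (P x) = 0" for x
    by (simp add: PP(4) blinfun.zero_right)
  have spec: "\<sigma> \<notin> op_spectrum A" if "\<sigma> \<in> cball \<mu> \<rho>" "\<sigma> \<noteq> \<mu>" for \<sigma>
    using \<rho>(2) that by auto
  have pencil: "\<sigma> *\<^sub>C w - A w = (\<sigma> - \<mu>) *\<^sub>C w - L w" for \<sigma> w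
    by (simp add: L_def shifted_apply scaleC.diff_left)
  have scalar: "((\<lambda>\<sigma>. cinner y (R \<sigma> x)) has_contour_integral (2 * of_real pi * \<i> * cinner y (P x))) g" for x y
  proof -
    define v where "v = x - P x"
    have Pv: "P v = 0" by (simp add: v_def blinfun.diff_right PP(2))
    \<comment> \<open>The value at \<mu> is the limit of the matrix element: on the kernel of
      \<open>P\<close> the inverse of \<mu> - A = - L is - S.\<close>
    define h where "h \<sigma> = (if \<sigma> = \<mu> then - cinner y (S v) else cinner y (R \<sigma> v))" for \<sigma>
    define q where "q \<sigma> = (\<Sum>k<Suc n. cinner y (op_pow L k (P x)) *
        (1 / (\<sigma> - \<mu>) ^ Suc k))" for \<sigma>
    have split: "cinner y (R \<sigma> x) = q \<sigma> + h \<sigma>" if \<sigma>: "\<sigma> \<in> cball \<mu> \<rho>" "\<sigma> \<noteq> \<mu>" for \<sigma>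
    proof -
      have "R \<sigma> (P x) = (\<Sum>k<Suc n. (1 / (\<sigma> - \<mu>) ^ Suc k) *\<^sub>C op_pow L k (P x))"
        unfolding R_def
        by (rule op_resolvent_eqI[OF spec[OF \<sigma>]], subst pencil, subst telescoping_pole_sum[OF cL])
          (use \<sigma>(2) Ln[of x] in \<open>simp_all del: funpow.simps power_Suc add: scaleC.zero_right\<close>)
      then have "cinner y (R \<sigma> (P x)) = q \<sigma>"
        unfolding q_def by (simp only: cinner.sum_right cinner_scaleC_right mult.commute)
      moreover have "R \<sigma> x = R \<sigma> (P x) + R \<sigma> v"
        by (simp add: v_def blinfun.diff_right)
      ultimately show ?thesis using \<sigma>(2) by (simp add: h_def cinner_add_right)
    qed
    \<comment> \<open>Applying \<open>S\<close> to the resolvent equation gives a fixed-point form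
      with the factor \<sigma> - \<mu>, from which both boundedness near \<mu> and the limit
      follow.\<close>
    have Rv: "R \<sigma> v = - S v + (\<sigma> - \<mu>) *\<^sub>C S (R \<sigma> v)" if \<sigma>: "\<sigma> \<in> cball \<mu> \<rho>" "\<sigma> \<noteq> \<mu>" for \<sigma>
    proof -
      define w where "w = R \<sigma> v"
      have w: "\<sigma> *\<^sub>C w - A w = v"
        unfolding w_def R_def by (rule op_resolvent_inverse(2)[OF spec[OF \<sigma>]])
      have "\<sigma> *\<^sub>C P w - A (P w) = 0"
        using arg_cong[OF w, of P] by (simp add: blinfun.diff_right clinear_op_scaleC[OF PP(1)] PP(3) Pv)
      then have "P w = 0"
        using op_resolvent_inverse(1)[OF spec[OF \<sigma>], of "P w"] by (simp add: blinfun.zero_right)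
      have "S v = S ((\<sigma> - \<mu>) *\<^sub>C w - L w)" unfolding w[symmetric] pencil ..
      then show ?thesis
        unfolding w_def[symmetric]
        by (simp add: blinfun.diff_right clinear_op_scaleC[OF PP(5)] PP(6) \<open>P w = 0\<close>)
    qed
    have contR: "continuous_on (cball \<mu> \<rho> - {\<mu>}) R"
      unfolding R_def by (rule continuous_on_op_resolvent[OF A]) (use \<rho>(2) in auto)
    have lim: "((\<lambda>\<sigma>. cinner y (R \<sigma> v)) \<longlongrightarrow> - cinner y (S v)) (at \<mu> within cball \<mu> \<rho>)"
    proof -
      define C where "C = norm S"
      define K where "K = 2 * norm (S v)"
      show ?thesis
      proof (rule tendsto_of_linear_bound[where C = C and K = "norm y * (C * K)"])
        fix \<sigma> assume \<sigma>: "\<sigma> \<in> cball \<mu> \<rho>" "\<sigma> \<noteq> \<mu>" "cmod (\<sigma> - \<mu>) * C < 1 / 2"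
        define r where "r = norm (R \<sigma> v)"
        have SR: "norm ((\<sigma> - \<mu>) *\<^sub>C S (R \<sigma> v)) \<le> cmod (\<sigma> - \<mu>) * (C * r)"
          unfolding norm_scaleC r_def C_def by (intro mult_left_mono norm_blinfun) auto
        have "r \<le> norm (S v) + norm ((\<sigma> - \<mu>) *\<^sub>C S (R \<sigma> v))"
          using norm_triangle_ineq[of "- S v" "(\<sigma> - \<mu>) *\<^sub>C S (R \<sigma> v)"]
          unfolding Rv[OF \<sigma>(1,2), symmetric] by (simp add: r_def)
        also have "\<dots> \<le> norm (S v) + r * (1 / 2)"
          using SR mult_left_mono[OF less_imp_le[OF \<sigma>(3)], of r] by (simp add: r_def mult_ac)
        finally have "r \<le> K" by (simp add: K_def)
        have "norm (R \<sigma> v + S v) \<le> cmod (\<sigma> - \<mu>) * (C * r)"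
          using SR Rv[OF \<sigma>(1,2)] by (metis add.commute add_diff_cancel_left' diff_minus_eq_add)
        also have "\<dots> \<le> cmod (\<sigma> - \<mu>) * (C * K)"
          using \<open>r \<le> K\<close> by (intro mult_left_mono) (auto simp: C_def)
        finally have "norm y * norm (R \<sigma> v + S v) \<le> norm y * (cmod (\<sigma> - \<mu>) * (C * K))"
          by (intro mult_left_mono) auto
        then show "norm (cinner y (R \<sigma> v) - - cinner y (S v)) \<le> cmod (\<sigma> - \<mu>) * (norm y * (C * K))"
          using cinner_Cauchy_Schwarz[of y "R \<sigma> v + S v"]
          by (simp add: cinner_add_right mult.left_commute)
      qed
    qed
    have conth: "continuous_on (cball \<mu> \<rho>) h"
      unfolding continuous_on_def
    proof
      fix \<sigma> assume \<sigma>: "\<sigma> \<in> cball \<mu> \<rho>"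
      show "(h \<longlongrightarrow> h \<sigma>) (at \<sigma> within cball \<mu> \<rho>)"
      proof (cases "\<sigma> = \<mu>")
        case True
        have "(h \<longlongrightarrow> - cinner y (S v)) (at \<mu> within cball \<mu> \<rho>)"
          by (rule Lim_transform_eventually[OF lim]) (auto simp: h_def eventually_at_filter)
        then show ?thesis using True by (simp add: h_def)
      next
        case False
        have "(R \<longlongrightarrow> R \<sigma>) (at \<sigma> within cball \<mu> \<rho> - {\<mu>})"
          using contR \<sigma> False by (auto simp: continuous_on_def)
        then have "((\<lambda>\<sigma>. cinner y (R \<sigma> v)) \<longlongrightarrow> cinner y (R \<sigma> v)) (at \<sigma> within cball \<mu> \<rho> - {\<mu>})"
          by (intro cinner.tendsto blinfun.tendsto tendsto_const)
        then have "(h \<longlongrightarrow> cinner y (R \<sigma> v)) (at \<sigma> within cball \<mu> \<rho> - {\<mu>})"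
          by (rule Lim_transform_eventually) (auto simp: h_def eventually_at_filter)
        moreover have "at \<sigma> within cball \<mu> \<rho> - {\<mu>} = at \<sigma> within cball \<mu> \<rho>"
          by (rule at_within_nhd[of _ "- {\<mu>}"]) (use False in auto)
        ultimately show ?thesis using False by (simp add: h_def)
      qed
    qed
    \<comment> \<open>Cauchy's theorem on a disc tolerates finitely many points of mere continuity;
      here the single one is \<mu>.\<close>
    have hint: "(h has_contour_integral 0) g"
    proof (rule Cauchy_theorem_disc[of "{\<mu>}" \<mu> \<rho>])
      show "h field_differentiable at \<sigma>" if \<sigma>: "\<sigma> \<in> ball \<mu> \<rho> - {\<mu>}" for \<sigma>
      proof -
        have fd: "(\<lambda>\<sigma>. cinner y (R \<sigma> v)) field_differentiable at \<sigma>"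
          unfolding R_def
        proof (rule op_resolvent_field_differentiable[OF A _ _ \<sigma>])
          show "(ball \<mu> \<rho> - {\<mu>}) \<inter> op_spectrum A = {}"
            using \<rho>(2) ball_subset_cball[of \<mu> \<rho>] by blast
        qed auto
        have "eventually (\<lambda>\<sigma>. \<sigma> \<in> ball \<mu> \<rho> - {\<mu>}) (nhds \<sigma>)"
          by (rule eventually_nhds_in_open[OF _ \<sigma>]) auto
        then have "eventually (\<lambda>\<sigma>. h \<sigma> = cinner y (R \<sigma> v)) (nhds \<sigma>)"
          by eventually_elim (auto simp: h_def)
        with fd show ?thesis
          by (auto simp: field_differentiable_def dest: DERIV_cong_ev[OF refl _ refl, THEN iffD2])
      qed
      show "path_image g \<subseteq> cball \<mu> \<rho>" using \<rho>(1) by (auto simp: g_def path_image_circlepath)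
    qed (use conth in \<open>auto simp: g_def\<close>)
    have "(q has_contour_integral (\<Sum>k<Suc n. cinner y (op_pow L k (P x)) *
        (if k = 0 then 2 * of_real pi * \<i> else 0))) g"
      unfolding q_def g_def
      by (intro has_contour_integral_sum has_contour_integral_lmul Cauchy_circle_pole \<rho>(1)) auto
    also have "(\<Sum>k<Suc n. cinner y (op_pow L k (P x)) *
        (if k = 0 then 2 * of_real pi * \<i> else 0)) = 2 * of_real pi * \<i> * cinner y (P x)"
      by (subst sum.lessThan_Suc_shift) simp
    finally have "((\<lambda>\<sigma>. q \<sigma> + h \<sigma>) has_contour_integral (2 * of_real pi * \<i> * cinner y (P x) + 0)) g"
      by (intro has_contour_integral_add hint)
    then have "((\<lambda>\<sigma>. cinner y (R \<sigma> x)) has_contour_integral (2 * of_real pi * \<i> * cinner y (P x) + 0)) g"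
      by (rule has_contour_integral_eq)
        (use split \<rho>(1) in \<open>auto simp: g_def path_image_circlepath\<close>)
    then show ?thesis by simp
  qed
  define F where "F t = vector_derivative g (at t within {0..1}) *\<^sub>C R (g t)" for t
  have "continuous_on {0..1} (\<lambda>t. (2 * of_real pi * \<i> * of_real \<rho> * exp (2 * of_real pi * \<i> * of_real t))
      *\<^sub>C R (g t))"
  proof (rule bounded_bilinear.continuous_on[OF scaleC.bounded_bilinear_axioms])
    show "continuous_on {0..1} (\<lambda>t. R (g t))"
      unfolding R_def
    proof (rule continuous_on_compose2[OF continuous_on_op_resolvent[OF A]])
      show "continuous_on {0..1} g" using path_circlepath by (simp add: g_def path_def)
      show "g ` {0..1} \<subseteq> sphere \<mu> \<rho>"
        using \<rho>(1) path_image_circlepath[of \<mu> \<rho>] by (simp add: g_def path_image_def)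
      show "sphere \<mu> \<rho> \<inter> op_spectrum A = {}" using \<rho> by auto
    qed
  qed (intro continuous_intros)
  then have "continuous_on {0..1} F"
    by (rule continuous_on_cong[THEN iffD1, rotated -1])
      (simp_all add: F_def g_def vector_derivative_circlepath01)
  then have Fint: "F integrable_on {0..1}" by (rule integrable_continuous_real)
  show ?thesis
  proof (rule blinfun_eqI, rule cinner_ext)
    fix x y :: 'a
    \<comment> \<open>The operator-valued integrand is continuous, hence integrable, and this
      functional may be drawn under the integral.\<close>
    have bl: "bounded_linear (\<lambda>T. cinner y (blinfun_apply T x))"
      by (rule bounded_linear_compose[OF cinner.bounded_linear_right blinfun.bounded_linear_left])
    have "cinner y (integral {0..1} F x) = integral {0..1} (\<lambda>t. cinner y (F t x))"
      using integral_linear[OF Fint bl] by (simp add: o_def)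
    also have "\<dots> = 2 * of_real pi * \<i> * cinner y (P x)"
      using scalar[of y x] unfolding has_contour_integral_def
      by (intro integral_unique) (simp add: F_def cinner_scaleC_right mult.commute)
    finally show "cinner y (((1 / (2 * of_real pi * \<i>)) *\<^sub>C
        vcontour_integral (circlepath \<mu> \<rho>) (op_resolvent A)) x) = cinner y (P x)"
      by (simp add: vcontour_integral_def F_def[abs_def] R_def g_def cinner_scaleC_right)
  qed
qed

section \<open>Algebra of Riesz projections: disjointness, adjoints, Moebius invariance\<close>

lemma shifted_commute:
  assumes "clinear_op P" "\<And>x. blinfun_apply A (blinfun_apply P x) = P (A x)"
  shows "shifted A \<mu> (P x) = P (shifted A \<mu> x)"
  by (simp add: shifted_apply assms(2) blinfun.diff_right clinear_op_scaleC[OF assms(1)])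

text \<open>A - \<mu> is invertible on the kernel of \<open>P\<close>, so every vector there has
  preimages under all its powers. For the adjoint operator this becomes orthogonality to generalized
  eigenvectors.\<close>

lemma riesz_range_power:
  assumes "clinear_op A" "riesz A \<mu> P"
  shows "\<exists>w. x - P x = op_pow (shifted A \<mu>) n w"
proof (induction n)
  case (Suc n)
  obtain S where P: "clinear_op P" "\<And>x. P (P x) = P x" "\<And>x. A (P x) = P (A x)"
    "\<And>x. shifted A \<mu> (S x) = x - P x"
    using assms(2) unfolding riesz_def by auto
  obtain w where w: "x - P x = op_pow (shifted A \<mu>) n w" using Suc.IH by auto
  have "x - P x = (x - P x) - P (x - P x)"
    by (simp add: blinfun.diff_right P(2))
  also have "\<dots> = op_pow (shifted A \<mu>) n (w - P w)"
    unfolding w blinfun_funpow_diff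
    by (simp add: blinfun_funpow_commute[OF shifted_commute[OF P(1,3)]])
  also have "w - P w = shifted A \<mu> (S w)" by (simp only: P(4))
  finally show ?case by (auto simp only: funpow_Suc_right comp_apply)
qed simp

text \<open>Coprimality of powers of X - \<mu> and X - \<mu>'. By induction (A - \<mu>) v is already
  0, and on such an eigenvector A - \<mu>' is multiplication by \<mu> - \<mu>'.\<close>

lemma coprime_nilpotent:
  assumes A: "clinear_op A" and "\<mu> \<noteq> \<mu>'"
    and "op_pow (shifted A \<mu>) n v = 0" "op_pow (shifted A \<mu>') m v = 0"
  shows "v = 0"
  using assms(3,4)
proof (induction n arbitrary: v)
  case (Suc n)
  have comm: "shifted A \<mu>' (shifted A \<mu> x) = shifted A \<mu> (shifted A \<mu>' x)" for x
    by (simp add: shifted_apply blinfun.diff_right clinear_op_scaleC[OF A] scaleC.diff_right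
        scaleC_scaleC mult.commute algebra_simps)
  have "shifted A \<mu> v = 0"
  proof (rule Suc.IH)
    show "op_pow (shifted A \<mu>) n (shifted A \<mu> v) = 0"
      using Suc.prems(1) by (simp add: funpow_swap1)
    show "op_pow (shifted A \<mu>') m (shifted A \<mu> v) = 0"
      using Suc.prems(2) by (simp add: blinfun_funpow_commute[OF comm] blinfun.zero_right)
  qed
  then have "shifted A \<mu>' v = (\<mu> - \<mu>') *\<^sub>C v"
    by (simp add: shifted_apply scaleC.diff_left)
  then have "op_pow (shifted A \<mu>') k v = (\<mu> - \<mu>') ^ k *\<^sub>C v" for k
    by (induction k)
      (simp_all add: clinear_op_scaleC[OF clinear_op_shifted[OF A]] scaleC_scaleC mult.commute)
  from this[of m] show ?case using Suc.prems(2) \<open>\<mu> \<noteq> \<mu>'\<close> by simp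
qed simp

lemma riesz_disjoint:
  assumes A: "clinear_op A" and P: "riesz A \<mu> P" and P': "riesz A \<mu>' P'" and "\<mu> \<noteq> \<mu>'"
  shows "P (P' x) = 0"
proof -
  obtain n where n: "op_pow (shifted A \<mu>) n (P (P' x)) = 0"
    using P unfolding riesz_def by blast
  obtain m where m: "op_pow (shifted A \<mu>') m (P' x) = 0"
    using P' unfolding riesz_def by blast
  have "clinear_op P" "\<And>x. A (P x) = P (A x)" using P unfolding riesz_def by auto
  then have "op_pow (shifted A \<mu>') m (P (P' x)) = 0"
    by (simp add: blinfun_funpow_commute[OF shifted_commute] m blinfun.zero_right)
  then show ?thesis using coprime_nilpotent[OF A \<open>\<mu> \<noteq> \<mu>'\<close> n] by blast
qed

text \<open>\<open>Q x\<close> is killed by a power of B - cnj \<mu> and \<open>y - P y\<close> lies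
  in the range of the same power of A - \<mu>, so they are orthogonal; likewise
  \<open>x - Q x\<close> and \<open>P y\<close>. Subtracting gives the claim with no conjugation of
  contour integrals.\<close>

lemma riesz_adjoint:
  fixes A B :: "'a::complex_inner \<Rightarrow>\<^sub>L 'a"
  assumes A: "clinear_op A" "riesz A \<mu> P" and B: "clinear_op B" "riesz B (cnj \<mu>) Q"
    and adj: "\<And>x y. cinner (B x) y = cinner x (A y)"
  shows "cinner (Q x) y = cinner x (P y)"
proof -
  have L: "cinner (op_pow (shifted B (cnj \<mu>)) n x) y
      = cinner x (op_pow (shifted A \<mu>) n y)" for n x y
  proof (induction n arbitrary: x)
    case (Suc n)
    have "cinner (shifted B (cnj \<mu>) x) w = cinner x (shifted A \<mu> w)" for w
      by (simp add: shifted_apply cinner_simps adj)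
    then show ?case using Suc.IH by (simp only: funpow_Suc_right comp_apply) (simp add: funpow_swap1)
  qed simp
  obtain n where n: "\<And>x. op_pow (shifted A \<mu>) n (P x) = 0"
    using A(2) unfolding riesz_def by blast
  obtain m where m: "\<And>x. op_pow (shifted B (cnj \<mu>)) m (Q x) = 0"
    using B(2) unfolding riesz_def by blast
  obtain w where w: "y - P y = op_pow (shifted A \<mu>) m w"
    using riesz_range_power[OF A] by blast
  obtain v where v: "x - Q x = op_pow (shifted B (cnj \<mu>)) n v"
    using riesz_range_power[OF B] by blast
  have "cinner (Q x) (y - P y) = 0"
    unfolding w L[symmetric] m by (rule cinner.zero_left)
  moreover have "cinner (x - Q x) (P y) = 0"
    unfolding v L n by (rule cinner.zero_right)
  ultimately show ?thesis by (simp add: cinner_diff_left cinner_diff_right)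
qed

text \<open>\<open>A' = A (1 + c A)\<^sup>-\<^sup>1\<close> is a Moebius function of \<open>A\<close>, so both have the same
  spectral projections.\<close>

lemma riesz_Moebius:
  assumes A: "clinear_op A" and A': "clinear_op A'"
    and I1: "\<And>x. A x - A' x = c *\<^sub>C A (A' x)" and I2: "\<And>x. A x - A' x = c *\<^sub>C A' (A x)"
    and P: "riesz A \<mu> P" and c: "1 + c * \<mu> \<noteq> 0"
  shows "riesz A' (\<mu> / (1 + c * \<mu>)) P"
proof -
  define \<kappa> where "\<kappa> = 1 / (1 + c * \<mu>)"
  define L where "L = shifted A \<mu>"
  define L' where "L' = shifted A' (\<mu> / (1 + c * \<mu>))"
  \<comment> \<open>\<open>U\<close> and \<open>Ui\<close> are mutually inverse and commute with
    \<open>P\<close>. Since L' = \<kappa> U L with U and L commuting, nilpotence passes from L to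
    L', and the partial inverse becomes S Ui / \<kappa>.\<close>
  define U where "U = id_blinfun - c *\<^sub>C A'"
  define Ui where "Ui = id_blinfun + c *\<^sub>C A"
  have \<kappa>0: "\<kappa> \<noteq> 0" using c by (simp add: \<kappa>_def)
  have cU: "clinear_op U" "clinear_op Ui"
    unfolding U_def Ui_def by (intro clinear_op_intros A A')+
  have cL: "clinear_op L" "clinear_op L'"
    unfolding L_def L'_def by (intro clinear_op_shifted A A')+
  have U: "U x = x - c *\<^sub>C A' x" "Ui x = x + c *\<^sub>C A x" for x
    by (simp_all add: U_def Ui_def blinfun.diff_left blinfun.add_left)
  have UUi: "U (Ui x) = x" for x
  proof -
    have "U (Ui x) = x + c *\<^sub>C (A x - A' x - c *\<^sub>C A' (A x))"
      by (simp add: U blinfun.add_right blinfun.diff_right clinear_op_scaleC[OF A']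
          scaleC_add_right scaleC.diff_right)
    then show ?thesis unfolding I2 by (simp add: scaleC.zero_right)
  qed
  have UiU: "Ui (U x) = x" for x
  proof -
    have "Ui (U x) = x + c *\<^sub>C (A x - A' x - c *\<^sub>C A (A' x))"
      by (simp add: U blinfun.add_right blinfun.diff_right clinear_op_scaleC[OF A]
          scaleC_add_right scaleC.diff_right)
    then show ?thesis unfolding I1 by (simp add: scaleC.zero_right)
  qed
  have UA: "U (A x) = A' x" for x using I2[of x] by (simp add: U algebra_simps)
  have AU: "A (U x) = A' x" for x
    using I1[of x] by (simp add: U blinfun.diff_right clinear_op_scaleC[OF A] algebra_simps)
  have LU: "L (U x) = U (L x)" for x
    by (simp add: L_def shifted_apply AU UA blinfun.diff_right clinear_op_scaleC[OF cU(1)])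
  have L'U: "L' x = \<kappa> *\<^sub>C U (L x)" for x
  proof -
    have "U (L x) = (1 + c * \<mu>) *\<^sub>C A' x - \<mu> *\<^sub>C x"
      by (simp add: L_def shifted_apply blinfun.diff_right clinear_op_scaleC[OF cU(1)] UA)
        (simp add: U(1) scaleC.diff_right scaleC_add_left scaleC_scaleC mult.commute)
    then show ?thesis
      using c by (simp add: L'_def shifted_apply \<kappa>_def scaleC.diff_right scaleC_scaleC)
  qed
  obtain n S where PP: "clinear_op P" "finite_rank P" "\<And>x. P (P x) = P x" "\<And>x. A (P x) = P (A x)"
    "\<And>x. op_pow L n (P x) = 0"
    "clinear_op S" "\<And>x. S (L x) = x - P x" "\<And>x. L (S x) = x - P x"
    using P unfolding riesz_def L_def by auto
  have UiP: "Ui (P x) = P (Ui x)" for x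
    by (simp add: U PP(4) blinfun.add_right clinear_op_scaleC[OF PP(1)])
  have UP: "U (P x) = P (U x)" for x
    by (metis UiP UUi UiU)
  have A'P: "A' (P x) = P (A' x)" for x
    by (metis UA UP PP(4))
  have nil: "op_pow L k y = 0 \<Longrightarrow> op_pow L' k y = 0" for k y
  proof (induction k arbitrary: y)
    case (Suc k)
    have "op_pow L k (U (L y)) = U (op_pow L k (L y))"
      by (rule blinfun_funpow_commute[OF LU])
    also have "\<dots> = 0"
      using Suc.prems by (simp add: funpow_swap1 blinfun.zero_right)
    finally have "op_pow L' k (U (L y)) = 0" by (rule Suc.IH)
    then have "op_pow L' k (L' y) = 0"
      unfolding L'U[of y] by (simp add: blinfun_funpow_scaleC[OF cL(2)] scaleC.zero_right)
    then show ?case by (simp add: funpow_swap1)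
  qed simp
  define S' where "S' = (1 / \<kappa>) *\<^sub>C (S o\<^sub>L Ui)"
  have S': "clinear_op S'" unfolding S'_def by (intro clinear_op_intros PP(6) cU)
  have S'L': "S' (L' x) = x - P x" for x
    using \<kappa>0 by (simp add: S'_def L'U clinear_op_scaleC[OF cU(2)] clinear_op_scaleC[OF PP(6)]
        UiU PP(7) scaleC_scaleC)
  have L'S': "L' (S' x) = x - P x" for x
  proof -
    have "L' (S' x) = U (L (S (Ui x)))"
      using \<kappa>0 by (simp add: S'_def L'U clinear_op_scaleC[OF cU(1)] clinear_op_scaleC[OF cL(1)]
          scaleC_scaleC)
    then show ?thesis by (simp add: PP(8) blinfun.diff_right UUi UP)
  qed
  show ?thesis
    unfolding riesz_def L'_def[symmetric]
    by (intro conjI allI PP(1-3) A'P exI[of _ n] exI[of _ S'] nil PP(5) S' S'L' L'S')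
qed

text \<open>For \<sigma> non-zero this is the classical swap of factors. The value 0 must be covered
  because a resonance circle may enclose it; there invertibility of T J with \<open>T\<close>
  approximable forces the space to be finite-dimensional, where an injective operator is
  invertible.\<close>

lemma not_in_spectrum_compose_swap:
  fixes T J :: "'a::chilbert_space \<Rightarrow>\<^sub>L 'a"
  assumes T: "approximable T" and J: "clinear_op J" and \<sigma>: "\<sigma> \<notin> op_spectrum (T o\<^sub>L J)"
  shows "\<sigma> \<notin> op_spectrum (J o\<^sub>L T)"
proof -
  have cT: "clinear_op T" by (rule approximable_clinear_op[OF T])
  define R where "R = op_resolvent (T o\<^sub>L J) \<sigma>"
  have cR: "clinear_op R"
    unfolding R_def by (intro clinear_op_resolvent clinear_op_compose cT J \<sigma>)
  have R1: "R (\<sigma> *\<^sub>C x - T (J x)) = x" for x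
    using op_resolvent_inverse(1)[OF \<sigma>] by (simp add: R_def)
  have R2: "\<sigma> *\<^sub>C R x - T (J (R x)) = x" for x
    using op_resolvent_inverse(2)[OF \<sigma>] by (simp add: R_def)
  show ?thesis
  proof (cases "\<sigma> = 0")
    case False
    \<comment> \<open>Jacobson's formula for the inverse of \<sigma> - J T in terms of the inverse
      \<open>R\<close> of \<sigma> - T J.\<close>
    define G where "G = (1 / \<sigma>) *\<^sub>C (id_blinfun + (J o\<^sub>L R o\<^sub>L T))"
    have G: "G x = (1 / \<sigma>) *\<^sub>C (x + J (R (T x)))" for x
      by (simp add: G_def blinfun.add_left)
    show ?thesis
    proof (rule not_in_spectrumI[of G])
      fix x
      have "R (T (\<sigma> *\<^sub>C x - J (T x))) = T x"
        using R1[of "T x"] by (simp add: blinfun.diff_right clinear_op_scaleC[OF cT])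
      then show "G (\<sigma> *\<^sub>C x - (J o\<^sub>L T) x) = x"
        using False by (simp add: G scaleC_scaleC)
      have "\<sigma> *\<^sub>C J (R (T x)) - J (T (J (R (T x)))) = J (T x)"
        using arg_cong[OF R2[of "T x"], of J]
        by (simp add: blinfun.diff_right clinear_op_scaleC[OF J])
      then have e: "J (T (J (R (T x)))) = \<sigma> *\<^sub>C J (R (T x)) - J (T x)"
        by (simp add: algebra_simps)
      show "\<sigma> *\<^sub>C G x - (J o\<^sub>L T) (G x) = x"
        using False
        by (simp add: G clinear_op_scaleC[OF cT] clinear_op_scaleC[OF J] scaleC_scaleC
            blinfun.add_right e scaleC_add_right scaleC.diff_right)
    qed
  next
    case True
    have TJR: "T (J (R x)) = - x" for x
    proof -
      have "- T (J (R x)) = x" using R2[of x] True by simp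
      then show ?thesis by (metis minus_minus)
    qed
    \<comment> \<open>An identity with approximable factor \<open>T\<close> is itself approximable,
      and then so is every complex-linear operator on the space.\<close>
    have "(id_blinfun :: 'a \<Rightarrow>\<^sub>L 'a) = (- 1) *\<^sub>C (T o\<^sub>L (J o\<^sub>L R))"
      by (rule blinfun_eqI) (simp add: TJR blinfun.minus_left)
    then have aid: "approximable (id_blinfun :: 'a \<Rightarrow>\<^sub>L 'a)"
      using approximable_cmult[OF approximable_compose_right[OF T clinear_op_compose[OF J cR]]]
      by metis
    have all: "approximable M" if "clinear_op M" for M :: "'a \<Rightarrow>\<^sub>L 'a"
    proof -
      have "M o\<^sub>L id_blinfun = M" by (rule blinfun_eqI) simp
      then show ?thesis using approximable_compose_left[OF aid that] by simp
    qed
    have surj: "\<exists>w. J (R w) = x" for x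
    proof -
      \<comment> \<open>The Fredholm alternative for 1 - X at the value 1 inverts X itself. Here X =
        J R; further down X = - J T.\<close>
      have a: "approximable (id_blinfun - (J o\<^sub>L R))"
        by (intro all clinear_op_intros J cR)
      have inj: "y = 0" if "(id_blinfun - (J o\<^sub>L R)) y = 1 *\<^sub>C y" for y
        using that TJR[of y] by (simp add: blinfun.diff_left blinfun.zero_right)
      obtain G where "\<And>y. 1 *\<^sub>C blinfun_apply G y - (id_blinfun - (J o\<^sub>L R)) (G y) = y"
        using Fredholm_alternative[OF a one_neq_zero inj] by metis
      from this[of x] show ?thesis by (auto simp: blinfun.diff_left)
    qed
    have Tinj: "x = 0" if "T x = 0" for x
    proof -
      obtain w where w: "J (R w) = x" using surj by blast
      have "w = 0" using TJR[of w] that unfolding w by simp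
      then show ?thesis using w by (simp add: blinfun.zero_right)
    qed
    have Jinj: "x = 0" if "J x = 0" for x
      using R1[of x] True that by (simp add: blinfun.zero_right)
    have a: "approximable (id_blinfun + (J o\<^sub>L T))"
      by (intro all clinear_op_intros J cT)
    have inj: "y = 0" if "(id_blinfun + (J o\<^sub>L T)) y = 1 *\<^sub>C y" for y
    proof -
      have "y + J (T y) = y + 0" using that by (simp add: blinfun.add_left)
      then have "J (T y) = 0" by (rule add_left_imp_eq)
      then have "T y = 0" by (rule Jinj)
      then show "y = 0" by (rule Tinj)
    qed
    obtain G where G: "\<And>x. blinfun_apply G (1 *\<^sub>C x - (id_blinfun + (J o\<^sub>L T)) x) = x"
        "\<And>y. 1 *\<^sub>C blinfun_apply G y - (id_blinfun + (J o\<^sub>L T)) (G y) = y"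
      using Fredholm_alternative[OF a one_neq_zero inj] by metis
    show ?thesis
      by (rule not_in_spectrumI[of G]) (use G True in \<open>simp_all add: blinfun.add_left\<close>)
  qed
qed

section \<open>The sandwiched resolvent\<close>

lemma closed_dense_UNIV:
  assumes "closure D = UNIV" "closed S" "D \<subseteq> S"
  shows "x \<in> S"
  using closure_minimal[OF assms(3,2)] assms(1) by auto

lemma subspace_closure:
  assumes S: "csubspace (S :: 'a::complex_normed_vector set)"
  shows "csubspace (closure S)"
proof (rule complex_vector.subspaceI)
  show "0 \<in> closure S"
    using complex_vector.subspace_0[OF S] closure_subset by blast
next
  fix x y assume "x \<in> closure S" "y \<in> closure S"
  then obtain f g where f: "\<And>n. f n \<in> S" "f \<longlonglongrightarrow> x" and g: "\<And>n. g n \<in> S" "g \<longlonglongrightarrow> y"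
    unfolding closure_sequential by auto
  show "x + y \<in> closure S"
    unfolding closure_sequential
    by (rule exI[of _ "\<lambda>n. f n + g n"])
      (use f g in \<open>auto intro: tendsto_add complex_vector.subspace_add[OF S]\<close>)
next
  fix c x assume "x \<in> closure S"
  then obtain f where f: "\<And>n. f n \<in> S" "f \<longlonglongrightarrow> x"
    unfolding closure_sequential by auto
  show "c *\<^sub>C x \<in> closure S"
    unfolding closure_sequential
    by (rule exI[of _ "\<lambda>n. c *\<^sub>C f n"])
      (use f in \<open>auto intro: scaleC.tendsto complex_vector.subspace_scale[OF S]\<close>)
qed

lemma adj_add: "(g, h) \<in> adj F \<Longrightarrow> (g', h') \<in> adj F \<Longrightarrow> (g + g', h + h') \<in> adj F"
  by (auto simp: adj_def cinner_add_right split_beta)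

lemma adj_scaleC: "(g, h) \<in> adj F \<Longrightarrow> (c *\<^sub>C g, c *\<^sub>C h) \<in> adj F"
  by (auto simp: adj_def cinner_scaleC_right split_beta)

lemma adj_0: "(0, 0) \<in> adj F"
  by (auto simp: adj_def cinner.zero_right)

lemma adjD: "(g, h) \<in> adj F \<Longrightarrow> (f, f') \<in> F \<Longrightarrow> cinner f' g = cinner f h"
  by (auto simp: adj_def)

text \<open>Von Neumann: a vector orthogonal to the domain of the adjoint lies in the multivalued part
  of the graph of \<open>F\<close>.\<close>

lemma adj_densely_defined:
  fixes F :: "('h::chilbert_space \<times> 'k::chilbert_space) set"
  assumes F: "linear_operator F" "closed F"
  shows "closure (Domain (adj F)) = UNIV"
proof (rule ccontr)
  assume "closure (Domain (adj F)) \<noteq> UNIV"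
  then obtain x where x: "x \<notin> closure (Domain (adj F))" by auto
  have "csubspace (Domain (adj F))"
    by (rule complex_vector.subspaceI)
      (auto intro: adj_0 adj_add adj_scaleC DomainI)
  then have sub: "csubspace (closure (Domain (adj F)))" by (rule subspace_closure)
  obtain p where p: "p \<in> closure (Domain (adj F))"
    "\<And>y. y \<in> closure (Domain (adj F)) \<Longrightarrow> cinner y (x - p) = 0"
    using orthogonal_decomposition[OF sub closed_closure] by metis
  \<comment> \<open>A non-zero vector orthogonal to the domain of the adjoint; the pair (0, g) will
    turn out to lie in \<open>F\<close>, against single-valuedness.\<close>
  define g where "g = x - p"
  have g0: "g \<noteq> 0" using p(1) x by (auto simp: g_def)
  have g: "cinner d g = 0" if "d \<in> Domain (adj F)" for d
    unfolding g_def by (rule p(2)[OF subsetD[OF closure_subset that]])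
  have "csubspace F"
    using F(1) unfolding linear_operator_def
    by (intro complex_vector.subspaceI) (auto simp: scaleC_prod_def zero_prod_def)
  then obtain q where q: "q \<in> F" "\<And>y. y \<in> F \<Longrightarrow> cinner y ((0, g) - q) = 0"
    using orthogonal_decomposition[OF _ F(2)] by metis
  define c d where "c = fst ((0, g) - q)" and "d = snd ((0, g) - q)"
  have cd: "(0, g) - q = (c, d)" by (simp only: c_def d_def prod.collapse)
  \<comment> \<open>The adjoint is the orthogonal complement of the graph turned by a right angle,
    and (c, d) is the component of (0, g) in that complement.\<close>
  have "(d, - c) \<in> adj F"
    unfolding adj_def
  proof (clarsimp)
    fix f f' assume "(f, f') \<in> F"
    from q(2)[OF this] show "cinner f' d = cinner f (- c)"
      unfolding cd by (simp add: cinner_prod_def cinner_minus_right eq_neg_iff_add_eq_0 add.commute)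
  qed
  then have "cinner d g = 0" using g by auto
  then have "cinner (c, d) (0, g) = 0" by (simp add: cinner_prod_def cinner.zero_right)
  moreover have "cinner (c, d) q = 0"
    using q(2)[OF q(1)] cinner_commute[of "(c, d)" q] unfolding cd by simp
  ultimately have "cinner (c, d) ((0, g) - q) = 0" by (simp only: cinner_diff_right) simp
  then have "(0, g) - q = 0" unfolding cd cinner_eq_zero_iff .
  then have "(0, g) \<in> F" using q(1) by simp
  moreover have "(0, 0) \<in> F" "single_valued F" using F(1) by (auto simp: linear_operator_def)
  ultimately show False using g0 by (auto simp: single_valued_def)
qed

context resonance_setting
begin

lemma adj_F_dense: "closure (Domain (adj F)) = UNIV"
  by (rule adj_densely_defined[OF F_operator(1,2)])

text \<open>The witnesses are u = (H_s - z)^-1 applied to the image of \<open>x\<close> under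
  \<open>adj F\<close>, and y = H_s u. All properties of T are computed with them, so no bounded
  resolvent operator is ever formed.\<close>

lemma T_graph_iff:
  "(x, w) \<in> T_graph H0 F J z s \<longleftrightarrow>
    (\<exists>u y. (x, y - z *\<^sub>C u) \<in> adj F \<and> (u, y) \<in> H_op H0 F J s \<and> (u, w) \<in> F)"
  unfolding T_graph_def resolvent_graph_def by (auto simp: relcomp_unfold)

text \<open>Density of the domain of \<open>adj F\<close> makes the bounded extension unique, which
  is what the definite description in \<open>T_op\<close> requires.\<close>

lemma T_op_properties:
  assumes "Im z \<noteq> 0"
  shows "clinear_op (T_op H0 F J z s)" "compact_op (T_op H0 F J z s)"
    "T_graph H0 F J z s \<subseteq> op_graph (T_op H0 F J z s)"
proof -
  have dom: "Domain (T_graph H0 F J z s) = Domain (adj F)"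
    and "\<exists>T. clinear_op T \<and> compact_op T \<and> T_graph H0 F J z s \<subseteq> op_graph T"
    using T_compact[OF assms, of s] by auto
  then obtain T where T: "clinear_op T" "compact_op T" "T_graph H0 F J z s \<subseteq> op_graph T"
    by metis
  have uniq: "T' = T" if T': "T_graph H0 F J z s \<subseteq> op_graph T'" for T'
  proof (rule blinfun_eqI)
    fix x
    have "closed {x. blinfun_apply T' x = T x}"
      by (intro closed_Collect_eq continuous_intros)
    moreover have "Domain (adj F) \<subseteq> {x. blinfun_apply T' x = T x}"
    proof
      fix x assume "x \<in> Domain (adj F)"
      then obtain w where "(x, w) \<in> T_graph H0 F J z s"
        unfolding dom[symmetric] by (rule DomainE)
      then have "T x = w" "T' x = w" using T(3) T' by (auto simp: op_graph_def)
      then show "x \<in> {x. blinfun_apply T' x = T x}" by simp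
    qed
    ultimately show "T' x = T x" using closed_dense_UNIV[OF adj_F_dense] by blast
  qed
  have "T_op H0 F J z s = T"
    unfolding T_op_def
  proof (rule the_equality)
    show "T_graph H0 F J z s \<subseteq> op_graph T" by (rule T(3))
  qed (rule uniq)
  then show "clinear_op (T_op H0 F J z s)" "compact_op (T_op H0 F J z s)"
    "T_graph H0 F J z s \<subseteq> op_graph (T_op H0 F J z s)"
    using T by auto
qed

lemma T_op_eqI:
  assumes "Im z \<noteq> 0" "(x, y - z *\<^sub>C u) \<in> adj F" "(u, y) \<in> H_op H0 F J s" "(u, w) \<in> F"
  shows "T_op H0 F J z s x = w"
proof -
  have "(x, w) \<in> T_graph H0 F J z s" using assms(2-4) T_graph_iff by blast
  then show ?thesis using T_op_properties(3)[OF assms(1), of s] by (auto simp: op_graph_def)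
qed

lemma T_op_obtain:
  assumes "Im z \<noteq> 0" "x \<in> Domain (adj F)"
  shows "\<exists>u y. (x, y - z *\<^sub>C u) \<in> adj F \<and> (u, y) \<in> H_op H0 F J s \<and>
    (u, T_op H0 F J z s x) \<in> F"
proof -
  have "Domain (T_graph H0 F J z s) = Domain (adj F)"
    using T_compact[OF assms(1), of s] by simp
  with assms(2) obtain w where "(x, w) \<in> T_graph H0 F J z s"
    by (metis DomainE)
  then obtain u y where *: "(x, y - z *\<^sub>C u) \<in> adj F" "(u, y) \<in> H_op H0 F J s" "(u, w) \<in> F"
    unfolding T_graph_iff by blast
  with T_op_eqI[OF assms(1) *] show ?thesis by blast
qed

section \<open>Adjoint, dependence on the coupling constant and imaginary part of T_z(H_s)\<close>

lemma H_symmetric: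
  assumes "(u, y) \<in> H_op H0 F J s" "(u', y') \<in> H_op H0 F J s"
  shows "cinner y u' = cinner u y'"
proof -
  have "(u', y') \<in> adj (H_op H0 F J s)"
    using assms(2) H_self_adjoint[of s] by (simp add: self_adjoint_def)
  then show ?thesis using assms(1) by (rule adjD)
qed

text \<open>On the domain of \<open>adj F\<close> symmetry of H_s carries z across the inner
  product; the identity then extends by continuity, one argument at a time.\<close>

lemma T_op_adjoint:
  assumes z: "Im z \<noteq> 0"
  shows "cinner (T_op H0 F J z s x) x' = cinner x (T_op H0 F J (cnj z) s x')"
proof -
  have z': "Im (cnj z) \<noteq> 0" using z by simp
  have dense: "cinner (T_op H0 F J z s x) x' = cinner x (T_op H0 F J (cnj z) s x')"
    if x: "x \<in> Domain (adj F)" and x': "x' \<in> Domain (adj F)" for x x'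
  proof -
    obtain u y where u: "(x, y - z *\<^sub>C u) \<in> adj F" "(u, y) \<in> H_op H0 F J s"
      "(u, T_op H0 F J z s x) \<in> F"
      using T_op_obtain[OF z x] by blast
    obtain u' y' where u': "(x', y' - cnj z *\<^sub>C u') \<in> adj F" "(u', y') \<in> H_op H0 F J s"
      "(u', T_op H0 F J (cnj z) s x') \<in> F"
      using T_op_obtain[OF z' x'] by blast
    have "cinner (T_op H0 F J z s x) x' = cinner u (y' - cnj z *\<^sub>C u')"
      by (rule adjD[OF u'(1) u(3)])
    also have "\<dots> = cinner (y - z *\<^sub>C u) u'"
      using H_symmetric[OF u(2) u'(2)] by (simp add: cinner_simps)
    also have "\<dots> = cinner x (T_op H0 F J (cnj z) s x')"
      using adjD[OF u(1) u'(3)] cinner_commute by metis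
    finally show ?thesis .
  qed
  have closed1: "closed {x. cinner (T_op H0 F J z s x) x' = cinner x (T_op H0 F J (cnj z) s x')}" for x'
    by (intro closed_Collect_eq cinner.continuous_on continuous_intros)
  have closed2: "closed {x'. cinner (T_op H0 F J z s x) x' = cinner x (T_op H0 F J (cnj z) s x')}"
    by (intro closed_Collect_eq cinner.continuous_on continuous_intros)
  have "x \<in> {x. cinner (T_op H0 F J z s x) x' = cinner x (T_op H0 F J (cnj z) s x')}"
    if "x' \<in> Domain (adj F)" for x'
    by (rule closed_dense_UNIV[OF adj_F_dense closed1]) (use dense that in auto)
  then have "x' \<in> {x'. cinner (T_op H0 F J z s x) x' = cinner x (T_op H0 F J (cnj z) s x')}"
    by (intro closed_dense_UNIV[OF adj_F_dense closed2]) auto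
  then show ?thesis by simp
qed

text \<open>One vector \<open>u\<close> serves both coupling constants: (H_s - z) u exceeds (H_t -
  z) u by (s - t) V u, and V u is the image of J F u under \<open>adj F\<close>. So passing from t
  to s merely adds (s - t) J w to the argument, where w = F u.\<close>

lemma T_op_resolvent_identity:
  assumes z: "Im z \<noteq> 0"
  shows "T_op H0 F J z t x - T_op H0 F J z s x
    = of_real (s - t) *\<^sub>C T_op H0 F J z s (J (T_op H0 F J z t x))"
proof -
  have cl: "closed {x. T_op H0 F J z t x - T_op H0 F J z s x
    = of_real (s - t) *\<^sub>C T_op H0 F J z s (J (T_op H0 F J z t x))}"
    by (intro closed_Collect_eq scaleC.continuous_on continuous_intros)
  have "Domain (adj F) \<subseteq> {x. T_op H0 F J z t x - T_op H0 F J z s x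
    = of_real (s - t) *\<^sub>C T_op H0 F J z s (J (T_op H0 F J z t x))}"
  proof (intro subsetI, unfold mem_Collect_eq)
    fix x assume x: "x \<in> Domain (adj F)"
    define w where "w = T_op H0 F J z t x"
    obtain u y where u: "(x, y - z *\<^sub>C u) \<in> adj F" "(u, y) \<in> H_op H0 F J t" "(u, w) \<in> F"
      using T_op_obtain[OF z x] unfolding w_def by blast
    obtain h v where h: "(u, h) \<in> H0" "(u, v) \<in> V_op F J" "y = h + t *\<^sub>R v"
      using u(2) unfolding H_op_def by blast
    obtain w' where w': "(u, w') \<in> F" "(J w', v) \<in> adj F"
      using h(2) unfolding V_op_def op_graph_def by auto
    \<comment> \<open>\<open>w'\<close> is the value F u hidden in the factorization of V u; it must
      be the one entering T.\<close>
    have "w' = w"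
      using F_operator(1) u(3) w'(1) by (auto simp: linear_operator_def single_valued_def)
    have "(x + of_real (s - t) *\<^sub>C J w, (y - z *\<^sub>C u) + of_real (s - t) *\<^sub>C v) \<in> adj F"
      using w'(2) \<open>w' = w\<close> by (intro adj_add adj_scaleC u(1)) simp
    also have "(y - z *\<^sub>C u) + of_real (s - t) *\<^sub>C v = (h + s *\<^sub>R v) - z *\<^sub>C u"
      by (simp add: h(3) scaleC_of_real scaleR_diff_left del: of_real_diff)
    finally have "T_op H0 F J z s (x + of_real (s - t) *\<^sub>C J w) = w"
      by (rule T_op_eqI[OF z _ _ u(3)]) (use h in \<open>auto simp: H_op_def\<close>)
    then show "T_op H0 F J z t x - T_op H0 F J z s x
      = of_real (s - t) *\<^sub>C T_op H0 F J z s (J (T_op H0 F J z t x))"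
      unfolding w_def[symmetric] blinfun.add_right
      by (simp only: clinear_op_scaleC[OF T_op_properties(1)[OF z]]) (simp add: diff_eq_eq add.commute)
  qed
  from closed_dense_UNIV[OF adj_F_dense cl this] show ?thesis by simp
qed

text \<open>For x in the domain of \<open>adj F\<close> the imaginary part of <x, T x> is Im z times
  the squared norm of the resolvent vector \<open>u\<close>. A general \<open>v\<close> is
  approximated by such x; \<open>u n\<close> need not converge unless the imaginary part at
  \<open>v\<close> is 0.\<close>

lemma T_op_imaginary_part:
  assumes z: "Im z \<noteq> 0"
  shows "0 \<le> Im z * Im (cinner v (T_op H0 F J z s v))"
    and "Im (cinner v (T_op H0 F J z s v)) = 0 \<Longrightarrow> T_op H0 F J z s v = 0"
proof -
  define T where "T = T_op H0 F J z s"
  obtain x where x: "\<And>n::nat. x n \<in> Domain (adj F)" "x \<longlonglongrightarrow> v"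
    using adj_F_dense closure_sequential[of v "Domain (adj F)"] by auto
  have "\<forall>n. \<exists>u y. (x n, y - z *\<^sub>C u) \<in> adj F \<and> (u, y) \<in> H_op H0 F J s \<and> (u, T (x n)) \<in> F"
    using T_op_obtain[OF z x(1)] unfolding T_def by blast
  then obtain u y where u: "\<And>n. (x n, y n - z *\<^sub>C u n) \<in> adj F"
    "\<And>n. (u n, y n) \<in> H_op H0 F J s" "\<And>n. (u n, T (x n)) \<in> F"
    by metis
  have Im_eq: "Im (cinner (x n) (T (x n))) = Im z * (norm (u n))\<^sup>2" for n
  proof -
    have "cinner (y n) (u n) = cinner (u n) (y n)" by (rule H_symmetric[OF u(2) u(2)])
    then have "Im (cinner (u n) (y n)) = 0"
      by (metis cinner_commute Reals_cnj_iff complex_is_Real_iff)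
    then have "Im (cinner (u n) (y n - z *\<^sub>C u n)) = - (Im z * (norm (u n))\<^sup>2)"
      by (simp add: cinner_simps cinner_self del: of_real_power)
    moreover have "cinner (T (x n)) (x n) = cinner (u n) (y n - z *\<^sub>C u n)"
      by (rule adjD[OF u(1) u(3)])
    ultimately show ?thesis using cinner_commute[of "x n" "T (x n)"] by simp
  qed
  have Tlim: "(\<lambda>n. T (x n)) \<longlonglongrightarrow> T v"
    by (intro blinfun.tendsto tendsto_const x(2))
  have lim: "(\<lambda>n. Im z * (norm (u n))\<^sup>2) \<longlonglongrightarrow> Im (cinner v (T v))"
    unfolding Im_eq[symmetric] by (intro tendsto_Im cinner.tendsto x(2) Tlim)
  have "(\<lambda>n. Im z * (Im z * (norm (u n))\<^sup>2)) \<longlonglongrightarrow> Im z * Im (cinner v (T v))"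
    by (intro tendsto_mult tendsto_const lim)
  then have "0 \<le> Im z * Im (cinner v (T v))"
    by (rule LIMSEQ_le_const) (auto simp: mult.assoc[symmetric])
  then show "0 \<le> Im z * Im (cinner v (T_op H0 F J z s v))" by (simp add: T_def)
  show "T_op H0 F J z s v = 0" if "Im (cinner v (T_op H0 F J z s v)) = 0"
  proof -
    have "(\<lambda>n. (1 / Im z) * (Im z * (norm (u n))\<^sup>2)) \<longlonglongrightarrow> (1 / Im z) * 0"
      using lim that by (intro tendsto_mult tendsto_const) (simp add: T_def)
    then have "(\<lambda>n. (norm (u n))\<^sup>2) \<longlonglongrightarrow> 0" using z by simp
    then have "(\<lambda>n. sqrt ((norm (u n))\<^sup>2)) \<longlonglongrightarrow> sqrt 0" by (rule tendsto_real_sqrt)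
    then have "u \<longlonglongrightarrow> 0" by (simp add: tendsto_norm_zero_iff)
    \<comment> \<open>The pairs lie in the graph of \<open>F\<close>, so closedness gives T v = F 0
      = 0.\<close>
    then have "(\<lambda>n. (u n, T (x n))) \<longlonglongrightarrow> (0, T v)" by (intro tendsto_Pair Tlim)
    then have "(0, T v) \<in> F"
      by (rule closed_sequentially[OF F_operator(2) u(3)])
    then show ?thesis
      using F_operator(1) unfolding T_def linear_operator_def single_valued_def by blast
  qed
qed

section \<open>The idempotents P_z(r) and Q_z(r) as Riesz projections\<close>

lemma J_clinear: "clinear_op J"
  using J_self_adjoint by (simp add: self_adjoint_op_def)

lemma J_cinner: "cinner (J x) y = cinner x (J y)"
  using J_self_adjoint by (simp add: self_adjoint_op_def)

lemma T_approximable: "Im z \<noteq> 0 \<Longrightarrow> approximable (T_op H0 F J z s)"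
  by (intro compact_imp_approximable T_op_properties)

lemma A_approximable: "Im z \<noteq> 0 \<Longrightarrow> approximable (A_op H0 F J z s)"
  unfolding A_op_def by (intro approximable_compose_right T_approximable J_clinear)

lemma B_approximable: "Im z \<noteq> 0 \<Longrightarrow> approximable (B_op H0 F J z s)"
  unfolding B_op_def by (intro approximable_compose_left T_approximable J_clinear)

lemma A_clinear: "Im z \<noteq> 0 \<Longrightarrow> clinear_op (A_op H0 F J z s)"
  by (intro approximable_clinear_op A_approximable)

lemma B_clinear: "Im z \<noteq> 0 \<Longrightarrow> clinear_op (B_op H0 F J z s)"
  by (intro approximable_clinear_op B_approximable)

lemma A_B_adjoint:
  "Im z \<noteq> 0 \<Longrightarrow> cinner (B_op H0 F J (cnj z) s x) y = cinner x (A_op H0 F J z s y)"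
  using T_op_adjoint[of "cnj z" s x "J y"] by (simp add: A_op_def B_op_def J_cinner)

lemma A_identity:
  assumes "Im z \<noteq> 0"
  shows "A_op H0 F J z t x - A_op H0 F J z s x
    = of_real (s - t) *\<^sub>C A_op H0 F J z s (A_op H0 F J z t x)"
  using T_op_resolvent_identity[OF assms, of t "J x" s] by (simp add: A_op_def)

lemma B_identity:
  assumes "Im z \<noteq> 0"
  shows "B_op H0 F J z t x - B_op H0 F J z s x
    = of_real (s - t) *\<^sub>C B_op H0 F J z s (B_op H0 F J z t x)"
  using arg_cong[OF T_op_resolvent_identity[OF assms, of t x s], of J]
  by (simp add: B_op_def blinfun.diff_right clinear_op_scaleC[OF J_clinear] del: of_real_diff)

lemma resonance_circle_obtain:
  assumes z: "Im z \<noteq> 0" and r: "Im r \<noteq> 0"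
  obtains \<rho> where "\<rho> > 0"
    "cball (inverse (of_real s - r)) \<rho> \<inter> op_spectrum (A_op H0 F J z s) \<subseteq> {inverse (of_real s - r)}"
    "resonance_circle H0 F J s z r = circlepath (inverse (of_real s - r)) \<rho>"
proof -
  define \<mu> where "\<mu> = inverse (of_real s - r)"
  have "\<mu> \<noteq> 0" using r unfolding \<mu>_def by (auto simp: complex_eq_iff)
  define \<rho> where "\<rho> = (SOME \<rho>. \<rho> > 0 \<and> cball \<mu> \<rho> \<inter> op_spectrum (A_op H0 F J z s) \<subseteq> {\<mu>})"
  have "\<rho> > 0 \<and> cball \<mu> \<rho> \<inter> op_spectrum (A_op H0 F J z s) \<subseteq> {\<mu>}"
    unfolding \<rho>_def by (rule someI_ex) (rule isolated_in_spectrum[OF A_approximable[OF z] \<open>\<mu> \<noteq> 0\<close>])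
  moreover have "resonance_circle H0 F J s z r = circlepath \<mu> \<rho>"
    by (simp add: resonance_circle_def \<mu>_def \<rho>_def Let_def)
  ultimately show ?thesis using that[of \<rho>] unfolding \<mu>_def by blast
qed

lemma P_idem_riesz_same:
  assumes z: "Im z \<noteq> 0" and r: "Im r \<noteq> 0"
  shows "riesz (A_op H0 F J z s) (inverse (of_real s - r)) (P_idem H0 F J s z r)"
proof -
  obtain \<rho> where \<rho>: "\<rho> > 0"
    "cball (inverse (of_real s - r)) \<rho> \<inter> op_spectrum (A_op H0 F J z s) \<subseteq> {inverse (of_real s - r)}"
    "resonance_circle H0 F J s z r = circlepath (inverse (of_real s - r)) \<rho>"
    using resonance_circle_obtain[OF assms] .
  have "inverse (of_real s - r) \<noteq> 0" using r by (auto simp: complex_eq_iff)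
  then obtain P where P: "riesz (A_op H0 F J z s) (inverse (of_real s - r)) P"
    using riesz_exists[OF A_approximable[OF z]] by blast
  have "P_idem H0 F J s z r = P"
    unfolding P_idem_def \<rho>(3) by (rule riesz_contour_integral[OF A_clinear[OF z] P \<rho>(1,2)])
  then show ?thesis using P by simp
qed

lemma Q_idem_riesz_same:
  assumes z: "Im z \<noteq> 0" and r: "Im r \<noteq> 0"
  shows "riesz (B_op H0 F J z s) (inverse (of_real s - r)) (Q_idem H0 F J s z r)"
proof -
  obtain \<rho> where \<rho>: "\<rho> > 0"
    "cball (inverse (of_real s - r)) \<rho> \<inter> op_spectrum (A_op H0 F J z s) \<subseteq> {inverse (of_real s - r)}"
    "resonance_circle H0 F J s z r = circlepath (inverse (of_real s - r)) \<rho>"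
    using resonance_circle_obtain[OF assms] .
  \<comment> \<open>The circle was selected with the spectrum of A in view; comparison of T J with J
    T makes it admissible for B.\<close>
  have spec: "cball (inverse (of_real s - r)) \<rho> \<inter> op_spectrum (B_op H0 F J z s)
      \<subseteq> {inverse (of_real s - r)}"
    using \<rho>(2) not_in_spectrum_compose_swap[OF T_approximable[OF z] J_clinear]
    unfolding A_op_def B_op_def by blast
  have "inverse (of_real s - r) \<noteq> 0" using r by (auto simp: complex_eq_iff)
  then obtain P where P: "riesz (B_op H0 F J z s) (inverse (of_real s - r)) P"
    using riesz_exists[OF B_approximable[OF z]] by blast
  have "Q_idem H0 F J s z r = P"
    unfolding Q_idem_def \<rho>(3) by (rule riesz_contour_integral[OF B_clinear[OF z] P \<rho>(1) spec])
  then show ?thesis using P by simp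
qed

text \<open>1 + (t - s) / (s - r) = (t - r) / (s - r): the Moebius map that takes A_z(s) to A_z(t)
  moves the eigenvalue 1 / (s - r) to 1 / (t - r), and its denominator vanishes for no real t since
  r is not real.\<close>

lemma resonance_point_shift:
  assumes r: "Im r \<noteq> 0"
  shows "1 + of_real (t - s) * inverse (of_real s - r) \<noteq> 0"
    and "inverse (of_real s - r) / (1 + of_real (t - s) * inverse (of_real s - r))
      = inverse (of_real t - r)"
proof -
  have nz: "of_real s - r \<noteq> 0" "of_real t - r \<noteq> 0" using r by (auto simp: complex_eq_iff)
  have e: "1 + of_real (t - s) * inverse (of_real s - r)
      = (of_real t - r) * inverse (of_real s - r)"
    using nz by (simp add: field_simps)
  show "1 + of_real (t - s) * inverse (of_real s - r) \<noteq> 0" unfolding e using nz by simp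
  show "inverse (of_real s - r) / (1 + of_real (t - s) * inverse (of_real s - r))
      = inverse (of_real t - r)"
    unfolding e using nz by (simp add: field_simps)
qed

text \<open>Independence of the coupling constant: \<open>s\<close> belongs to the contour integral,
  \<open>t\<close> to the operator whose projection it is.\<close>

lemma P_idem_riesz:
  assumes z: "Im z \<noteq> 0" and r: "Im r \<noteq> 0"
  shows "riesz (A_op H0 F J z t) (inverse (of_real t - r)) (P_idem H0 F J s z r)"
  using riesz_Moebius[OF A_clinear[OF z] A_clinear[OF z] _ _ P_idem_riesz_same[OF assms]
      resonance_point_shift(1)[OF r, of t s], unfolded resonance_point_shift(2)[OF r]]
    A_identity[OF z, of s _ t] A_identity[OF z, of t _ s]
  by (metis (no_types, lifting) minus_diff_eq of_real_minus scaleC.minus_left)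

lemma Q_idem_riesz:
  assumes z: "Im z \<noteq> 0" and r: "Im r \<noteq> 0"
  shows "riesz (B_op H0 F J z t) (inverse (of_real t - r)) (Q_idem H0 F J s z r)"
  using riesz_Moebius[OF B_clinear[OF z] B_clinear[OF z] _ _ Q_idem_riesz_same[OF assms]
      resonance_point_shift(1)[OF r, of t s], unfolded resonance_point_shift(2)[OF r]]
    B_identity[OF z, of s _ t] B_identity[OF z, of t _ s]
  by (metis (no_types, lifting) minus_diff_eq of_real_minus scaleC.minus_left)

lemma P_Q_adjoint:
  assumes z: "Im z \<noteq> 0" and r: "Im r \<noteq> 0"
  shows "cinner (Q_idem H0 F J s (cnj z) (cnj r) x) y = cinner x (P_idem H0 F J t z r y)"
proof -
  have zr: "Im (cnj z) \<noteq> 0" "Im (cnj r) \<noteq> 0" using assms by auto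
  \<comment> \<open>The two idempotents come from possibly different constants \<open>s\<close> and
    \<open>t\<close>; both are regarded as projections at the common constant 0.\<close>
  have Q: "riesz (B_op H0 F J (cnj z) 0) (cnj (inverse (of_real 0 - r)))
      (Q_idem H0 F J s (cnj z) (cnj r))"
    using Q_idem_riesz[OF zr, of 0 s] by simp
  show ?thesis
    by (rule riesz_adjoint[OF A_clinear[OF z] P_idem_riesz[OF assms] B_clinear[OF zr(1)] Q
          A_B_adjoint[OF z]])
qed

text \<open>By the resolvent identity, \<open>A\<^sub>z(s)\<close> stays bounded near every real coupling constant.\<close>

lemma resonance_point_not_real:
  assumes z: "Im z \<noteq> 0" and r: "resonance_point H0 F J z r"
  shows "Im r \<noteq> 0"
proof
  assume "Im r = 0"
  then obtain t where t: "r = of_real t" by (metis complex_is_Real_iff Reals_cases)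
  define C where "C = norm (A_op H0 F J z t)"
  obtain G where G: "\<And>s. G (complex_of_real s) = A_op H0 F J z s" "is_pole G r"
    using r unfolding resonance_point_def by blast
  \<comment> \<open>The threshold lies one above the bound \<open>2 * C\<close> that the resolvent
    identity gives at nearby real points, where \<open>G\<close> agrees with
    \<open>A_op\<close>.\<close>
  have "eventually (\<lambda>w. 2 * C + 1 \<le> norm (G w)) (at r)"
    using G(2) filterlim_at_infinity[of 0 G "at r"] unfolding is_pole_def
    by (simp add: C_def add_nonneg_pos)
  then obtain d where d: "d > 0" "\<And>w. w \<noteq> r \<Longrightarrow> dist w r < d \<Longrightarrow> 2 * C + 1 \<le> norm (G w)"
    unfolding eventually_at by auto
  \<comment> \<open>The first bound keeps t + \<delta> where the pole makes \<open>G\<close> large;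
    the second gives \<open>\<delta> * C \<le> 1 / 2\<close>, so that the identity absorbs half of
    \<open>a\<close>.\<close>
  define \<delta> where "\<delta> = min (d / 2) (1 / (2 * (C + 1)))"
  have C: "C \<ge> 0" by (simp add: C_def)
  have \<delta>: "\<delta> > 0" "\<delta> < d" "\<delta> * C \<le> 1 / 2"
  proof -
    show "\<delta> > 0" "\<delta> < d" using d(1) C by (auto simp: \<delta>_def)
    have "\<delta> * C \<le> 1 / (2 * (C + 1)) * (C + 1)"
      using C by (intro mult_mono) (auto simp: \<delta>_def)
    also have "\<dots> = 1 / 2" using C by simp
    finally show "\<delta> * C \<le> 1 / 2" .
  qed
  define a where "a = norm (A_op H0 F J z (t + \<delta>))"
  have "A_op H0 F J z (t + \<delta>)
      = A_op H0 F J z t - of_real \<delta> *\<^sub>C (A_op H0 F J z (t + \<delta>) o\<^sub>L A_op H0 F J z t)"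
    by (rule blinfun_eqI)
      (use A_identity[OF z, of t _ "t + \<delta>"] in \<open>simp add: blinfun.diff_left algebra_simps\<close>)
  then have "a \<le> C + norm (of_real \<delta> *\<^sub>C (A_op H0 F J z (t + \<delta>) o\<^sub>L A_op H0 F J z t))"
    unfolding a_def C_def by (metis norm_triangle_ineq4)
  also have "\<dots> \<le> C + \<delta> * (a * C)"
    using \<delta>(1) norm_blinfun_compose[of "A_op H0 F J z (t + \<delta>)" "A_op H0 F J z t"]
    by (simp add: norm_scaleC a_def C_def mult_left_mono)
  also have "\<delta> * (a * C) \<le> a * (1 / 2)"
    using mult_left_mono[OF \<delta>(3), of a] by (simp add: a_def mult_ac)
  finally have "a \<le> 2 * C" by simp
  moreover have "2 * C + 1 \<le> a"
    using d(2)[of "of_real (t + \<delta>)"] \<delta> unfolding G(1) t a_def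
    by (simp add: dist_norm)
  ultimately show False by simp
qed

end

section \<open>The spectral theorem for finite-rank self-adjoint operators\<close>

text \<open>The vector p(M) v, evaluated by Horner's scheme.\<close>

definition poly_at :: "('a::complex_normed_vector \<Rightarrow>\<^sub>L 'a) \<Rightarrow> 'a \<Rightarrow> complex poly \<Rightarrow> 'a" where
  "poly_at M v p = fold_coeffs (\<lambda>a w. a *\<^sub>C v + M w) p 0"

lemma poly_at_0 [simp]: "poly_at M v 0 = 0"
  by (simp add: poly_at_def)

lemma poly_at_pCons [simp]: "poly_at M v (pCons a p) = a *\<^sub>C v + M (poly_at M v p)"
  by (cases "p = 0 \<and> a = 0")
    (auto simp: poly_at_def fold_coeffs_pCons_coeff_not_0_eq fold_coeffs_pCons_not_0_0_eq
      blinfun.zero_right)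

lemma poly_at_add: "poly_at M v (p + q) = poly_at M v p + poly_at M v q"
  by (induction p q rule: poly_induct2) (simp_all add: scaleC_add_left blinfun.add_right)

lemma poly_at_smult:
  "clinear_op M \<Longrightarrow> poly_at M v (smult c p) = c *\<^sub>C poly_at M v p"
  by (induction p) (simp_all add: scaleC_add_right scaleC_scaleC clinear_op_scaleC scaleC.zero_right)

lemma poly_at_monom: "poly_at M v (monom 1 n) = op_pow M n v"
  by (induction n) (simp_all add: monom_0 monom_Suc blinfun.zero_right)

text \<open>Take a non-zero polynomial p of least degree with p(M) v = 0. Splitting off a root c
  leaves q with q(M) v non-zero by minimality, and M - c annihilates q(M) v.\<close>

lemma eigenvector_exists:
  assumes M: "clinear_op M" and W: "csubspace W" and X: "finite X"
    and WX: "W \<subseteq> cspan X" and inv: "\<And>x. x \<in> W \<Longrightarrow> M x \<in> W"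
    and v: "v \<in> W" "v \<noteq> 0"
  shows "\<exists>x c. x \<in> W \<and> x \<noteq> 0 \<and> M x = c *\<^sub>C x"
proof -
  have iter: "op_pow M n v \<in> W" for n
    by (induction n) (auto simp: v inv)
  have "\<exists>n. op_pow M n v \<in> cspan ((\<lambda>i. op_pow M i v) ` {..<n})"
  proof (rule ccontr)
    assume contra: "\<not> ?thesis"
    have "cindependent ((\<lambda>i. op_pow M i v) ` {..<n}) \<and>
        card ((\<lambda>i. op_pow M i v) ` {..<n}) = n" for n
    proof (induction n)
      case (Suc n)
      have notin: "op_pow M n v \<notin> cspan ((\<lambda>i. op_pow M i v) ` {..<n})"
        using contra by blast
      then have "op_pow M n v \<notin> (\<lambda>i. op_pow M i v) ` {..<n}"
        by (meson complex_vector.span_base)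
      then show ?case
        unfolding lessThan_Suc image_insert
        using Suc.IH complex_vector.independent_insertI[OF notin] by simp
    qed (simp add: complex_vector.independent_empty)
    from this[of "Suc (card X)"] show False
      using complex_vector.independent_span_bound[OF X] iter WX
      by (metis (no_types, lifting) Suc_n_not_le_n image_subsetI subsetD)
  qed
  then obtain n where n:
    "op_pow M n v \<in> cspan ((\<lambda>i. op_pow M i v) ` {..<n})" ..
  \<comment> \<open>The condition on the coefficients keeps the degree of q below n, so that X^n - q
    is a non-zero annihilating polynomial of v.\<close>
  have "\<exists>q. poly_at M v q = x \<and> (\<forall>i\<ge>n. coeff q i = 0)"
    if "x \<in> cspan ((\<lambda>i. op_pow M i v) ` {..<n})" for x
    using that
  proof (induction rule: complex_vector.span_induct_alt)
    case base
    show ?case by (rule exI[of _ 0]) simp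
  next
    case (step c b y)
    then obtain i q where i: "i < n" "b = op_pow M i v"
      and q: "poly_at M v q = y" "\<forall>i\<ge>n. coeff q i = 0" by auto
    show ?case
      using i q
      by (intro exI[of _ "smult c (monom 1 i) + q"])
        (auto simp: poly_at_add poly_at_smult[OF M] poly_at_monom)
  qed
  then obtain q where q: "poly_at M v q = op_pow M n v" "\<forall>i\<ge>n. coeff q i = 0"
    using n by blast
  have "coeff (smult (- 1) q + monom 1 n) n = 1" using q(2) by simp
  then have "smult (- 1) q + monom 1 n \<noteq> 0" by (metis coeff_0 zero_neq_one)
  moreover have "poly_at M v (smult (- 1) q + monom 1 n) = 0"
    by (simp only: poly_at_add poly_at_smult[OF M] poly_at_monom q(1)) (simp add: scaleC.minus_left)
  ultimately have "\<exists>p. p \<noteq> 0 \<and> poly_at M v p = 0" by blast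
  then obtain p where p: "p \<noteq> 0" "poly_at M v p = 0"
    and least: "\<And>q. q \<noteq> 0 \<Longrightarrow> poly_at M v q = 0 \<Longrightarrow> degree p \<le> degree q"
    using ex_has_least_nat[of "\<lambda>p. p \<noteq> 0 \<and> poly_at M v p = 0" _ degree] by blast
  have "degree p \<noteq> 0"
  proof
    assume "degree p = 0"
    then obtain a where a: "p = [:a:]" by (rule degree_eq_zeroE)
    then show False using p v by (simp add: blinfun.zero_right)
  qed
  then obtain c where "poly p c = 0"
    using alg_closed_imp_poly_has_root[of p] by auto
  then obtain q where q: "p = [:- c, 1:] * q" by (auto simp: poly_eq_0_iff_dvd)
  have "q \<noteq> 0" using p(1) q by auto
  then have "degree p = Suc (degree q)" 
    unfolding q by (subst degree_mult_eq) (simp_all del: mult_pCons_left)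
  then have nz: "poly_at M v q \<noteq> 0" using least[of q] \<open>q \<noteq> 0\<close> by auto
  have "p = smult (- c) q + pCons 0 q" by (simp add: q)
  then have "poly_at M v p = (- c) *\<^sub>C poly_at M v q + M (poly_at M v q)"
    by (simp only: poly_at_add poly_at_smult[OF M] poly_at_pCons) simp
  then have "M (poly_at M v q) = c *\<^sub>C poly_at M v q"
    using p(2) by (simp add: scaleC.minus_left)
  moreover have "poly_at M v q \<in> W" for q
    by (induction q)
      (auto intro!: complex_vector.subspace_add[OF W] complex_vector.subspace_scale[OF W] inv v
        complex_vector.subspace_0[OF W])
  ultimately show ?thesis using nz by blast
qed

lemma dim_strict_mono:
  assumes S: "csubspace S" and T: "csubspace T" and ST: "S \<subseteq> T" "e \<in> T" "e \<notin> S"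
    and X: "finite X" "T \<subseteq> cspan X"
  shows "cdim S < cdim T"
proof -
  obtain B where B: "finite B" "B \<subseteq> S" "cindependent B" "cspan B = S" "card B = cdim S"
    using finite_basis_exists[OF S X(1) order_trans[OF ST(1) X(2)]] .
  obtain Y where Y: "finite Y" "cspan Y = T" "card Y = cdim T"
    using finite_basis_exists[OF T X] by metis
  have "cindependent (insert e B)"
    using complex_vector.independent_insertI[OF _ B(3)] ST(3) B(4) by metis
  moreover have "insert e B \<subseteq> cspan Y" using B(2) ST Y(2) by auto
  ultimately have "card (insert e B) \<le> card Y"
    using complex_vector.independent_span_bound[OF Y(1)] by blast
  moreover have "e \<notin> B" using B(2) ST(3) by blast
  ultimately show ?thesis using B(1,5) Y(3) by simp
qed

lemma self_adjoint_opD: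
  assumes "self_adjoint_op M"
  shows "clinear_op M" "cinner (M x) y = cinner x (M y)"
  using assms by (auto simp: self_adjoint_op_def)

text \<open>Deflation: subtracting c |e><e| for a unit eigenvector e lowers the rank. Looking for e
  inside the range of M keeps the eigenvalue away from 0.\<close>

theorem spectral_decomposition:
  fixes M :: "'a::complex_inner \<Rightarrow>\<^sub>L 'a"
  assumes "self_adjoint_op M" "finite_rank M"
  shows "\<exists>E (m :: 'a \<Rightarrow> real). finite E \<and> orthonormal E \<and> (\<forall>e\<in>E. m e \<noteq> 0) \<and>
    (\<forall>x. M x = (\<Sum>e\<in>E. (of_real (m e) * cinner e x) *\<^sub>C e))"
  using assms
proof (induction "cdim (op_range M)" arbitrary: M rule: less_induct)
  case (less M)
  note cM = self_adjoint_opD(1)[OF less.prems(1)]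
  note sym = self_adjoint_opD(2)[OF less.prems(1)]
  obtain X where X: "finite X" "op_range M \<subseteq> cspan X"
    using less.prems(2) by (auto simp: finite_rank_def)
  show ?case
  proof (cases "\<forall>x. M x = 0")
    case True
    then show ?thesis by (intro exI[of _ "{}"]) (simp add: orthonormal_def)
  next
    case False
    then obtain v where v: "v \<in> op_range M" "v \<noteq> 0" by blast
    obtain x c where x: "x \<in> op_range M" "x \<noteq> 0" "M x = c *\<^sub>C x"
      using eigenvector_exists[OF cM subspace_range[OF cM] X _ v] by blast
    define e where "e = (1 / of_real (norm x)) *\<^sub>C x"
    have e_range: "e \<in> op_range M"
      unfolding e_def by (rule complex_vector.subspace_scale[OF subspace_range[OF cM] x(1)])
    have ee: "cinner e e = 1"
      using x(2) by (simp add: e_def cinner_self norm_scaleC norm_divide)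
    have Me: "M e = c *\<^sub>C e"
      by (simp add: e_def clinear_op_scaleC[OF cM] x(3) scaleC_scaleC mult.commute)
    have "cnj c = c" using sym[of e e] ee by (simp add: Me cinner_simps)
    then obtain l where l: "c = of_real l" by (metis Reals_cnj_iff Reals_cases)
    \<comment> \<open>A vector of the range that M kills would be orthogonal to itself, because e =
      M y gives <e, e> = <y, M e>.\<close>
    have "l \<noteq> 0"
    proof
      assume "l = 0"
      obtain y where y: "e = M y" using e_range by blast
      have "cinner e e = cinner y (M e)" using sym[of y e] y by simp
      then show False using ee by (simp add: Me l \<open>l = 0\<close> cinner.zero_right)
    qed
    define M' where "M' = M - c *\<^sub>C rank_one e e"
    have M': "M' y = M y - (c * cinner e y) *\<^sub>C e" for y
      by (simp add: M'_def blinfun.diff_left scaleC_scaleC)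
    have cM': "clinear_op M'"
      unfolding M'_def by (intro clinear_op_intros cM clinear_op_rank_one)
    have sa: "self_adjoint_op M'"
      unfolding self_adjoint_op_def
      using sym cinner_commute[of _ e]
      by (auto simp: cM' M' cinner_simps l)
    have M'_alt: "M' y = M (y - cinner e y *\<^sub>C e)" for y
      by (simp add: M' blinfun.diff_right clinear_op_scaleC[OF cM] Me scaleC_scaleC mult.commute)
    have range_sub: "op_range M' \<subseteq> op_range M"
      using M'_alt by auto
    then have fr: "finite_rank M'" using X by (auto simp: finite_rank_def)
    have eM': "cinner e (M' y) = 0" for y
      using sym[of e y] ee by (simp add: M' cinner_simps Me l)
    have "e \<notin> op_range M'" using eM' ee by auto
    then have "cdim (op_range M') < cdim (op_range M)"
      by (intro dim_strict_mono[OF subspace_range[OF cM'] subspace_range[OF cM] range_sub e_range _ X])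
    from less.hyps[OF this sa fr] obtain E m where E: "finite E" "orthonormal E" "\<forall>e\<in>E. m e \<noteq> (0::real)"
      "\<And>x. M' x = (\<Sum>e\<in>E. (of_real (m e) * cinner e x) *\<^sub>C e)" by blast
    \<comment> \<open>As an eigenvector of M' with non-zero eigenvalue, e' is a multiple of a vector
      in the range of M', and that range is orthogonal to e.\<close>
    have orth: "cinner e e' = 0" if e': "e' \<in> E" for e'
    proof -
      have "M' e' = (\<Sum>d\<in>E. if d = e' then of_real (m e') *\<^sub>C e' else 0)"
        unfolding E(4) using E(2) e' by (intro sum.cong) (auto simp: orthonormal_def)
      then have "M' e' = of_real (m e') *\<^sub>C e'" using E(1) e' by simp
      then show ?thesis using eM'[of e'] E(3) e' by (simp add: cinner_scaleC_right)
    qed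
    have orth': "cinner e' e = 0" if "e' \<in> E" for e'
      using orth[OF that] cinner_commute[of e' e] by simp
    have eE: "e \<notin> E" using orth[of e] ee by auto
    have "M y = (\<Sum>d\<in>insert e E. (of_real ((m(e := l)) d) * cinner d y) *\<^sub>C d)" for y
    proof -
      have "(\<Sum>d\<in>E. (of_real ((m(e := l)) d) * cinner d y) *\<^sub>C d) = M' y"
        unfolding E(4) using eE by (intro sum.cong) auto
      then show ?thesis using E(1) eE by (simp add: M' l del: fun_upd_apply) simp
    qed
    moreover have "orthonormal (insert e E)"
      using E(2) ee orth orth' unfolding orthonormal_def by (metis insert_iff zero_neq_one)
    ultimately show ?thesis
      using E(1,3) \<open>l \<noteq> 0\<close> by (intro exI[of _ "insert e E"] exI[of _ "m(e := l)"]) auto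
  qed
qed

section \<open>Positive and negative parts\<close>

lemma positive_opD:
  assumes "positive_op B"
  shows "clinear_op B" "Im (cinner x (B x)) = 0" "0 \<le> Re (cinner x (B x))"
proof -
  have "cinner x (B x) \<in> \<real>\<^sub>\<ge>\<^sub>0" and c: "clinear_op B" using assms by (auto simp: positive_op_def)
  then show "Im (cinner x (B x)) = 0" "0 \<le> Re (cinner x (B x))"
    by (auto simp: complex_nonneg_Reals_iff)
  show "clinear_op B" by (rule c)
qed

lemma positive_opI:
  assumes "clinear_op B" "\<And>x. Im (cinner x (B x)) = 0" "\<And>x. 0 \<le> Re (cinner x (B x))"
  shows "positive_op B"
  using assms by (simp add: positive_op_def complex_nonneg_Reals_iff)

text \<open>Polarization: reality of the form at x + y and at x + i y fixes the imaginary and the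
  real parts, respectively.\<close>

lemma positive_op_symmetric:
  assumes B: "positive_op B"
  shows "cinner (B x) y = cinner x (B y)"
proof -
  note cB = positive_opD(1)[OF B] and im = positive_opD(2)[OF B]
  have 1: "Im (cinner x (B y)) + Im (cinner y (B x)) = 0"
    using im[of "x + y"] im[of x] im[of y] by (simp add: blinfun.add_right cinner_simps)
  have "Re (cinner x (B y)) - Re (cinner y (B x)) = 0"
    using im[of "x + \<i> *\<^sub>C y"] im[of x] im[of y]
    by (simp add: blinfun.add_right cinner_simps clinear_op_scaleC[OF cB])
  with 1 show ?thesis
    using cinner_commute[of "B x" y] by (simp add: complex_eq_iff)
qed

text \<open>Along x + t B x the form is a non-negative quadratic in t without constant term, so its
  linear coefficient, twice the squared norm of B x, must vanish.\<close>

lemma positive_op_zero: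
  assumes B: "positive_op B" and x: "Re (cinner x (B x)) = 0"
  shows "B x = 0"
proof -
  note cB = positive_opD(1)[OF B]
  define a where "a = (norm (B x))\<^sup>2"
  define b where "b = Re (cinner (B x) (B (B x)))"
  have b: "b \<ge> 0" unfolding b_def by (rule positive_opD(3)[OF B])
  have ineq: "0 \<le> 2 * t * a + t * t * b" for t :: real
  proof -
    have "cinner x (B (B x)) = cinner (B x) (B x)" using positive_op_symmetric[OF B] by simp
    then have "Re (cinner (x + of_real t *\<^sub>C B x) (B (x + of_real t *\<^sub>C B x)))
        = 2 * t * a + t * t * b"
      using x by (simp add: blinfun.add_right cinner_simps clinear_op_scaleC[OF cB] a_def b_def
          cinner_self algebra_simps del: of_real_power)
    then show ?thesis using positive_opD(3)[OF B] by metis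
  qed
  have "a = 0"
  proof (rule ccontr)
    assume "a \<noteq> 0"
    then have a: "a > 0" by (simp add: a_def)
    \<comment> \<open>Small enough that the linear term dominates at - t; adding 1 covers b =
      0.\<close>
    define t where "t = a / (b + 1)"
    have t: "t > 0" "t * b \<le> a" using a b by (auto simp: t_def field_simps)
    have "2 * (- t) * a + (- t) * (- t) * b = t * (t * b - 2 * a)" by (simp add: algebra_simps)
    also have "\<dots> < 0" using t a by (intro mult_pos_neg) auto
    finally show False using ineq[of "- t"] by simp
  qed
  then show ?thesis by (simp add: a_def)
qed

lemma positive_product_zero_commute:
  assumes "positive_op B" "positive_op C" "B o\<^sub>L C = 0"
  shows "C (B x) = 0" "B (C x) = 0"
proof -
  show *: "B (C x) = 0" for x using arg_cong[OF assms(3), of "\<lambda>A. blinfun_apply A x"] by simp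
  show "C (B x) = 0"
  proof (rule cinner_ext)
    fix y
    have "cinner y (C (B x)) = cinner (B (C y)) x"
      by (simp add: positive_op_symmetric[OF assms(1)] positive_op_symmetric[OF assms(2)])
    then show "cinner y (C (B x)) = cinner y 0" by (simp add: * cinner.zero_left cinner.zero_right)
  qed
qed

lemma weighted_projection_positive:
  fixes m :: "'a::complex_inner \<Rightarrow> real"
  assumes "finite E" "\<And>e. e \<in> E \<Longrightarrow> 0 \<le> m e"
  shows "positive_op (\<Sum>e\<in>E. of_real (m e) *\<^sub>C rank_one e e)"
proof (rule positive_opI)
  show "clinear_op (\<Sum>e\<in>E. of_real (m e) *\<^sub>C rank_one e e)"
    by (intro clinear_op_sum clinear_op_cmult clinear_op_rank_one)
  have "cinner x ((\<Sum>e\<in>E. of_real (m e) *\<^sub>C rank_one e e) x)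
      = of_real (\<Sum>e\<in>E. m e * (cmod (cinner e x))\<^sup>2)" for x
  proof -
    have "cinner x ((of_real (m e) *\<^sub>C rank_one e e) x) = of_real (m e * (cmod (cinner e x))\<^sup>2)" for e
      using cinner_commute[of x e]
      by (simp add: cinner_scaleC_right complex_norm_square del: of_real_power)
    then show ?thesis by (simp add: blinfun.sum_left cinner.sum_right)
  qed
  then show "Im (cinner x ((\<Sum>e\<in>E. of_real (m e) *\<^sub>C rank_one e e) x)) = 0"
    "0 \<le> Re (cinner x ((\<Sum>e\<in>E. of_real (m e) *\<^sub>C rank_one e e) x))" for x
    using assms by (auto intro!: sum_nonneg)
qed

text \<open>Splitting the eigenvalues by sign gives one decomposition. Since \<open>pos_part\<close>
  is a definite description, it must also be shown that any other positive pair with product 0 acts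
  in the same way on the eigenvectors and on their orthogonal complement.\<close>

theorem pos_neg_parts:
  fixes M :: "'a::complex_inner \<Rightarrow>\<^sub>L 'a"
  assumes "self_adjoint_op M" "finite_rank M"
  shows "positive_op (pos_part M)" "positive_op (neg_part M)"
    "finite_rank (pos_part M)" "finite_rank (neg_part M)"
    "M = pos_part M - neg_part M" "pos_part M o\<^sub>L neg_part M = 0"
proof -
  obtain E and m :: "'a \<Rightarrow> real" where E: "finite E" "orthonormal E" "\<And>e. e \<in> E \<Longrightarrow> m e \<noteq> 0"
    "\<And>x. M x = (\<Sum>e\<in>E. (of_real (m e) * cinner e x) *\<^sub>C e)"
    using spectral_decomposition[OF assms] by blast
  define B where "B = (\<Sum>e\<in>E. of_real (max (m e) 0) *\<^sub>C rank_one e e)"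
  define C where "C = (\<Sum>e\<in>E. of_real (max (- m e) 0) *\<^sub>C rank_one e e)"
  have pB: "positive_op B" unfolding B_def by (rule weighted_projection_positive[OF E(1)]) simp
  have pC: "positive_op C" unfolding C_def by (rule weighted_projection_positive[OF E(1)]) simp
  have fB: "finite_rank B" "finite_rank C"
    unfolding B_def C_def by (intro finite_rank_sum finite_rank_cmult finite_rank_rank_one)+
  have eq: "M = B - C"
  proof (rule blinfun_eqI)
    fix x
    have "(of_real (max (m e) 0) *\<^sub>C rank_one e e) x - (of_real (max (- m e) 0) *\<^sub>C rank_one e e) x
        = (of_real (m e) * cinner e x) *\<^sub>C e" for e
      by (cases "m e \<ge> 0") (simp_all add: scaleC_scaleC max_def scaleC.minus_left blinfun.minus_left)
    then show "M x = (B - C) x"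
      by (simp add: E(4) B_def C_def blinfun.diff_left blinfun.sum_left flip: sum_subtractf)
  qed
  have unit: "cinner e e' = (if e = e' then 1 else 0)" if "e \<in> E" "e' \<in> E" for e e'
    using E(2) that by (simp add: orthonormal_def)
  have Be: "B e = of_real (max (m e) 0) *\<^sub>C e" if e: "e \<in> E" for e
  proof -
    have "B e = (\<Sum>d\<in>E. if d = e then of_real (max (m e) 0) *\<^sub>C e else 0)"
      unfolding B_def blinfun.sum_left using unit e by (intro sum.cong) auto
    then show ?thesis using E(1) e by simp
  qed
  have BC: "B o\<^sub>L C = 0"
  proof (rule blinfun_eqI)
    fix x
    have "B ((of_real (max (- m e) 0) *\<^sub>C rank_one e e) x) = 0" if "e \<in> E" for e
      using Be[OF that]
      by (cases "m e \<ge> 0") (simp_all add: clinear_op_scaleC[OF positive_opD(1)[OF pB]]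
          scaleC.zero_right blinfun.zero_right blinfun.minus_left blinfun.minus_right max_def)
    then show "(B o\<^sub>L C) x = blinfun_apply 0 x"
      by (simp add: C_def blinfun.sum_left blinfun.sum_right)
  qed
  have uniq: "B' = B"
    if "\<exists>C'. positive_op B' \<and> positive_op C' \<and> M = B' - C' \<and> B' o\<^sub>L C' = 0" for B'
  proof -
    obtain C' where B': "positive_op B'" and C': "positive_op C'" and M: "M = B' - C'"
      and BC': "B' o\<^sub>L C' = 0" using \<open>\<exists>C'. _\<close> by blast
    note z = positive_product_zero_commute[OF B' C' BC']
    have Me: "M e = of_real (m e) *\<^sub>C e" if e: "e \<in> E" for e
    proof -
      have "M e = (\<Sum>d\<in>E. if d = e then of_real (m e) *\<^sub>C e else 0)"
        unfolding E(4) using unit e by (intro sum.cong) auto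
      then show ?thesis using E(1) e by simp
    qed
    have B'e: "B' e = B e" if e: "e \<in> E" for e
    proof -
      have d: "B' e - C' e = of_real (m e) *\<^sub>C e"
        using Me[OF e] by (simp add: M blinfun.diff_left)
      show ?thesis
      proof (cases "m e > 0")
        case True
        \<comment> \<open>C' annihilates B' e, so C' e would be an eigenvector of the positive C' at
          the negative value - m e unless it is 0. The other sign is treated in the same way with
          B'.\<close>
        have "- C' (C' e) = of_real (m e) *\<^sub>C C' e"
          using arg_cong[OF d, of C']
          by (simp add: blinfun.diff_right z clinear_op_scaleC[OF positive_opD(1)[OF C']])
        then have "C' (C' e) = - of_real (m e) *\<^sub>C C' e"
          by (metis minus_minus scaleC.minus_left)
        then have "Re (cinner (C' e) (C' (C' e))) = - (m e * (norm (C' e))\<^sup>2)"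
          by (simp add: cinner_simps cinner_self scaleC.minus_left del: of_real_power)
        then have "m e * (norm (C' e))\<^sup>2 \<le> 0" using positive_opD(3)[OF C', of "C' e"] by simp
        then have "C' e = 0" using True by (simp add: mult_le_0_iff)
        then show ?thesis using d True Be[OF e] by simp
      next
        case False
        then have neg: "m e < 0" using E(3)[OF e] by simp
        have "B' (B' e) = of_real (m e) *\<^sub>C B' e"
          using arg_cong[OF d, of B']
          by (simp add: blinfun.diff_right z clinear_op_scaleC[OF positive_opD(1)[OF B']])
        then have "Re (cinner (B' e) (B' (B' e))) = m e * (norm (B' e))\<^sup>2"
          by (simp add: cinner_simps cinner_self del: of_real_power)
        then have "0 \<le> m e * (norm (B' e))\<^sup>2" using positive_opD(3)[OF B', of "B' e"] by simp
        then have "B' e = 0" using neg by (simp add: zero_le_mult_iff)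
        then show ?thesis using neg Be[OF e] by simp
      qed
    qed
    \<comment> \<open>M y = 0 means B' y = C' y; then B' B' y = B' C' y = 0, and symmetry of B'
      gives B' y = 0.\<close>
    have perp: "B' y = 0" if y: "\<And>e. e \<in> E \<Longrightarrow> cinner e y = 0" for y
    proof -
      have "M y = 0" using y by (simp add: E(4))
      then have "B' y = C' y" by (simp add: M blinfun.diff_left)
      then have "B' (B' y) = 0" using z(2) by simp
      then have "cinner (B' y) (B' y) = 0"
        by (simp add: positive_op_symmetric[OF B'] cinner.zero_right)
      then show ?thesis by (simp add: cinner_eq_zero_iff)
    qed
    show "B' = B"
    proof (rule blinfun_eqI)
      fix x
      define y where "y = x - (\<Sum>e\<in>E. cinner e x *\<^sub>C e)"
      have "cinner e y = 0" if e: "e \<in> E" for e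
      proof -
        have "cinner e (\<Sum>d\<in>E. cinner d x *\<^sub>C d) = (\<Sum>d\<in>E. if d = e then cinner e x else 0)"
          unfolding cinner.sum_right using unit e
          by (intro sum.cong) (auto simp: cinner_scaleC_right)
        then show ?thesis using E(1) e by (simp add: y_def cinner_diff_right)
      qed
      note yE = this
      have By: "B y = 0" using yE by (simp add: B_def blinfun.sum_left scaleC.zero_right)
      have x: "x = y + (\<Sum>e\<in>E. cinner e x *\<^sub>C e)" by (simp add: y_def)
      have "B' x = (\<Sum>e\<in>E. cinner e x *\<^sub>C B' e)"
        by (subst x) (simp add: blinfun.add_right perp[OF yE] blinfun.sum_right
            clinear_op_scaleC[OF positive_opD(1)[OF B']])
      also have "\<dots> = (\<Sum>e\<in>E. cinner e x *\<^sub>C B e)" using B'e by simp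
      also have "\<dots> = B x"
        by (subst (2) x) (simp add: blinfun.add_right By blinfun.sum_right
            clinear_op_scaleC[OF positive_opD(1)[OF pB]])
      finally show "B' x = B x" .
    qed
  qed
  have pos: "pos_part M = B"
    unfolding pos_part_def
  proof (rule the_equality)
    show "\<exists>C. positive_op B \<and> positive_op C \<and> M = B - C \<and> B o\<^sub>L C = 0"
      using pB pC eq BC by blast
  qed (rule uniq)
  have neg: "neg_part M = C" unfolding neg_part_def pos using eq by simp
  show "positive_op (pos_part M)" "positive_op (neg_part M)"
    "finite_rank (pos_part M)" "finite_rank (neg_part M)"
    "M = pos_part M - neg_part M" "pos_part M o\<^sub>L neg_part M = 0"
    unfolding pos neg using pB pC fB eq BC by auto
qed

text \<open>As for Sylvester's law of inertia: \<open>P\<close> is injective on the range of \<open>B\<close>, and \<open>B\<close> on the range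
  of \<open>P\<close>.\<close>

lemma rank_positive_part:
  fixes B C M P :: "'a::complex_inner \<Rightarrow>\<^sub>L 'a"
  assumes B: "positive_op B" "finite_rank B" and C: "positive_op C"
    and M: "M = B - C" and BC: "\<And>x. C (B x) = 0"
    and P: "clinear_op P" "finite_rank P" "\<And>x. P (P x) = P x"
    and pos: "\<And>u. P u = u \<Longrightarrow> u \<noteq> 0 \<Longrightarrow> 0 < Re (cinner u (M u))"
    and neg: "\<And>u. P u = 0 \<Longrightarrow> Re (cinner u (M u)) \<le> 0"
  shows "op_rank B = cdim (op_range P)"
proof -
  note cB = positive_opD(1)[OF B(1)]
  obtain X where X: "finite X" "op_range B \<subseteq> cspan X"
    using B(2) by (auto simp: finite_rank_def)
  obtain Y where Y: "finite Y" "op_range P \<subseteq> cspan Y"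
    using P(2) by (auto simp: finite_rank_def)
  have 1: "x = 0" if x: "x \<in> op_range B" "P x = 0" for x
  proof -
    obtain y where y: "x = B y" using x(1) by blast
    have "M x = B x" by (simp add: M blinfun.diff_left y BC)
    then have "Re (cinner x (B x)) = 0"
      using neg[OF x(2)] positive_opD(3)[OF B(1), of x] by simp
    then have "B x = 0" by (rule positive_op_zero[OF B(1)])
    then have "cinner x x = 0"
      using positive_op_symmetric[OF B(1), of y x] y by (simp add: cinner.zero_right)
    then show ?thesis by (simp add: cinner_eq_zero_iff)
  qed
  have 2: "u = 0" if "u \<in> op_range P" "B u = 0" for u
  proof (rule ccontr)
    assume "u \<noteq> 0"
    have "P u = u" using that(1) P(3) by auto
    from pos[OF this \<open>u \<noteq> 0\<close>] have "0 < Re (cinner u (M u))" .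
    then show False
      using positive_opD(3)[OF C, of u] by (simp add: M blinfun.diff_left that(2) cinner_minus_right)
  qed
  have "cdim (op_range B) \<le> cdim (op_range P)"
    by (rule dim_le_of_injective[OF P(1) subspace_range[OF cB] subspace_range[OF P(1)] Y 1]) auto
  moreover have "cdim (op_range P) \<le> cdim (op_range B)"
    by (rule dim_le_of_injective[OF cB subspace_range[OF P(1)] subspace_range[OF cB] X 2]) auto
  ultimately show ?thesis by (simp add: op_rank_def)
qed

section \<open>Dissipativity and definiteness\<close>

text \<open>An eigenvalue \<open>\<nu>\<close> of \<open>N\<close> with \<open>w\<close> orthogonal to the rest of a triangular basis satisfies
  \<open>Im \<langle>w, J N w\<rangle> = Im \<nu> * \<langle>w, J w\<rangle>\<close>; hence a maximal \<open>J\<close>-orthogonal family of \<open>J\<close>-positive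
  vectors with \<open>N\<close>-invariant span is everything.\<close>

lemma dissipative_positive:
  fixes J N :: "'a::complex_inner \<Rightarrow>\<^sub>L 'a"
  assumes J: "self_adjoint_op J" and N: "clinear_op N"
    and W: "csubspace W" "finite X" "W \<subseteq> cspan X"
    and inv: "\<And>x. x \<in> W \<Longrightarrow> N x \<in> W"
    and diss: "\<And>u. u \<in> W \<Longrightarrow> u \<noteq> 0 \<Longrightarrow> 0 < Im (cinner u (J (N u)))"
    and gen: "\<And>V x. csubspace V \<Longrightarrow> x \<in> W \<Longrightarrow> x \<notin> V \<Longrightarrow>
      \<exists>y \<nu> n. y \<in> W \<and> y \<notin> V \<and> 0 < Im \<nu> \<and> op_pow (shifted N \<nu>) n y = 0"
    and u: "u \<in> W" "u \<noteq> 0"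
  shows "0 < Re (cinner u (J u))"
proof -
  note cJ = self_adjoint_opD(1)[OF J] and symJ = self_adjoint_opD(2)[OF J]
  have J_swap: "cinner y (J x) = cnj (cinner x (J y))" for x y
    using cinner_commute[of y "J x"] symJ[of x y] by simp
  have J_real: "Im (cinner x (J x)) = 0" for x
    using J_swap[of x x] by (simp add: complex_eq_iff)
  \<comment> \<open>Positivity together with orthogonality for J makes such a family independent, so
    its size is bounded by \<open>card X\<close> and a largest one exists.\<close>
  define good where "good B \<longleftrightarrow> finite B \<and> B \<subseteq> W \<and>
    (\<forall>b\<in>B. \<forall>c\<in>B. b \<noteq> c \<longrightarrow> cinner b (J c) = 0) \<and>
    (\<forall>b\<in>B. 0 < Re (cinner b (J b))) \<and> (\<forall>b\<in>B. N b \<in> cspan B)" for B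
  have form: "cinner (\<Sum>b\<in>B. c b *\<^sub>C b) (J (\<Sum>b\<in>B. c b *\<^sub>C b))
      = (\<Sum>b\<in>B. of_real ((cmod (c b))\<^sup>2) * cinner b (J b))" if "good B" for B c
  proof -
    have fB: "finite B" and orth: "\<And>b d. b \<in> B \<Longrightarrow> d \<in> B \<Longrightarrow> b \<noteq> d \<Longrightarrow> cinner b (J d) = 0"
      using that by (auto simp: good_def)
    have "cinner (\<Sum>b\<in>B. c b *\<^sub>C b) (J (\<Sum>b\<in>B. c b *\<^sub>C b))
        = (\<Sum>b\<in>B. \<Sum>d\<in>B. cnj (c b) * (c d * cinner b (J d)))"
      by (simp add: cinner.sum_left cinner.sum_right blinfun.sum_right clinear_op_scaleC[OF cJ]
          cinner_scaleC_left cinner_scaleC_right sum_distrib_left)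
        (rule trans[OF sum.swap], simp add: mult.left_commute)
    also have "\<dots> = (\<Sum>b\<in>B. \<Sum>d\<in>B. if d = b then cnj (c b) * (c b * cinner b (J b)) else 0)"
      using orth by (intro sum.cong) auto
    also have "\<dots> = (\<Sum>b\<in>B. cnj (c b) * (c b * cinner b (J b)))"
      using fB by simp
    finally show ?thesis
      by (simp add: complex_norm_square mult_ac del: of_real_power)
  qed
  have pos: "0 < Re (cinner (\<Sum>b\<in>B. c b *\<^sub>C b) (J (\<Sum>b\<in>B. c b *\<^sub>C b)))"
    if g: "good B" and b: "b \<in> B" "c b \<noteq> 0" for B c b
  proof -
    have fB: "finite B" and p: "\<And>b. b \<in> B \<Longrightarrow> 0 < Re (cinner b (J b))"
      using g by (auto simp: good_def)
    have "0 < (\<Sum>b\<in>B. (cmod (c b))\<^sup>2 * Re (cinner b (J b)))"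
    proof (rule sum_pos2[OF fB b(1)])
      show "0 < (cmod (c b))\<^sup>2 * Re (cinner b (J b))" using b p by simp
      show "0 \<le> (cmod (c d))\<^sup>2 * Re (cinner d (J d))" if "d \<in> B" for d
        using less_imp_le[OF p[OF that]] by simp
    qed
    then show ?thesis unfolding form[OF g] by simp
  qed
  have indep: "cindependent B" if g: "good B" for B
  proof (rule complex_vector.independent_if_scalars_zero)
    show "finite B" using g by (simp add: good_def)
    fix c b assume "(\<Sum>x\<in>B. c x *\<^sub>C x) = 0" "b \<in> B"
    then show "c b = 0"
      using pos[OF g, of b c] by (auto simp: cinner.zero_left)
  qed
  have card: "card B \<le> card X" if "good B" for B
    using complex_vector.independent_span_bound[OF W(2) indep[OF that]] that W(3)
    by (auto simp: good_def)
  have empty: "good {}" by (simp add: good_def)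
  have "\<exists>B. good B \<and> (\<forall>B'. good B' \<longrightarrow> card B' \<le> card B)"
    by (rule ex_has_greatest_nat[of good "{}" card "Suc (card X)"])
      (use empty card in \<open>simp_all add: less_Suc_eq_le\<close>)
  then obtain B where B: "good B" and max: "\<And>B'. good B' \<Longrightarrow> card B' \<le> card B"
    by metis
  have fB: "finite B" and BW: "B \<subseteq> W"
    and orth: "\<And>b c. b \<in> B \<Longrightarrow> c \<in> B \<Longrightarrow> b \<noteq> c \<Longrightarrow> cinner b (J c) = 0"
    and bpos: "\<And>b. b \<in> B \<Longrightarrow> 0 < Re (cinner b (J b))"
    and Ninv: "\<And>b. b \<in> B \<Longrightarrow> N b \<in> cspan B"
    using B by (auto simp: good_def)
  have spanW: "cspan B \<subseteq> W" by (rule complex_vector.span_minimal[OF BW W(1)])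
  have Nspan: "N x \<in> cspan B" if "x \<in> cspan B" for x
    using that
    by (induction rule: complex_vector.span_induct_alt)
      (auto simp: blinfun.zero_right complex_vector.span_zero blinfun.add_right
        clinear_op_scaleC[OF N] intro!: complex_vector.span_add complex_vector.span_scale Ninv)
  have "W \<subseteq> cspan B"
  proof (rule ccontr)
    assume "\<not> ?thesis"
    then obtain x where "x \<in> W" "x \<notin> cspan B" by blast
    then obtain y \<nu> n where y: "y \<in> W" "y \<notin> cspan B" and \<nu>: "0 < Im \<nu>"
      and nil: "op_pow (shifted N \<nu>) n y = 0"
      using gen[OF complex_vector.subspace_span] by blast
    have ex: "op_pow (shifted N \<nu>) n y \<in> cspan B"
      by (simp add: nil complex_vector.span_zero)
    \<comment> \<open>The iterate just before the first one to enter the span is outside it, yet is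
      moved into it by N - \<nu>: an eigenvector modulo the span.\<close>
    define k where "k = (LEAST k. op_pow (shifted N \<nu>) k y \<in> cspan B)"
    have k: "op_pow (shifted N \<nu>) k y \<in> cspan B"
      unfolding k_def using ex
      by (rule LeastI[of "\<lambda>k. op_pow (shifted N \<nu>) k y \<in> cspan B"])
    have "k \<noteq> 0" using k y(2) by (cases k) auto
    then obtain j where j: "k = Suc j" using not0_implies_Suc by blast
    define v where "v = op_pow (shifted N \<nu>) j y"
    have vB: "v \<notin> cspan B"
      unfolding v_def using j unfolding k_def
      by (intro not_less_Least[of j "\<lambda>k. op_pow (shifted N \<nu>) k y \<in> cspan B"])
        simp
    have sv: "N v - \<nu> *\<^sub>C v \<in> cspan B"
      using k by (simp add: j v_def shifted_apply)
    have vW: "v \<in> W"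
      unfolding v_def
      by (induction j)
        (auto simp: y(1) shifted_apply intro!: complex_vector.subspace_diff[OF W(1)]
          complex_vector.subspace_scale[OF W(1)] inv)
    \<comment> \<open>Gram-Schmidt for the indefinite form; the denominators are non-zero because
      every member of \<open>B\<close> is J-positive.\<close>
    define p where "p = (\<Sum>b\<in>B. (cinner b (J v) / cinner b (J b)) *\<^sub>C b)"
    define w where "w = v - p"
    have pB: "p \<in> cspan B"
      unfolding p_def
      by (intro complex_vector.span_sum complex_vector.span_scale complex_vector.span_base)
    have wB: "w \<notin> cspan B"
      using vB pB complex_vector.span_add[of w B p] by (auto simp: w_def)
    have wW: "w \<in> W"
      unfolding w_def using vW pB spanW by (intro complex_vector.subspace_diff[OF W(1)]) auto
    have w0: "w \<noteq> 0" using wB complex_vector.span_zero by auto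
    have bw: "cinner b (J w) = 0" if b: "b \<in> B" for b
    proof -
      have nz: "cinner b (J b) \<noteq> 0" using bpos[OF b] by auto
      have "cinner b (J p) = (\<Sum>d\<in>B. if d = b then cinner b (J v) else 0)"
        unfolding p_def blinfun.sum_right cinner.sum_right using orth b nz
        by (intro sum.cong) (auto simp: clinear_op_scaleC[OF cJ] cinner_scaleC_right)
      then show ?thesis using fB b by (simp add: w_def blinfun.diff_right cinner_diff_right)
    qed
    have wb: "cinner w (J b) = 0" if "b \<in> B" for b
      using bw[OF that] J_swap[of w b] by simp
    have wspan: "cinner w (J x) = 0" if "x \<in> cspan B" for x
      using that
      by (induction rule: complex_vector.span_induct_alt)
        (auto simp: blinfun.zero_right cinner.zero_right blinfun.add_right
          clinear_op_scaleC[OF cJ] cinner_add_right cinner_scaleC_right wb)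
    define q where "q = N w - \<nu> *\<^sub>C w"
    have qB: "q \<in> cspan B"
    proof -
      have "q = (N v - \<nu> *\<^sub>C v) - (N p - \<nu> *\<^sub>C p)"
        by (simp add: q_def w_def blinfun.diff_right scaleC.diff_right)
      then show ?thesis
        using sv Nspan[OF pB] pB
        by (auto intro!: complex_vector.span_diff complex_vector.span_scale)
    qed
    have Nw: "N w = \<nu> *\<^sub>C w + q" by (simp add: q_def)
    \<comment> \<open>The remainder q lies in the span of \<open>B\<close>, to which w is
      J-orthogonal. Dissipativity thus makes Im \<nu> times <w, J w> positive, so
      \<open>insert w B\<close> is again good.\<close>
    have "cinner w (J (N w)) = \<nu> * cinner w (J w)"
      by (simp add: Nw blinfun.add_right clinear_op_scaleC[OF cJ] cinner_add_right
          cinner_scaleC_right wspan[OF qB])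
    then have "0 < Im \<nu> * Re (cinner w (J w))"
      using diss[OF wW w0] J_real[of w] by simp
    then have wpos: "0 < Re (cinner w (J w))" using \<nu> by (simp add: zero_less_mult_iff)
    have sub: "cspan B \<subseteq> cspan (insert w B)"
      by (rule complex_vector.span_mono) auto
    have "N w \<in> cspan (insert w B)"
      unfolding Nw
      by (rule complex_vector.span_add[OF complex_vector.span_scale[OF complex_vector.span_base]
            subsetD[OF sub qB]]) simp
    then have "good (insert w B)"
      unfolding good_def using fB BW wW orth bw wb bpos wpos Ninv sub by auto
    from max[OF this] have "card (insert w B) \<le> card B" .
    moreover have "w \<notin> B" using wB complex_vector.span_base by blast
    ultimately show False using fB by simp
  qed
  then have "u \<in> cspan B" using u(1) by blast
  then obtain c where c: "u = (\<Sum>b\<in>B. c b *\<^sub>C b)"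
    using complex_vector.span_finite[OF fB] by auto
  then obtain b where "b \<in> B" "c b \<noteq> 0" using u(2) by (metis (no_types, lifting) scaleC.zero_left sum.neutral)
  then show ?thesis unfolding c by (rule pos[OF B])
qed

section \<open>Sums of Riesz projections\<close>

lemma dim_range_add:
  fixes P P' :: "'a::complex_normed_vector \<Rightarrow>\<^sub>L 'a"
  assumes P: "clinear_op P" "finite_rank P" "\<And>x. P (P x) = P x"
    and P': "clinear_op P'" "finite_rank P'" "\<And>x. P' (P' x) = P' x"
    and z: "\<And>x. P (P' x) = 0" "\<And>x. P' (P x) = 0"
  shows "cdim (op_range (P + P')) = cdim (op_range P) + cdim (op_range P')"
proof -
  obtain X where X: "finite X" "op_range P \<subseteq> cspan X"
    using P(2) by (auto simp: finite_rank_def)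
  obtain B where B: "finite B" "B \<subseteq> op_range P" "cindependent B"
    "cspan B = op_range P" "card B = cdim (op_range P)"
    using finite_basis_exists[OF subspace_range[OF P(1)] X] .
  obtain X' where X': "finite X'" "op_range P' \<subseteq> cspan X'"
    using P'(2) by (auto simp: finite_rank_def)
  obtain B' where B': "finite B'" "B' \<subseteq> op_range P'" "cindependent B'"
    "cspan B' = op_range P'" "card B' = cdim (op_range P')"
    using finite_basis_exists[OF subspace_range[OF P'(1)] X'] .
  have fixB: "P b = b" "P' b = 0" if "b \<in> B" for b
    using B(2) that P(3) z(2) by auto
  have fixB': "P' b = b" "P b = 0" if "b \<in> B'" for b
    using B'(2) that P'(3) z(1) by auto
  have disj: "B \<inter> B' = {}"
  proof (rule ccontr)
    assume "B \<inter> B' \<noteq> {}"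
    then obtain b where "b \<in> B" "b \<in> B'" by blast
    then have "b = 0" using fixB fixB' by metis
    then show False using \<open>b \<in> B\<close> B(3) complex_vector.dependent_zero by blast
  qed
  have ind: "cindependent (B \<union> B')"
  proof (rule complex_vector.independent_if_scalars_zero)
    show "finite (B \<union> B')" using B(1) B'(1) by simp
    fix f x assume s: "(\<Sum>x\<in>B \<union> B'. f x *\<^sub>C x) = 0" and x: "x \<in> B \<union> B'"
    have s': "(\<Sum>x\<in>B. f x *\<^sub>C x) + (\<Sum>x\<in>B'. f x *\<^sub>C x) = 0"
      using s sum.union_disjoint[OF B(1) B'(1) disj] by metis
    have "P ((\<Sum>x\<in>B. f x *\<^sub>C x) + (\<Sum>x\<in>B'. f x *\<^sub>C x)) = (\<Sum>x\<in>B. f x *\<^sub>C x)"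
      using fixB fixB' by (simp add: blinfun.add_right blinfun.sum_right clinear_op_scaleC[OF P(1)]
          scaleC.zero_right)
    then have 1: "(\<Sum>x\<in>B. f x *\<^sub>C x) = 0" unfolding s' by (simp add: blinfun.zero_right)
    then have 2: "(\<Sum>x\<in>B'. f x *\<^sub>C x) = 0" using s' by simp
    show "f x = 0"
      using x complex_vector.independentD[OF B(3,1) subset_refl 1]
        complex_vector.independentD[OF B'(3,1) subset_refl 2] by blast
  qed
  have "cspan (B \<union> B') = op_range (P + P')"
  proof (rule antisym)
    have "b \<in> op_range (P + P')" if "b \<in> B \<union> B'" for b
      using that fixB[of b] fixB'[of b]
      by (intro range_eqI[of _ _ b]) (auto simp: blinfun.add_left)
    then show "cspan (B \<union> B') \<subseteq> op_range (P + P')"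
      by (intro complex_vector.span_minimal subspace_range clinear_op_add P(1) P'(1)) auto
    have "P x + P' x \<in> cspan (B \<union> B')" for x
    proof (rule complex_vector.span_add)
      show "P x \<in> cspan (B \<union> B')"
        using B(4) complex_vector.span_mono[of B "B \<union> B'"] by auto
      show "P' x \<in> cspan (B \<union> B')"
        using B'(4) complex_vector.span_mono[of B' "B \<union> B'"] by auto
    qed
    then show "op_range (P + P') \<subseteq> cspan (B \<union> B')"
      by (auto simp: blinfun.add_left)
  qed
  then have "cdim (op_range (P + P')) = card (B \<union> B')"
    using complex_vector.dim_span_eq_card_independent[OF ind] by simp
  then show ?thesis using card_Un_disjoint[OF B(1) B'(1) disj] B(5) B'(5) by simp
qed

text \<open>The intended instance is A = A_z(s), \<mu> r = 1 / (s - r) and k = Im z.\<close>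

locale riesz_family =
  fixes A :: "'a::complex_inner \<Rightarrow>\<^sub>L 'a" and \<Gamma> :: "complex set"
    and \<mu> :: "complex \<Rightarrow> complex" and P :: "complex \<Rightarrow> 'a \<Rightarrow>\<^sub>L 'a" and k :: real
  assumes A: "clinear_op A" and fin: "finite \<Gamma>" and inj: "inj_on \<mu> \<Gamma>"
    and nonreal: "\<And>r. r \<in> \<Gamma> \<Longrightarrow> Im (\<mu> r) \<noteq> 0"
    and riesz: "\<And>r. r \<in> \<Gamma> \<Longrightarrow> riesz A (\<mu> r) (P r)"
    and k0: "k \<noteq> 0"
begin

definition PS :: "complex set \<Rightarrow> ('a \<Rightarrow>\<^sub>L 'a)" where
  "PS \<Delta> = (\<Sum>r\<in>\<Delta>. P r)"

definition N :: "'a \<Rightarrow>\<^sub>L 'a" where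
  "N = k *\<^sub>R (A o\<^sub>L PS \<Gamma>)"

lemma P_facts:
  assumes "r \<in> \<Gamma>"
  shows "clinear_op (P r)" "finite_rank (P r)" "P r (P r x) = P r x" "A (P r x) = P r (A x)"
    "\<exists>n. \<forall>x. op_pow (shifted A (\<mu> r)) n (P r x) = 0"
  using riesz[OF assms] unfolding riesz_def by auto

lemma P_disjoint:
  assumes "r \<in> \<Gamma>" "r' \<in> \<Gamma>" "r \<noteq> r'"
  shows "P r (P r' x) = 0"
  using riesz_disjoint[OF A riesz[OF assms(1)] riesz[OF assms(2)]] inj_onD[OF inj _ assms(1,2)] assms(3)
  by blast

lemma PS_apply: "PS \<Delta> x = (\<Sum>r\<in>\<Delta>. P r x)"
  by (simp add: PS_def blinfun.sum_left)

lemma P_PS: "\<Delta> \<subseteq> \<Gamma> \<Longrightarrow> r \<in> \<Gamma> \<Longrightarrow> P r (PS \<Delta> x) = (if r \<in> \<Delta> then P r x else 0)"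
proof -
  assume \<Delta>: "\<Delta> \<subseteq> \<Gamma>" "r \<in> \<Gamma>"
  have "P r (PS \<Delta> x) = (\<Sum>r'\<in>\<Delta>. if r' = r then P r x else 0)"
    unfolding PS_apply blinfun.sum_right using \<Delta> P_disjoint[of r] P_facts(3)
    by (intro sum.cong) auto
  then show ?thesis using finite_subset[OF \<Delta>(1) fin] by simp
qed

lemma clinear_PS: "\<Delta> \<subseteq> \<Gamma> \<Longrightarrow> clinear_op (PS \<Delta>)"
  unfolding PS_def by (intro clinear_op_sum P_facts) auto

lemma finite_rank_PS: "\<Delta> \<subseteq> \<Gamma> \<Longrightarrow> finite_rank (PS \<Delta>)"
  unfolding PS_def by (intro finite_rank_sum P_facts) auto

lemma A_PS: "\<Delta> \<subseteq> \<Gamma> \<Longrightarrow> A (PS \<Delta> x) = PS \<Delta> (A x)"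
  unfolding PS_apply blinfun.sum_right by (intro sum.cong P_facts) auto

lemma PS_PS:
  assumes "\<Delta> \<subseteq> \<Gamma>" "\<Delta>' \<subseteq> \<Gamma>"
  shows "PS \<Delta> (PS \<Delta>' x) = PS (\<Delta> \<inter> \<Delta>') x"
proof -
  have "PS \<Delta> (PS \<Delta>' x) = (\<Sum>r\<in>\<Delta>. if r \<in> \<Delta>' then P r x else 0)"
    unfolding PS_apply[of \<Delta>] using assms P_PS[of \<Delta>'] by (intro sum.cong) auto
  then show ?thesis
    unfolding PS_apply[of "\<Delta> \<inter> \<Delta>'"] using finite_subset[OF assms(1) fin]
    by (simp add: sum.inter_restrict)
qed

lemma PS_idem: "\<Delta> \<subseteq> \<Gamma> \<Longrightarrow> PS \<Delta> (PS \<Delta> x) = PS \<Delta> x"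
  by (simp add: PS_PS)

lemma dim_PS:
  assumes "\<Delta> \<subseteq> \<Gamma>"
  shows "cdim (op_range (PS \<Delta>))
    = (\<Sum>r\<in>\<Delta>. cdim (op_range (P r)))"
  using finite_subset[OF assms fin] assms
proof (induction \<Delta> rule: finite_induct)
  case empty
  have "op_range (PS {}) = {0}" by (auto simp: PS_def)
  then show ?case
    using complex_vector.dim_le_card[of "{0}" "{}"] by simp
next
  case (insert r \<Delta>)
  have r: "r \<in> \<Gamma>" "\<Delta> \<subseteq> \<Gamma>" using insert.prems by auto
  have "PS \<Delta> (P r x) = 0" for x
    unfolding PS_apply using insert.hyps(2) r P_disjoint by (intro sum.neutral) auto
  moreover have "P r (PS \<Delta> x) = 0" for x
    using P_PS[OF r(2,1)] insert.hyps(2) by simp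
  moreover have "PS (insert r \<Delta>) = P r + PS \<Delta>"
    using insert.hyps by (simp add: PS_def)
  ultimately show ?case
    using dim_range_add[OF P_facts(1-3)[OF r(1)] clinear_PS[OF r(2)] finite_rank_PS[OF r(2)]
        PS_idem[OF r(2)]] insert.IH[OF r(2)] insert.hyps by simp
qed

section \<open>Spectrum and multiplicities of N\<close>

lemma N_apply: "N x = of_real k *\<^sub>C A (PS \<Gamma> x)"
  by (simp add: N_def blinfun.scaleR_left scaleR_eq_scaleC)

lemma clinear_N: "clinear_op N"
  unfolding N_def scaleR_eq_scaleC by (intro clinear_op_intros A clinear_PS) auto

lemma finite_rank_N: "finite_rank N"
  unfolding N_def scaleR_eq_scaleC
  by (intro finite_rank_cmult finite_rank_compose_left A finite_rank_PS) auto

lemma PS_N: "\<Delta> \<subseteq> \<Gamma> \<Longrightarrow> PS \<Delta> (N x) = N (PS \<Delta> x)"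
  using PS_PS[of \<Delta> \<Gamma>] PS_PS[of \<Gamma> \<Delta>]
  by (simp add: N_apply clinear_op_scaleC[OF clinear_PS] A_PS Int_commute)

lemma P_fixed_PS: "r \<in> \<Gamma> \<Longrightarrow> r \<in> \<Delta> \<Longrightarrow> \<Delta> \<subseteq> \<Gamma> \<Longrightarrow> PS \<Delta> (P r x) = P r x"
proof -
  assume r: "r \<in> \<Gamma>" "r \<in> \<Delta>" "\<Delta> \<subseteq> \<Gamma>"
  have "PS \<Delta> (P r x) = (\<Sum>r'\<in>\<Delta>. if r' = r then P r x else 0)"
    unfolding PS_apply using r P_disjoint P_facts(3) by (intro sum.cong) auto
  then show ?thesis using finite_subset[OF r(3) fin] r by simp
qed

lemma shifted_N_iterate:
  assumes "PS \<Gamma> x = x"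
  shows "op_pow (shifted N (of_real k * \<mu>')) n x
    = of_real k ^ n *\<^sub>C op_pow (shifted A \<mu>') n x"
  using assms
proof (induction n arbitrary: x)
  case (Suc n)
  have s: "shifted N (of_real k * \<mu>') x = of_real k *\<^sub>C shifted A \<mu>' x"
    using Suc.prems by (simp add: shifted_apply N_apply scaleC.diff_right scaleC_scaleC)
  have "PS \<Gamma> (shifted A \<mu>' x) = shifted A \<mu>' x"
    using Suc.prems A_PS[of \<Gamma> x]
    by (simp add: shifted_apply blinfun.diff_right clinear_op_scaleC[OF clinear_PS])
  from Suc.IH[OF this] show ?case
    unfolding funpow_Suc_right comp_apply s
    by (simp add: blinfun_funpow_scaleC[OF clinear_op_shifted[OF clinear_N]] scaleC_scaleC)
qed simp

text \<open>N is 0 on the kernel of \<open>PS \<Gamma>\<close>, so there N - \<nu> is multiplication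
  by the non-zero number - \<nu>, and the component of x in that kernel must vanish.\<close>

lemma generalized_eigenvector_in_range:
  assumes "\<nu> \<noteq> 0" "op_pow (shifted N \<nu>) n x = 0"
  shows "PS \<Gamma> x = x"
proof -
  define y where "y = x - PS \<Gamma> x"
  have comm: "shifted N \<nu> (PS \<Gamma> x) = PS \<Gamma> (shifted N \<nu> x)" for x
    by (rule shifted_commute) (auto simp: clinear_PS PS_N)
  have 0: "op_pow (shifted N \<nu>) n y = 0"
    unfolding y_def blinfun_funpow_diff
    by (simp add: blinfun_funpow_commute[OF comm] assms(2) blinfun.zero_right)
  have "PS \<Gamma> y = 0" by (simp add: y_def blinfun.diff_right PS_idem)
  then have "shifted N \<nu> y = (- \<nu>) *\<^sub>C y"
    by (simp add: shifted_apply N_apply blinfun.zero_right scaleC.zero_right scaleC.minus_left)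
  then have "op_pow (shifted N \<nu>) m y = (- \<nu>) ^ m *\<^sub>C y" for m
    by (induction m)
      (simp_all del: minus_mult_left[symmetric] mult_minus_left
        add: clinear_op_scaleC[OF clinear_op_shifted[OF clinear_N]] scaleC_scaleC mult.commute)
  from this[of n] 0 have "y = 0" using assms(1) by simp
  then show ?thesis by (simp add: y_def)
qed

lemma kernel_component:
  assumes "r \<in> \<Gamma>" "op_pow (shifted A \<mu>') n x = 0" "\<mu>' \<noteq> \<mu> r"
  shows "P r x = 0"
proof -
  obtain m where "op_pow (shifted A (\<mu> r)) m (P r x) = 0"
    using P_facts(5)[OF assms(1)] by blast
  moreover have "op_pow (shifted A \<mu>') n (P r x) = 0"
    using assms(2)
    by (simp add: blinfun_funpow_commute[OF shifted_commute[OF P_facts(1,4)[OF assms(1)]]]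
        blinfun.zero_right)
  ultimately show ?thesis using coprime_nilpotent[OF A assms(3)] by blast
qed

text \<open>A kernel vector is an eigenvector at 0, and 0 differs from every \<mu> r because these
  are not real; each component \<open>P r x\<close> therefore vanishes.\<close>

lemma A_injective_on_range:
  assumes "PS \<Gamma> x = x" "A x = 0"
  shows "x = 0"
proof -
  have "P r x = 0" if r: "r \<in> \<Gamma>" for r
    by (rule kernel_component[OF r, where \<mu>' = 0 and n = 1]) (use assms(2) nonreal[OF r] in \<open>auto simp: shifted_apply\<close>)
  then have "PS \<Gamma> x = 0" unfolding PS_apply by simp
  then show ?thesis using assms(1) by simp
qed

lemma generalized_eigenspace:
  assumes r: "r \<in> \<Gamma>"
  shows "{x. \<exists>n. op_pow (shifted N (of_real k * \<mu> r)) n x = 0} = op_range (P r)"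
proof (intro antisym subsetI)
  fix x assume "x \<in> op_range (P r)"
  then have x: "P r x = x" using P_facts(3)[OF r] by auto
  then have "PS \<Gamma> x = x" using P_fixed_PS[OF r r subset_refl, of x] by simp
  moreover obtain n where "op_pow (shifted A (\<mu> r)) n x = 0"
    using P_facts(5)[OF r] x by metis
  ultimately have "op_pow (shifted N (of_real k * \<mu> r)) n x = 0"
    by (simp add: shifted_N_iterate scaleC.zero_right)
  then show "x \<in> {x. \<exists>n. op_pow (shifted N (of_real k * \<mu> r)) n x = 0}" by blast
next
  fix x assume "x \<in> {x. \<exists>n. op_pow (shifted N (of_real k * \<mu> r)) n x = 0}"
  then obtain n where n: "op_pow (shifted N (of_real k * \<mu> r)) n x = 0" by blast
  have "of_real k * \<mu> r \<noteq> 0" using k0 nonreal[OF r] by auto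
  then have x: "PS \<Gamma> x = x" using generalized_eigenvector_in_range n by blast
  have "op_pow (shifted A (\<mu> r)) n x = 0"
    using n k0 unfolding shifted_N_iterate[OF x] by simp
  then have "P r' x = 0" if "r' \<in> \<Gamma>" "r' \<noteq> r" for r'
    using kernel_component[OF that(1)] inj_onD[OF inj _ that(1) r] that(2) by metis
  then have "(\<Sum>r'\<in>\<Gamma>. P r' x) = (\<Sum>r'\<in>\<Gamma>. if r' = r then P r x else 0)"
    by (intro sum.cong) auto
  then have "x = P r x" using x fin r unfolding PS_apply by simp
  then show "x \<in> op_range (P r)" by (rule range_eqI)
qed

lemma alg_mult_N:
  "r \<in> \<Gamma> \<Longrightarrow> alg_mult N (of_real k * \<mu> r) = cdim (op_range (P r))"
  unfolding alg_mult_def generalized_eigenspace ..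

lemma eigenvalue_N:
  assumes "op_eigenvalue N \<nu>" "\<nu> \<noteq> 0"
  shows "\<exists>r\<in>\<Gamma>. \<nu> = of_real k * \<mu> r"
proof (rule ccontr)
  assume contra: "\<not> ?thesis"
  obtain x where x: "x \<noteq> 0" "N x = \<nu> *\<^sub>C x" using assms(1) by (auto simp: op_eigenvalue_def)
  have 1: "op_pow (shifted N \<nu>) 1 x = 0" by (simp add: shifted_apply x(2))
  have PSx: "PS \<Gamma> x = x" by (rule generalized_eigenvector_in_range[OF assms(2) 1])
  define \<mu>' where "\<mu>' = \<nu> / of_real k"
  have \<nu>: "\<nu> = of_real k * \<mu>'" using k0 by (simp add: \<mu>'_def)
  have "op_pow (shifted A \<mu>') 1 x = 0"
    using 1 k0 unfolding \<nu> shifted_N_iterate[OF PSx] by simp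
  then have "P r x = 0" if "r \<in> \<Gamma>" for r
    using kernel_component[OF that] contra \<nu> that by blast
  then have "PS \<Gamma> x = 0" unfolding PS_apply by simp
  then show False using PSx x(1) by simp
qed

text \<open>The locale allows \<open>P r = 0\<close>, in which case k \<mu> r is no eigenvalue; this
  lets the sum over eigenvalues be extended to all of them.\<close>

lemma alg_mult_not_eigenvalue:
  assumes "\<not> op_eigenvalue N \<nu>"
  shows "alg_mult N \<nu> = 0"
proof -
  have "x = 0" if "op_pow (shifted N \<nu>) n x = 0" for n x
    using that
  proof (induction n arbitrary: x)
    case (Suc n)
    then have "shifted N \<nu> x = 0" by (simp only: funpow_Suc_right comp_apply)
    then show ?case using assms by (auto simp: op_eigenvalue_def shifted_apply)
  qed simp
  then have "{x. \<exists>n. op_pow (shifted N \<nu>) n x = 0} \<subseteq> cspan {}"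
    by auto
  from complex_vector.dim_le_card[OF this] show ?thesis unfolding alg_mult_def by simp
qed

lemma sum_alg_mult:
  assumes "\<And>\<nu>. R \<nu> \<Longrightarrow> \<nu> \<noteq> 0"
  shows "(\<Sum>\<nu> | op_eigenvalue N \<nu> \<and> R \<nu>. alg_mult N \<nu>)
    = cdim (op_range (PS {r\<in>\<Gamma>. R (of_real k * \<mu> r)}))"
proof -
  define \<Delta> where "\<Delta> = {r\<in>\<Gamma>. R (of_real k * \<mu> r)}"
  have \<Delta>: "\<Delta> \<subseteq> \<Gamma>" by (auto simp: \<Delta>_def)
  have inj': "inj_on (\<lambda>r. of_real k * \<mu> r) \<Delta>"
    using inj \<Delta> k0 by (auto simp: inj_on_def)
  have "(\<Sum>\<nu> | op_eigenvalue N \<nu> \<and> R \<nu>. alg_mult N \<nu>)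
      = (\<Sum>\<nu>\<in>(\<lambda>r. of_real k * \<mu> r) ` \<Delta>. alg_mult N \<nu>)"
  proof (rule sum.mono_neutral_left)
    show "finite ((\<lambda>r. of_real k * \<mu> r) ` \<Delta>)" using finite_subset[OF \<Delta> fin] by simp
    show "{\<nu>. op_eigenvalue N \<nu> \<and> R \<nu>} \<subseteq> (\<lambda>r. of_real k * \<mu> r) ` \<Delta>"
    proof
      fix \<nu> assume "\<nu> \<in> {\<nu>. op_eigenvalue N \<nu> \<and> R \<nu>}"
      then have \<nu>: "op_eigenvalue N \<nu>" "R \<nu>" by auto
      then obtain r where r: "r \<in> \<Gamma>" "\<nu> = of_real k * \<mu> r"
        using eigenvalue_N[OF \<nu>(1) assms[OF \<nu>(2)]] by auto
      then have "r \<in> \<Delta>" using \<nu>(2) by (simp add: \<Delta>_def)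
      then show "\<nu> \<in> (\<lambda>r. of_real k * \<mu> r) ` \<Delta>" using r(2) by (rule rev_image_eqI)
    qed
    show "\<forall>\<nu>\<in>(\<lambda>r. of_real k * \<mu> r) ` \<Delta> - {\<nu>. op_eigenvalue N \<nu> \<and> R \<nu>}. alg_mult N \<nu> = 0"
    proof
      fix \<nu> assume \<nu>: "\<nu> \<in> (\<lambda>r. of_real k * \<mu> r) ` \<Delta> - {\<nu>. op_eigenvalue N \<nu> \<and> R \<nu>}"
      then have "R \<nu>" by (auto simp: \<Delta>_def)
      with \<nu> have "\<not> op_eigenvalue N \<nu>" by simp
      then show "alg_mult N \<nu> = 0" by (rule alg_mult_not_eigenvalue)
    qed
  qed
  also have "\<dots> = (\<Sum>r\<in>\<Delta>. cdim (op_range (P r)))"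
    using \<Delta> alg_mult_N by (subst sum.reindex[OF inj']) (auto intro!: sum.cong)
  finally show ?thesis using dim_PS[OF \<Delta>] by (simp add: \<Delta>_def)
qed

lemma has_R_index_N: "has_R_index N"
  unfolding has_R_index_def
proof (intro conjI allI impI clinear_N finite_rank_N)
  fix \<nu> assume \<nu>: "op_eigenvalue N \<nu> \<and> \<nu> \<in> \<real>"
  show "\<nu> = 0"
  proof (rule ccontr)
    assume "\<nu> \<noteq> 0"
    then obtain r where r: "r \<in> \<Gamma>" "\<nu> = of_real k * \<mu> r" using eigenvalue_N \<nu> by blast
    then have "Im \<nu> \<noteq> 0" using k0 nonreal[OF r(1)] by simp
    then show False using \<nu> by (simp add: complex_is_Real_iff)
  qed
next
  fix f assume f: "N (N f) = 0"
  have "PS \<Gamma> (N f) = N f" by (simp add: PS_N) (simp add: N_apply PS_idem)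
  moreover have "A (N f) = 0"
    using f k0 calculation unfolding N_apply[of "N f"] by simp
  ultimately show "N f = 0" by (rule A_injective_on_range)
qed

lemma R_index_N:
  "R_index N = int (cdim (op_range (PS {r\<in>\<Gamma>. 0 < Im (of_real k * \<mu> r)})))
    - int (cdim (op_range (PS {r\<in>\<Gamma>. Im (of_real k * \<mu> r) < 0})))"
  unfolding R_index_def
  by (subst sum_alg_mult, force, subst sum_alg_mult, force) (rule refl)

text \<open>Replacing J and N by - J and - N leaves J N, and with it dissipativity, unchanged but
  moves the lower half-plane to the upper one. The negative case thus follows from
  \<open>dissipative_positive\<close> as well, with \<epsilon> = -1.\<close>

lemma definite_on_range:
  fixes J :: "'a \<Rightarrow>\<^sub>L 'a"
  assumes J: "self_adjoint_op J"
    and diss: "\<And>u. PS \<Gamma> u = u \<Longrightarrow> u \<noteq> 0 \<Longrightarrow> 0 < Im (cinner u (J (N u)))"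
  shows "PS {r\<in>\<Gamma>. 0 < Im (of_real k * \<mu> r)} u = u \<Longrightarrow> u \<noteq> 0 \<Longrightarrow> 0 < Re (cinner u (J u))"
    and "PS {r\<in>\<Gamma>. Im (of_real k * \<mu> r) < 0} u = u \<Longrightarrow> u \<noteq> 0 \<Longrightarrow> Re (cinner u (J u)) < 0"
proof -
  have main: "0 < Re (cinner u (J' u))"
    if J': "self_adjoint_op J'" and N': "clinear_op N'" and \<Delta>: "\<Delta> \<subseteq> \<Gamma>"
      and N'u: "\<And>u. N' u = of_real \<epsilon> *\<^sub>C N u" and J'u: "\<And>u. J' u = of_real \<epsilon> *\<^sub>C J u"
      and \<epsilon>: "\<epsilon> * \<epsilon> = 1" and sgn: "\<And>r. r \<in> \<Delta> \<Longrightarrow> 0 < \<epsilon> * Im (of_real k * \<mu> r)"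
      and u: "PS \<Delta> u = u" "u \<noteq> 0"
    for J' N' :: "'a \<Rightarrow>\<^sub>L 'a" and \<Delta> and \<epsilon> :: real and u
  proof -
    define W where "W = op_range (PS \<Delta>)"
    have W: "x \<in> W \<longleftrightarrow> PS \<Delta> x = x" for x
      unfolding W_def using PS_idem[OF \<Delta>] by (metis rangeE rangeI)
    obtain X where X: "finite X" "W \<subseteq> cspan X"
      using finite_rank_PS[OF \<Delta>] unfolding finite_rank_def W_def by blast
    have PSG: "PS \<Gamma> x = x" if "x \<in> W" for x
      using PS_PS[OF subset_refl \<Delta>, of x] that \<Delta> unfolding W by (simp add: Int_absorb1)
    show ?thesis
    proof (rule dissipative_positive[OF J' N' _ X])
      show "csubspace W" unfolding W_def by (rule subspace_range[OF clinear_PS[OF \<Delta>]])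
      show "N' x \<in> W" if "x \<in> W" for x
        using that PS_N[OF \<Delta>, of x] unfolding W N'u
        by (simp add: clinear_op_scaleC[OF clinear_PS[OF \<Delta>]])
      show "0 < Im (cinner x (J' (N' x)))" if "x \<in> W" "x \<noteq> 0" for x
      proof -
        have "J' (N' x) = of_real (\<epsilon> * \<epsilon>) *\<^sub>C J (N x)"
          by (simp add: J'u N'u clinear_op_scaleC[OF self_adjoint_opD(1)[OF J]] scaleC_scaleC)
        then show ?thesis using diss[OF PSG[OF that(1)] that(2)] by (simp add: \<epsilon>)
      qed
      \<comment> \<open>x is the sum of its components \<open>P r x\<close>, and a subspace missing
        x misses one of them, which is a generalized eigenvector.\<close>
      show "\<exists>y \<nu> n. y \<in> W \<and> y \<notin> V \<and> 0 < Im \<nu> \<and> op_pow (shifted N' \<nu>) n y = 0"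
        if V: "csubspace V" and x: "x \<in> W" "x \<notin> V" for V x
      proof -
        have "x = (\<Sum>r\<in>\<Delta>. P r x)" using x(1) unfolding W PS_apply by simp
        then obtain r where r: "r \<in> \<Delta>" "P r x \<notin> V"
          using complex_vector.subspace_sum[OF V, of \<Delta> "\<lambda>r. P r x"] x(2) by metis
        have rG: "r \<in> \<Gamma>" using r(1) \<Delta> by blast
        obtain n where "op_pow (shifted A (\<mu> r)) n (P r x) = 0"
          using P_facts(5)[OF rG] by blast
        then have nil: "op_pow (shifted N (of_real k * \<mu> r)) n (P r x) = 0"
          by (simp add: shifted_N_iterate[OF P_fixed_PS[OF rG rG subset_refl]] scaleC.zero_right)
        have "op_pow (shifted N' (of_real \<epsilon> * (of_real k * \<mu> r))) m y
            = of_real \<epsilon> ^ m *\<^sub>C op_pow (shifted N (of_real k * \<mu> r)) m y" for m y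
        proof (induction m)
          case (Suc m)
          have "shifted N' (of_real \<epsilon> * (of_real k * \<mu> r)) v
              = of_real \<epsilon> *\<^sub>C shifted N (of_real k * \<mu> r) v" for v
            by (simp add: shifted_apply N'u scaleC.diff_right scaleC_scaleC)
          then show ?case
            using Suc.IH
            by (simp add: clinear_op_scaleC[OF clinear_op_shifted[OF clinear_N]] scaleC_scaleC
                mult.commute)
        qed simp
        then have "op_pow (shifted N' (of_real \<epsilon> * (of_real k * \<mu> r))) n (P r x) = 0"
          by (simp add: nil scaleC.zero_right)
        moreover have "0 < Im (of_real \<epsilon> * (of_real k * \<mu> r))" using sgn[OF r(1)] by simp
        moreover have "P r x \<in> W" unfolding W by (rule P_fixed_PS[OF rG r(1) \<Delta>])
        ultimately show ?thesis using r(2) by blast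
      qed
      show "u \<in> W" "u \<noteq> 0" using u W by auto
    qed
  qed
  show "0 < Re (cinner u (J u))" if "PS {r\<in>\<Gamma>. 0 < Im (of_real k * \<mu> r)} u = u" "u \<noteq> 0"
    by (rule main[OF J clinear_N _ _ _ _ _ that, of 1]) auto
  have J': "self_adjoint_op (- J)"
    using J by (simp add: self_adjoint_op_def clinear_op_minus blinfun.minus_left
        cinner_minus_left cinner_minus_right)
  show "Re (cinner u (J u)) < 0" if u: "PS {r\<in>\<Gamma>. Im (of_real k * \<mu> r) < 0} u = u" "u \<noteq> 0"
  proof -
    have "0 < Re (cinner u ((- J) u))"
      by (rule main[OF J' clinear_op_minus[OF clinear_N] _ _ _ _ _ u, of "- 1"])
        (auto simp: blinfun.minus_left scaleC.minus_left)
    then show ?thesis by (simp add: blinfun.minus_left cinner_minus_right)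
  qed
qed

text \<open>The adjoint relation turns M into the compression of J, with form <P x, J P y>. It is
  positive on the range of the idempotent for the upper half-plane and at most 0 on its kernel,
  where P coincides with the idempotent for the lower one. This is the situation of
  \<open>rank_positive_part\<close>, applied to M and to - M.\<close>

theorem signature_eq_R_index:
  fixes J Q :: "'a \<Rightarrow>\<^sub>L 'a"
  assumes J: "self_adjoint_op J" and Q: "clinear_op Q"
    and adj: "\<And>x y. cinner (Q x) y = cinner x (PS \<Gamma> y)"
    and diss: "\<And>u. PS \<Gamma> u = u \<Longrightarrow> u \<noteq> 0 \<Longrightarrow> 0 < Im (cinner u (J (N u)))"
  defines "M \<equiv> Q o\<^sub>L J o\<^sub>L PS \<Gamma>"
  shows "finite_rank M \<and> self_adjoint_op M \<and> has_R_index N \<and> signature M = R_index N"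
proof -
  have M: "cinner x (M y) = cinner (PS \<Gamma> x) (J (PS \<Gamma> y))" for x y
    using adj[of "J (PS \<Gamma> y)" x] cinner_commute[of x "M y"] cinner_commute[of "PS \<Gamma> x"]
    by (simp add: M_def)
  have cPS: "clinear_op (PS \<Gamma>)" by (rule clinear_PS) simp
  have fM: "finite_rank M"
    unfolding M_def
    by (intro finite_rank_compose_left clinear_op_compose Q self_adjoint_opD(1)[OF J]
        finite_rank_PS subset_refl)
  have sM: "self_adjoint_op M"
    unfolding self_adjoint_op_def
  proof (intro conjI allI)
    show "clinear_op M"
      unfolding M_def by (intro clinear_op_compose Q self_adjoint_opD(1)[OF J] cPS)
    show "cinner (M x) y = cinner x (M y)" for x y
      using cinner_commute[of "M x" y] cinner_commute[of "J (PS \<Gamma> x)" "PS \<Gamma> y"]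
        self_adjoint_opD(2)[OF J]
      by (simp add: M)
  qed
  define \<Gamma>p where "\<Gamma>p = {r\<in>\<Gamma>. 0 < Im (of_real k * \<mu> r)}"
  define \<Gamma>n where "\<Gamma>n = {r\<in>\<Gamma>. Im (of_real k * \<mu> r) < 0}"
  have sub: "\<Gamma>p \<subseteq> \<Gamma>" "\<Gamma>n \<subseteq> \<Gamma>" by (auto simp: \<Gamma>p_def \<Gamma>n_def)
  have "Im (of_real k * \<mu> r) < 0 \<or> 0 < Im (of_real k * \<mu> r)" if "r \<in> \<Gamma>" for r
    unfolding neq_iff[symmetric] using nonreal[OF that] k0 by simp
  then have "\<Gamma> = \<Gamma>p \<union> \<Gamma>n" "\<Gamma>p \<inter> \<Gamma>n = {}"
    unfolding \<Gamma>p_def \<Gamma>n_def by force+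
  then have split: "PS \<Gamma> x = PS \<Gamma>p x + PS \<Gamma>n x" for x
    using sum.union_disjoint[of \<Gamma>p \<Gamma>n "\<lambda>r. P r x"] finite_subset[OF _ fin] sub
    unfolding PS_apply by metis
  have Gp: "PS \<Gamma> (PS \<Gamma>p x) = PS \<Gamma>p x" "PS \<Gamma> (PS \<Gamma>n x) = PS \<Gamma>n x" for x
    using PS_PS[OF subset_refl sub(1)] PS_PS[OF subset_refl sub(2)] sub by (simp_all add: Int_absorb1)
  have def_pos: "0 < Re (cinner u (J u))" if "PS \<Gamma>p u = u" "u \<noteq> 0" for u
    by (rule definite_on_range(1)[OF J _ that[unfolded \<Gamma>p_def]]) (rule diss)
  have def_neg: "Re (cinner u (J u)) < 0" if "PS \<Gamma>n u = u" "u \<noteq> 0" for u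
    by (rule definite_on_range(2)[OF J _ that[unfolded \<Gamma>n_def]]) (rule diss)
  note pn = pos_neg_parts[OF sM fM]
  note z = positive_product_zero_commute[OF pn(1,2,6)]
  have "op_rank (pos_part M) = cdim (op_range (PS \<Gamma>p))"
  proof (rule rank_positive_part[OF pn(1,3,2,5) z(1) clinear_PS[OF sub(1)] finite_rank_PS[OF sub(1)]
        PS_idem[OF sub(1)]])
    show "0 < Re (cinner u (M u))" if "PS \<Gamma>p u = u" "u \<noteq> 0" for u
      using def_pos[OF that] Gp(1)[of u] that(1) by (simp add: M)
    show "Re (cinner u (M u)) \<le> 0" if "PS \<Gamma>p u = 0" for u
    proof -
      define v where "v = PS \<Gamma>n u"
      have "PS \<Gamma>n v = v" by (simp add: v_def PS_idem[OF sub(2)])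
      moreover have "PS \<Gamma> u = v" using split[of u] that by (simp add: v_def)
      ultimately show ?thesis
        using def_neg[of v] by (cases "v = 0") (auto simp: M cinner.zero_left)
    qed
  qed
  moreover have "op_rank (neg_part M) = cdim (op_range (PS \<Gamma>n))"
  proof (rule rank_positive_part[where M = "- M", OF pn(2,4,1) _ z(2) clinear_PS[OF sub(2)]
        finite_rank_PS[OF sub(2)] PS_idem[OF sub(2)]])
    show "- M = neg_part M - pos_part M" by (subst pn(5)) simp
    show "0 < Re (cinner u ((- M) u))" if "PS \<Gamma>n u = u" "u \<noteq> 0" for u
      using def_neg[OF that] Gp(2)[of u] that(1) by (simp add: M blinfun.minus_left cinner_minus_right)
    show "Re (cinner u ((- M) u)) \<le> 0" if "PS \<Gamma>n u = 0" for u
    proof -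
      define v where "v = PS \<Gamma>p u"
      have "PS \<Gamma>p v = v" by (simp add: v_def PS_idem[OF sub(1)])
      moreover have "PS \<Gamma> u = v" using split[of u] that by (simp add: v_def)
      ultimately show ?thesis
        using def_pos[of v]
        by (cases "v = 0") (auto simp: M blinfun.minus_left cinner_minus_right cinner.zero_left)
    qed
  qed
  ultimately have "signature M = R_index N"
    unfolding signature_def R_index_N \<Gamma>p_def \<Gamma>n_def by simp
  then show ?thesis using fM sM has_R_index_N by blast
qed

end

context resonance_setting
begin

text \<open>The constants \<open>s\<close>, \<open>s\<^sub>P\<close> and \<open>s\<^sub>Q\<close>
  are unrelated: \<open>P_idem_riesz\<close> takes the idempotents at \<open>s\<^sub>P\<close> as
  Riesz projections of the operator at \<open>s\<close>, and \<open>P_Q_adjoint\<close> joins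
  \<open>s\<^sub>P\<close> with \<open>s\<^sub>Q\<close>.\<close>

theorem signature_of_resonance_matrix:
  fixes s s\<^sub>P s\<^sub>Q :: real
  assumes z: "Im z \<noteq> 0" and \<Gamma>: "finite \<Gamma>" "\<And>r. r \<in> \<Gamma> \<Longrightarrow> resonance_point H0 F J z r"
    and P: "P = P_set H0 F J s\<^sub>P z \<Gamma>"
    and Q: "Q = Q_set H0 F J s\<^sub>Q (cnj z) (cnj ` \<Gamma>)"
    and M: "M = Q o\<^sub>L J o\<^sub>L P"
    and N: "N = Im z *\<^sub>R (A_op H0 F J z s o\<^sub>L P)"
  shows "finite_rank M \<and> self_adjoint_op M \<and> has_R_index N \<and> signature M = R_index N"
proof -
  have nr: "Im r \<noteq> 0" if "r \<in> \<Gamma>" for r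
    using resonance_point_not_real[OF z \<Gamma>(2)[OF that]] .
  define A where "A = A_op H0 F J z s"
  define \<mu> where "\<mu> r = inverse (of_real s - r)" for r :: complex
  interpret R: riesz_family A \<Gamma> \<mu> "P_idem H0 F J s\<^sub>P z" "Im z"
  proof
    show "clinear_op A" unfolding A_def by (rule A_clinear[OF z])
    show "inj_on \<mu> \<Gamma>" by (auto simp: inj_on_def \<mu>_def)
    show "Im (\<mu> r) \<noteq> 0" if "r \<in> \<Gamma>" for r
    proof -
      have "of_real s - r \<noteq> 0" using nr[OF that] by (auto simp: complex_eq_iff)
      then have "(Re (of_real s - r))\<^sup>2 + (Im (of_real s - r))\<^sup>2 \<noteq> 0"
        unfolding cmod_power2[symmetric] by simp
      then show ?thesis using nr[OF that] by (simp add: \<mu>_def)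
    qed
    show "riesz A (\<mu> r) (P_idem H0 F J s\<^sub>P z r)" if "r \<in> \<Gamma>" for r
      unfolding A_def \<mu>_def by (rule P_idem_riesz[OF z nr[OF that]])
  qed (use z \<Gamma> in auto)
  have P': "P = R.PS \<Gamma>" by (simp add: P P_set_def R.PS_def)
  have "inj_on cnj \<Gamma>" by (auto simp: inj_on_def)
  then have Q': "Q = (\<Sum>r\<in>\<Gamma>. Q_idem H0 F J s\<^sub>Q (cnj z) (cnj r))"
    by (simp add: Q Q_set_def sum.reindex)
  have cQ: "clinear_op Q"
    unfolding Q'
  proof (rule clinear_op_sum)
    fix r assume "r \<in> \<Gamma>"
    then have "Im (cnj z) \<noteq> 0" "Im (cnj r) \<noteq> 0" using z nr by auto
    from Q_idem_riesz_same[OF this, of s\<^sub>Q] show "clinear_op (Q_idem H0 F J s\<^sub>Q (cnj z) (cnj r))"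
      by (simp add: riesz_def)
  qed
  have adj: "cinner (Q x) y = cinner x (R.PS \<Gamma> y)" for x y
    unfolding Q' R.PS_apply blinfun.sum_left cinner.sum_left cinner.sum_right
    by (intro sum.cong refl P_Q_adjoint z nr)
  have N': "N = R.N" unfolding N R.N_def P' A_def[symmetric] ..
  have diss: "0 < Im (cinner u (J (R.N u)))" if u: "R.PS \<Gamma> u = u" "u \<noteq> 0" for u
  proof -
    have Au: "A u = T_op H0 F J z s (J u)" by (simp add: A_def A_op_def)
    have "A u \<noteq> 0" using R.A_injective_on_range u by blast
    then have "Im (cinner (J u) (A u)) \<noteq> 0"
      using T_op_imaginary_part(2)[OF z, of "J u" s] unfolding Au by blast
    then have "Im z * Im (cinner (J u) (A u)) \<noteq> 0" using z by simp
    moreover have "0 \<le> Im z * Im (cinner (J u) (A u))"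
      unfolding Au by (rule T_op_imaginary_part(1)[OF z])
    moreover have "Im (cinner u (J (R.N u))) = Im z * Im (cinner (J u) (A u))"
      by (simp add: R.N_apply u(1) cinner_scaleC_right flip: J_cinner)
    ultimately show ?thesis by linarith
  qed
  show ?thesis
    unfolding M N' P' by (rule R.signature_eq_R_index[OF J_self_adjoint cQ adj diss])
qed

end

theorem theorem1p28:
  fixes H0 :: "('h::{chilbert_space,second_countable_topology} \<times> 'h) set"
    and F :: "('h \<times> 'k::{chilbert_space,second_countable_topology}) set"
    and J :: "'k \<Rightarrow>\<^sub>L 'k"
    and D :: "'h set"
    and z :: complex
    and \<Gamma> :: "complex set"
    and s s\<^sub>P s\<^sub>Q :: real
  assumes "resonance_setting H0 F J D"
    and "Im z \<noteq> 0"
    and "finite \<Gamma>"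
    and "\<forall>r\<in>\<Gamma>. resonance_point H0 F J z r"
  shows "let P = P_set H0 F J s\<^sub>P z \<Gamma>;
             M = Q_set H0 F J s\<^sub>Q (cnj z) (cnj ` \<Gamma>) o\<^sub>L J o\<^sub>L P;
             N = Im z *\<^sub>R (A_op H0 F J z s o\<^sub>L P)
         in finite_rank M \<and> self_adjoint_op M \<and> has_R_index N \<and> signature M = R_index N"
proof -
  interpret resonance_setting H0 F J D by fact
  show ?thesis
    unfolding Let_def
    by (rule signature_of_resonance_matrix[OF assms(2,3) _ refl refl refl refl])
      (use assms(4) in blast)
qed


end
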